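(* Let $d\geq 2$. There exists a set $P\subset\mathbb{R}^d$ of full Lebesgue measure such that for every bounded convex set $\mathcal{D}\subset\mathbb{R}^d$ with non-empty interior, every $\alpha\in P$, and every subexponential sequence $(R_i)_{i\geq 1}$, we have \[\sup_i G(\alpha,R_i\mathcal{D})=\infty\qquad\text{and}\qquad \liminf_{i\to\infty} G(\alpha,R_i\mathcal{D})<\infty .\]
   Context: For a bounded set $\mathcal{D}\subset\mathbb{R}^d$ and $\alpha\in\mathbb{R}^d$, let $S(\alpha,\mathcal{D})=\{m\cdot\alpha \bmod 1 \mid m\in\mathbb{Z}^d\cap\mathcal{D}\}\subset\mathbb{R}/\mathbb{Z}$, and let $G(\alpha,\mathcal{D})$ be the number of distinct lengths of the gaps between consecutive elements of $S(\alpha,\mathcal{D})$ on the circle $\mathbb{R}/\mathbb{Z}$ (i.e. the number of distinct lengths of the intervals into which $S(\alpha,\mathcal{D})$ partitions $\mathbb{R}/\mathbb{Z}$). For $R>0$, $R\mathcal{D}=\{Rx\mid x\in\mathcal{D}\}$. A sequence $0<R_1<R_2<\cdots$ is called subexponential if $\lim_{i\to\infty}R_i=\infty$ and $\lim_{i\to\infty}R_{i+1}/R_i=1$. *)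

theory Defs
  imports "HOL-Analysis.Analysis"
begin

definition gap_set :: "real ^ 'n \<Rightarrow> (real ^ 'n) set \<Rightarrow> real set" where
  "gap_set \<alpha> D = {frac (m \<bullet> \<alpha>) | m. m \<in> D \<and> (\<forall>i. m $ i \<in> \<int>)}"

text \<open>Length of the gap on the circle R/Z from x to the next point of the finite set S
  (wrapping around from the largest point to the smallest one).\<close>
definition next_gap :: "real set \<Rightarrow> real \<Rightarrow> real" where
  "next_gap S x = (if \<exists>y\<in>S. x < y then Min {y \<in> S. x < y} - x else 1 + Min S - x)"

definition num_gaps :: "real ^ 'n \<Rightarrow> (real ^ 'n) set \<Rightarrow> nat" where
  "num_gaps \<alpha> D = card (next_gap (gap_set \<alpha> D) ` gap_set \<alpha> D)"

definition scale_set :: "real \<Rightarrow> (real ^ 'n) set \<Rightarrow> (real ^ 'n) set" where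
  "scale_set R D = (\<lambda>x. R *\<^sub>R x) ` D"

definition subexponential :: "(nat \<Rightarrow> real) \<Rightarrow> bool" where
  "subexponential R \<longleftrightarrow> 0 < R 0 \<and> strict_mono R \<and> filterlim R at_top sequentially
     \<and> ((\<lambda>i. R (Suc i) / R i) \<longlonglongrightarrow> 1)"

end

theory Submission
  imports Defs
begin

text \<open>For almost every \<^term>\<open>\<alpha>\<close> there are a constant \<open>c\<close> and arbitrarily large \<open>\<tau>\<close> such that no non-zero
  integer vector of size at most \<open>\<tau>\<close> has \<open>n \<bullet> \<alpha>\<close> within \<open>c / \<tau>\<^sup>d\<close> of an integer.  At such a scale the
  points \<open>n \<bullet> \<alpha>\<close> are separated, hence, by counting, also dense; so all gaps are of order \<open>\<tau>\<^sup>-\<^sup>d\<close> and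
  come from boundedly many differences, which bounds the lower limit.

  For the supremum, consider an \<open>\<alpha>\<close> for which all relevant small values of \<open>n \<bullet> \<alpha>\<close> modulo one come
  from multiples of one short vector \<open>v\<close> and from one translate of these.  From the last point of a row
  in direction \<open>v\<close> one jumps to the first point of the next row, so the gap encodes the length of a
  chord of the convex set, and there are chords of infinitely many lengths.  Near every point at
  a separated scale there is a hole of proportional size consisting of such \<open>\<alpha>\<close>; hence the set of
  points that are structured only at bounded scales is porous and has measure zero.\<close>

section \<open>Integer vectors and gaps\<close>

text \<open>The set \<open>P\<close> may not depend on the convex set, yet the row direction and the
  required accuracy do. Hence \<open>row_structured\<close> carries tolerances, and \<open>P\<close>
  is cut out by countably many directions and accuracies. Both halves are proved on windows of
  scales with ratio two, because a subexponential sequence cannot jump over such a window.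

  The main obstacle is uniformity: porosity needs one hole ratio for all separated \<alpha> and all
  \<tau>. Rescaling the pairs (n, n \<bullet> \<alpha> + k) by 1/\<tau> and \<tau>^d gives a lattice
  without non-zero vectors of norm at most \<open>c\<close> and with covering radius at most some
  \<open>K\<close>; moving \<alpha> shears it. Only these two bounds may enter the constants. They
  give coordinates of bounded distortion in which the lattice contains the integer lattice with a
  bounded common denominator, so that only finitely many vectors have to be avoided. Which ones
  depends on the size of the shear, so the shear must be bounded before they are known; this is why
  \<open>generic_functional\<close> has a bound that is independent of the finite set.\<close>

definition int_vec :: "real ^ 'n \<Rightarrow> bool" where
  "int_vec n \<longleftrightarrow> (\<forall>i. n $ i \<in> \<int>)"

text \<open>Dirichlet's theorem always yields a value of size at most \<tau>^-d at this scale; the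
  condition says that it is sharp up to the factor \<open>c\<close>. The inequality is strict, so
  that failure is a union of closed slabs.\<close>

definition separated :: "real ^ 'n \<Rightarrow> nat \<Rightarrow> real \<Rightarrow> bool" where
  "separated \<alpha> \<tau> c \<longleftrightarrow> (\<forall>n k. int_vec n \<and> n \<noteq> 0 \<and> (\<forall>i. \<bar>n $ i\<bar> \<le> real \<tau>) \<and> k \<in> \<int> \<longrightarrow>
     \<bar>n \<bullet> \<alpha> + k\<bar> > c / real \<tau> ^ CARD('n))"

lemma int_vec_0 [simp]: "int_vec 0"
  by (simp add: int_vec_def)

lemma int_vec_add: "int_vec m \<Longrightarrow> int_vec n \<Longrightarrow> int_vec (m + n)"
  by (simp add: int_vec_def)

lemma int_vec_diff: "int_vec m \<Longrightarrow> int_vec n \<Longrightarrow> int_vec (m - n)"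
  by (simp add: int_vec_def)

lemma int_vec_scaleR: "r \<in> \<int> \<Longrightarrow> int_vec n \<Longrightarrow> int_vec (r *\<^sub>R n)"
  by (simp add: int_vec_def)

lemma norm_le_card_components:
  fixes x :: "real ^ 'n"
  assumes "\<And>i. \<bar>x $ i\<bar> \<le> B"
  shows "norm x \<le> real CARD('n) * B"
proof -
  have "norm x \<le> (\<Sum>i\<in>UNIV. \<bar>x $ i\<bar>)" by (rule norm_le_l1_cart)
  also have "\<dots> \<le> real CARD('n) * B"
    using sum_bounded_above[of UNIV "\<lambda>i. \<bar>x $ i\<bar>" B] assms by simp
  finally show ?thesis .
qed

lemma int_vec_near:
  fixes x :: "real ^ 'n"
  obtains n where "int_vec n" "norm (n - x) \<le> real CARD('n)"
proof -
  define n :: "real ^ 'n" where "n = (\<chi> i. of_int \<lfloor>x $ i\<rfloor>)"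
  have "\<bar>(n - x) $ i\<bar> \<le> 1" for i
    unfolding n_def by simp linarith
  then have "norm (n - x) \<le> real CARD('n) * 1" by (rule norm_le_card_components)
  moreover have "int_vec n" by (simp add: n_def int_vec_def)
  ultimately show thesis using that by simp
qed

lemma finite_int_vec_bounded:
  fixes B :: "(real ^ 'n) set"
  assumes "bounded B"
  shows "finite {n \<in> B. int_vec n}"
proof -
  obtain r where r: "\<And>x. x \<in> B \<Longrightarrow> norm x \<le> r"
    using assms bounded_iff by blast
  let ?F = "{f. \<forall>i::'n. f i \<in> {-\<lceil>r\<rceil>..\<lceil>r\<rceil>}}"
  have "finite (PiE (UNIV :: 'n set) (\<lambda>i. {-\<lceil>r\<rceil>..\<lceil>r\<rceil>}))"
    by (intro finite_PiE) auto
  then have fin: "finite ?F" by (rule rev_finite_subset) (auto simp: PiE_def extensional_def)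
  have "{n \<in> B. int_vec n} \<subseteq> (\<lambda>f. \<chi> i. of_int (f i)) ` ?F"
  proof
    fix n assume "n \<in> {n \<in> B. int_vec n}"
    then have n: "n \<in> B" "int_vec n" by auto
    have le: "\<bar>n $ i\<bar> \<le> r" for i
      using component_le_norm_cart[of n i] r[OF n(1)] by linarith
    have fl: "of_int \<lfloor>n $ i\<rfloor> = n $ i" for i
      using n(2) by (auto simp: int_vec_def elim!: Ints_cases)
    have "\<lfloor>n $ i\<rfloor> \<in> {-\<lceil>r\<rceil>..\<lceil>r\<rceil>}" for i
      using le[of i] fl[of i] by (auto simp: abs_le_iff) linarith+
    then have "(\<lambda>i. \<lfloor>n $ i\<rfloor>) \<in> ?F" by auto
    moreover have "n = (\<chi> i. of_int \<lfloor>n $ i\<rfloor>)" by (simp add: vec_eq_iff fl)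
    ultimately show "n \<in> (\<lambda>f. \<chi> i. of_int (f i)) ` ?F"
      by (intro image_eqI[where x="\<lambda>i. \<lfloor>n $ i\<rfloor>"])
  qed
  then show ?thesis using fin finite_surj by blast
qed

lemma finite_gap_set: "bounded D \<Longrightarrow> finite (gap_set \<alpha> D)"
proof -
  assume "bounded D"
  have "gap_set \<alpha> D = (\<lambda>m. frac (m \<bullet> \<alpha>)) ` {m \<in> D. int_vec m}"
    by (auto simp: gap_set_def int_vec_def)
  then show ?thesis using finite_int_vec_bounded[OF \<open>bounded D\<close>] by simp
qed

text \<open>Turns the two branches of \<open>next_gap\<close> into one notion, the first positive
  time at which a forward move on the circle meets \<open>S\<close> again. A one-point set returns
  to itself after a full turn, hence the weak bound by 1.\<close>

lemma next_gap_unit_set: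
  assumes "finite S" "S \<subseteq> {0..<1}" "x \<in> S"
  shows "0 < next_gap S x" "next_gap S x \<le> 1" "frac (x + next_gap S x) \<in> S"
    "\<And>t. 0 < t \<Longrightarrow> t < next_gap S x \<Longrightarrow> frac (x + t) \<notin> S"
proof -
  have S01: "y \<in> S \<Longrightarrow> 0 \<le> y \<and> y < 1" for y using assms by auto
  have x01: "0 \<le> x" "x < 1" using S01 assms by auto
  have "0 < next_gap S x \<and> next_gap S x \<le> 1 \<and> frac (x + next_gap S x) \<in> S \<and>
    (\<forall>t. 0 < t \<longrightarrow> t < next_gap S x \<longrightarrow> frac (x + t) \<notin> S)"
  proof (cases "\<exists>y\<in>S. x < y")
    case True
    let ?A = "{y \<in> S. x < y}"
    have A: "finite ?A" "?A \<noteq> {}" using assms True by auto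
    have M: "Min ?A \<in> S" "x < Min ?A" using Min_in[OF A] by auto
    have g: "next_gap S x = Min ?A - x" using True by (simp add: next_gap_def)
    have "frac (x + t) \<notin> S" if "0 < t" "t < Min ?A - x" for t
    proof
      have "Min ?A < 1" using S01 M by auto
      then have "frac (x + t) = x + t" using that x01 by (simp add: frac_eq)
      moreover assume "frac (x + t) \<in> S"
      ultimately have "x + t \<in> ?A" using that by simp
      then show False using Min_le[OF A(1)] that by fastforce
    qed
    moreover have "frac (Min ?A) = Min ?A" using S01 M by (simp add: frac_eq)
    ultimately show ?thesis using M S01[OF M(1)] x01 by (simp add: g)
  next
    case False
    have A: "finite S" "S \<noteq> {}" using assms by auto
    have M: "Min S \<in> S" using Min_in[OF A] .
    have le: "Min S \<le> x" using assms by simp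
    have g: "next_gap S x = 1 + Min S - x" using False by (simp add: next_gap_def)
    have "frac (x + t) \<notin> S" if t: "0 < t" "t < 1 + Min S - x" for t
    proof
      assume a: "frac (x + t) \<in> S"
      show False
      proof (cases "x + t < 1")
        case True
        then have "frac (x + t) = x + t" using t x01 by (simp add: frac_eq)
        then show False using False a t by (metis less_add_same_cancel1)
      next
        case xt: False
        then have "frac (x + t) = x + t - 1" using t le x01
          by (subst frac_unique_iff) (auto simp: algebra_simps)
        then have "frac (x + t) < Min S" using t by simp
        then show False using a Min_le[OF A(1)] by fastforce
      qed
    qed
    moreover have "frac (1 + Min S) = Min S" using S01[OF M]
      by (subst frac_unique_iff) (auto simp: algebra_simps)
    ultimately show ?thesis using M S01[OF M] x01 le by (simp add: g)
  qed
  then show "0 < next_gap S x" "next_gap S x \<le> 1" "frac (x + next_gap S x) \<in> S"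
    "\<And>t. 0 < t \<Longrightarrow> t < next_gap S x \<Longrightarrow> frac (x + t) \<notin> S" by auto
qed

lemma gap_set_unit: "gap_set \<alpha> D \<subseteq> {0..<1}"
  by (auto simp: gap_set_def frac_lt_1)

text \<open>Passage from the circle to the line: the integer \<open>k\<close> absorbs all
  floors.\<close>

lemma frac_add_mem_gap_set:
  "frac (frac (m \<bullet> \<alpha>) + t) \<in> gap_set \<alpha> D \<longleftrightarrow>
     (\<exists>n k. n \<in> D \<and> int_vec n \<and> k \<in> \<int> \<and> t = (n - m) \<bullet> \<alpha> + k)"
proof
  assume "frac (frac (m \<bullet> \<alpha>) + t) \<in> gap_set \<alpha> D"
  then obtain n where n: "n \<in> D" "int_vec n" "frac (frac (m \<bullet> \<alpha>) + t) = frac (n \<bullet> \<alpha>)"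
    by (auto simp: gap_set_def int_vec_def)
  then have "t - ((n - m) \<bullet> \<alpha>) =
     of_int (\<lfloor>frac (m \<bullet> \<alpha>) + t\<rfloor> - \<lfloor>n \<bullet> \<alpha>\<rfloor> + \<lfloor>m \<bullet> \<alpha>\<rfloor>)"
    by (simp add: frac_def inner_diff_left)
  then have "t = (n - m) \<bullet> \<alpha> + of_int (\<lfloor>frac (m \<bullet> \<alpha>) + t\<rfloor> - \<lfloor>n \<bullet> \<alpha>\<rfloor> + \<lfloor>m \<bullet> \<alpha>\<rfloor>)"
    by linarith
  then show "\<exists>n k. n \<in> D \<and> int_vec n \<and> k \<in> \<int> \<and> t = (n - m) \<bullet> \<alpha> + k"
    using n Ints_of_int by blast
next
  assume "\<exists>n k. n \<in> D \<and> int_vec n \<and> k \<in> \<int> \<and> t = (n - m) \<bullet> \<alpha> + k"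
  then obtain n k where n: "n \<in> D" "int_vec n" "t = (n - m) \<bullet> \<alpha> + of_int k"
    by (auto elim!: Ints_cases)
  have "frac (m \<bullet> \<alpha>) + t = n \<bullet> \<alpha> + of_int (k - \<lfloor>m \<bullet> \<alpha>\<rfloor>)"
    using n(3) by (simp add: frac_def inner_diff_left)
  then have "frac (frac (m \<bullet> \<alpha>) + t) = frac (n \<bullet> \<alpha>)"
    by (simp only: frac_def floor_add_int[symmetric] of_int_add)
  then show "frac (frac (m \<bullet> \<alpha>) + t) \<in> gap_set \<alpha> D"
    using n by (auto simp: gap_set_def int_vec_def)
qed

text \<open>The form in which gaps are used from here on: a gap is the least positive value of the
  linear form over differences \<open>n - m\<close> and integers \<open>k\<close>.\<close>

lemma next_gap_gap_set:
  assumes "bounded D" "m \<in> D" "int_vec m"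
  shows "0 < next_gap (gap_set \<alpha> D) (frac (m \<bullet> \<alpha>))"
    "\<exists>n k. n \<in> D \<and> int_vec n \<and> k \<in> \<int> \<and> next_gap (gap_set \<alpha> D) (frac (m \<bullet> \<alpha>)) = (n - m) \<bullet> \<alpha> + k"
    "\<And>n k. n \<in> D \<Longrightarrow> int_vec n \<Longrightarrow> k \<in> \<int> \<Longrightarrow> 0 < (n - m) \<bullet> \<alpha> + k \<Longrightarrow>
       next_gap (gap_set \<alpha> D) (frac (m \<bullet> \<alpha>)) \<le> (n - m) \<bullet> \<alpha> + k"
proof -
  have "frac (m \<bullet> \<alpha>) \<in> gap_set \<alpha> D" using assms by (auto simp: gap_set_def int_vec_def)
  note * = next_gap_unit_set[OF finite_gap_set[OF assms(1)] gap_set_unit this]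
  show "0 < next_gap (gap_set \<alpha> D) (frac (m \<bullet> \<alpha>))" by (rule *)
  show "\<exists>n k. n \<in> D \<and> int_vec n \<and> k \<in> \<int> \<and> next_gap (gap_set \<alpha> D) (frac (m \<bullet> \<alpha>)) = (n - m) \<bullet> \<alpha> + k"
    using *(3) frac_add_mem_gap_set by blast
  show "next_gap (gap_set \<alpha> D) (frac (m \<bullet> \<alpha>)) \<le> (n - m) \<bullet> \<alpha> + k"
    if "n \<in> D" "int_vec n" "k \<in> \<int>" "0 < (n - m) \<bullet> \<alpha> + k" for n k
    using *(4)[OF that(4)] that frac_add_mem_gap_set by (meson not_less)
qed

section \<open>Consequences of separation\<close>

lemma card_int_vec_box:
  "card {n :: real ^ 'n. \<forall>i. \<exists>j<q. n $ i = real j} = q ^ CARD('n)"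
proof -
  let ?F = "PiE (UNIV :: 'n set) (\<lambda>_. {..<q})"
  have "{n :: real ^ 'n. \<forall>i. \<exists>j<q. n $ i = real j} = (\<lambda>f. \<chi> i. real (f i)) ` ?F"
  proof (intro equalityI subsetI)
    fix n :: "real ^ 'n" assume "n \<in> {n. \<forall>i. \<exists>j<q. n $ i = real j}"
    then obtain f where f: "\<And>i. f i < q \<and> n $ i = real (f i)" by (auto, metis)
    then have "f \<in> ?F" "n = (\<chi> i. real (f i))" by (auto simp: vec_eq_iff)
    then show "n \<in> (\<lambda>f. \<chi> i. real (f i)) ` ?F" by (intro image_eqI[where x=f])
  qed auto
  moreover have "inj_on (\<lambda>f. \<chi> i. real (f i)) ?F"
    by (auto simp: inj_on_def vec_eq_iff)
  ultimately show ?thesis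
    by (simp add: card_image card_PiE)
qed

text \<open>The number of steps of size \<^term>\<open>\<tau>\<close> is bounded because points at pairwise step distance
  at least two have disjoint neighbourhoods, each containing \<^term>\<open>\<tau> ^ d\<close> separated points.\<close>
lemma separated_imp_dense:
  fixes \<alpha> :: "real ^ 'n"
  assumes sep: "separated \<alpha> \<tau> c" and c: "0 < c" and \<tau>: "0 < \<tau>" and J: "1 / c + 1 < real J"
  shows "\<exists>n k. int_vec n \<and> k \<in> \<int> \<and> (\<forall>i. \<bar>n $ i\<bar> \<le> real (2 * J) * real \<tau>) \<and>
    \<bar>n \<bullet> \<alpha> + k - t\<bar> \<le> real (2 * J) * (c / real \<tau> ^ CARD('n))"
proof -
  define \<delta> where "\<delta> = c / real \<tau> ^ CARD('n)"
  have \<delta>: "0 < \<delta>" using c \<tau> by (simp add: \<delta>_def)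
  \<comment> \<open>\<open>reach j t\<close> says that \<open>t\<close> is approximated at cost
    \<open>j\<close>, in both box size and error. Costs add when targets are added, so cost behaves
    like a step distance.\<close>
  define reach where "reach j t \<longleftrightarrow> (\<exists>n k. int_vec n \<and> k \<in> \<int> \<and>
    (\<forall>i. \<bar>n $ i\<bar> \<le> real j * real \<tau>) \<and> \<bar>n \<bullet> \<alpha> + k - t\<bar> \<le> real j * \<delta>)" for j :: nat and t :: real
  have reach_add: "reach (j + j') (t + t')" if "reach j t" "reach j' t'" for j j' t t'
  proof -
    obtain n k where n: "int_vec n" "k \<in> \<int>" "\<forall>i. \<bar>n $ i\<bar> \<le> real j * real \<tau>" "\<bar>n \<bullet> \<alpha> + k - t\<bar> \<le> real j * \<delta>"
      using \<open>reach j t\<close> unfolding reach_def by blast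
    obtain n' k' where n': "int_vec n'" "k' \<in> \<int>" "\<forall>i. \<bar>n' $ i\<bar> \<le> real j' * real \<tau>" "\<bar>n' \<bullet> \<alpha> + k' - t'\<bar> \<le> real j' * \<delta>"
      using \<open>reach j' t'\<close> unfolding reach_def by blast
    have "\<bar>(n + n') $ i\<bar> \<le> real (j + j') * real \<tau>" for i
      using spec[OF n(3), of i] spec[OF n'(3), of i] by (simp add: distrib_right)
    moreover have "\<bar>(n + n') \<bullet> \<alpha> + (k + k') - (t + t')\<bar> \<le> real (j + j') * \<delta>"
      using n(4) n'(4) by (simp add: distrib_right inner_add_left)
    ultimately show ?thesis unfolding reach_def
      using int_vec_add[OF n(1) n'(1)] Ints_add[OF n(2) n'(2)] by blast
  qed
  have reach_small: "reach 1 u" if "\<bar>u\<bar> \<le> \<delta>" for u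
    unfolding reach_def by (rule exI[of _ 0], rule exI[of _ 0]) (use that in auto)
  have reach_mono: "reach j' t" if "reach j t" "j \<le> j'" for j j' t
    unfolding reach_def using that(1)[unfolded reach_def] that(2) \<delta>
    by (meson mult_right_mono of_nat_0_le_iff of_nat_mono order_trans less_imp_le)
  have main: "reach (2 * J) t" if "0 \<le> t" for t
  proof (rule ccontr)
    assume not: "\<not> reach (2 * J) t"
    \<comment> \<open>A walk from 0 to \<open>t\<close> with steps of cost one. Its cost is 0 at the
      start and exceeds \<open>2 * J\<close> at the end, so every even level below is crossed; the
      first point beyond level \<open>2 * j\<close> has cost at most
      \<open>2 * j + 1\<close>.\<close>
    define p where "p i = min (real i * \<delta>) t" for i
    have p0: "reach 0 (p 0)" unfolding reach_def p_def
      by (rule exI[of _ 0], rule exI[of _ 0]) (use that in auto)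
    have pstep: "\<bar>p (Suc i) - p i\<bar> \<le> \<delta>" for i
      unfolding p_def using \<delta> by (auto simp: min_def algebra_simps)
    obtain N where N: "p N = t"
    proof -
      obtain N where "t < real N * \<delta>" using \<delta> reals_Archimedean3 by blast
      then show thesis using that[of N] by (simp add: p_def min_def)
    qed
    have ex: "\<exists>x. reach (2 * j + 1) x \<and> \<not> reach (2 * j) x" if "j < J" for j
    proof -
      have nj: "\<not> reach (2 * j) (p N)" using not reach_mono N that
        by (metis less_imp_le mult_le_mono2)
      define i where "i = (LEAST i. \<not> reach (2 * j) (p i))"
      have i: "\<not> reach (2 * j) (p i)" unfolding i_def using nj by (rule LeastI)
      have "i \<noteq> 0"
      proof
        assume "i = 0"
        then show False using i p0 reach_mono by blast
      qed
      then obtain i' where i': "i = Suc i'" by (cases i) auto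
      then have "reach (2 * j) (p i')" using not_less_Least[of i' "\<lambda>i. \<not> reach (2 * j) (p i)"]
        by (auto simp: i_def)
      from reach_add[OF this reach_small[OF pstep[of i']]] have "reach (2 * j + 1) (p i)"
        by (simp add: i')
      with i show ?thesis by blast
    qed
    define X where "X j = (SOME x. reach (2 * j + 1) x \<and> \<not> reach (2 * j) x)" for j
    have X: "reach (2 * j + 1) (X j)" "\<not> reach (2 * j) (X j)" if "j < J" for j
      using someI_ex[OF ex[OF that]] by (auto simp: X_def)
    let ?B = "{n :: real ^ 'n. \<forall>i. \<exists>j<\<tau>. n $ i = real j}"
    have Bint: "int_vec a" if "a \<in> ?B" for a
      unfolding int_vec_def
    proof
      fix i
      have "\<exists>j<\<tau>. a $ i = real j" using that by simp
      then obtain j where "a $ i = real j" by blast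
      then show "a $ i \<in> \<int>" by simp
    qed
    have Bdiff: "\<bar>(a - a') $ i\<bar> \<le> real \<tau>" if aa: "a \<in> ?B" "a' \<in> ?B" for a a' :: "real ^ 'n" and i
    proof -
      obtain j j' where "j < \<tau>" "a $ i = real j" "j' < \<tau>" "a' $ i = real j'" using aa by blast
      then show ?thesis by simp
    qed
    \<comment> \<open>Bins of length \<delta> on the circle for the translated boxes around the
      points \<open>X j\<close>. A common bin for different indices would reach the later
      \<open>X j\<close> too cheaply; a common bin for the same index contradicts
      separation.\<close>
    define h where "h = (\<lambda>(j, a). \<lfloor>frac (X j + a \<bullet> \<alpha>) / \<delta>\<rfloor>)"
    have h: "h (j, a) \<in> {0..\<lfloor>1 / \<delta>\<rfloor>}" for j a
    proof -
      have "frac (X j + a \<bullet> \<alpha>) / \<delta> \<le> 1 / \<delta>"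
        using \<delta> frac_lt_1[of "X j + a \<bullet> \<alpha>"] by (intro divide_right_mono) auto
      then show ?thesis using \<delta> by (auto simp: h_def intro: floor_mono)
    qed
    have close: "\<exists>k\<in>\<int>. \<bar>X j - X j' + (a - a') \<bullet> \<alpha> + k\<bar> < \<delta>"
      if "h (j, a) = h (j', a')" for j j' a a'
    proof -
      have "\<bar>frac (X j + a \<bullet> \<alpha>) / \<delta> - frac (X j' + a' \<bullet> \<alpha>) / \<delta>\<bar> < 1"
        using that by (simp add: h_def) linarith
      then have "\<bar>frac (X j + a \<bullet> \<alpha>) - frac (X j' + a' \<bullet> \<alpha>)\<bar> < \<delta>"
        using \<delta> by (simp add: diff_divide_distrib[symmetric] abs_divide)
      then have "\<bar>X j - X j' + (a - a') \<bullet> \<alpha> + of_int (\<lfloor>X j' + a' \<bullet> \<alpha>\<rfloor> - \<lfloor>X j + a \<bullet> \<alpha>\<rfloor>)\<bar> < \<delta>"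
        by (simp add: frac_def inner_diff_left algebra_simps)
      then show ?thesis using Ints_of_int by blast
    qed
    have far: False if hh: "h (j, a) = h (j', a')" and j: "j' < j" "j < J" and aa: "a \<in> ?B" "a' \<in> ?B" for j j' a a'
    proof -
      obtain k where k: "k \<in> \<int>" "\<bar>X j - X j' + (a - a') \<bullet> \<alpha> + k\<bar> < \<delta>"
        using close[OF hh] by blast
      have "reach 1 (X j - X j')" unfolding reach_def
        apply (rule exI[of _ "a' - a"], rule exI[of _ "- k"])
        using k Bdiff[OF aa(2,1)] int_vec_diff[OF Bint[OF aa(2)] Bint[OF aa(1)]]
        by (auto simp: inner_diff_left)
      from reach_add[OF X(1)[of j'] this] have "reach (2 * j' + 2) (X j)" using j by simp
      then have "reach (2 * j) (X j)" by (rule reach_mono) (use j in auto)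
      then show False using X j by blast
    qed
    have "inj_on h ({..<J} \<times> ?B)"
    proof (rule inj_onI, clarsimp simp del: inner_diff_left)
      fix j a j' a' assume j: "j < J" "j' < J"
        and a: "\<forall>i. \<exists>j<\<tau>. a $ i = real j" "\<forall>i. \<exists>j<\<tau>. a' $ i = real j"
        and eq: "h (j, a) = h (j', a')"
      have aB: "a \<in> ?B" "a' \<in> ?B" using a by auto
      have jj: "j = j'"
        using far[OF eq] far[OF eq[symmetric]] j aB by (meson linorder_neqE_nat)
      obtain k where k: "k \<in> \<int>" "\<bar>X j - X j' + (a - a') \<bullet> \<alpha> + k\<bar> < \<delta>"
        using close[OF eq] by blast
      have "a = a'"
      proof (rule ccontr)
        assume "a \<noteq> a'"
        then have "\<bar>(a - a') \<bullet> \<alpha> + k\<bar> > \<delta>"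
          using sep[unfolded separated_def, rule_format, of "a - a'" k] k(1) Bdiff[OF aB]
            int_vec_diff[OF Bint Bint, OF aB] by (auto simp: \<delta>_def)
        then show False using k(2) jj by simp
      qed
      with jj show "j = j' \<and> a = a'" by simp
    qed
    then have "card ({..<J} \<times> ?B) \<le> card {0..\<lfloor>1 / \<delta>\<rfloor>}"
      by (rule card_inj_on_le) (use h in auto)
    then have "J * \<tau> ^ CARD('n) \<le> nat (\<lfloor>1 / \<delta>\<rfloor> + 1)"
      by (simp add: card_cartesian_product card_int_vec_box)
    then have "real (J * \<tau> ^ CARD('n)) \<le> real (nat (\<lfloor>1 / \<delta>\<rfloor> + 1))" by (rule of_nat_mono)
    also have "\<dots> \<le> 1 / \<delta> + 1" using \<delta> by (simp add: add.commute)
    also have "\<dots> = real \<tau> ^ CARD('n) / c + 1" by (simp add: \<delta>_def)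
    \<comment> \<open>The rounding term 1 is absorbed into \<tau>^d; together with 1/c this is the
      threshold for \<open>J\<close>.\<close>
    also have "\<dots> \<le> real \<tau> ^ CARD('n) / c + real \<tau> ^ CARD('n)" using \<tau> by simp
    also have "\<dots> = (1 / c + 1) * real \<tau> ^ CARD('n)" by (simp add: algebra_simps)
    also have "\<dots> < real J * real \<tau> ^ CARD('n)" using J \<tau> by (intro mult_strict_right_mono) auto
    finally show False by simp
  qed
  \<comment> \<open>The walk starts at 0 and only treats non-negative targets; the integer part of
    \<open>t\<close> goes into \<open>k\<close>.\<close>
  have "reach (2 * J) (frac t)" by (rule main) simp
  then obtain n k where n: "int_vec n" "k \<in> \<int>" "\<forall>i. \<bar>n $ i\<bar> \<le> real (2 * J) * real \<tau>"
    "\<bar>n \<bullet> \<alpha> + k - frac t\<bar> \<le> real (2 * J) * \<delta>"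
    unfolding reach_def by blast
  have "\<bar>n \<bullet> \<alpha> + (k + of_int \<lfloor>t\<rfloor>) - t\<bar> \<le> real (2 * J) * \<delta>"
    using n(4) by (simp add: frac_def algebra_simps)
  moreover have "k + of_int \<lfloor>t\<rfloor> \<in> \<int>" using n(2) by simp
  ultimately show ?thesis using n unfolding \<delta>_def by blast
qed

text \<open>Cut the region into cells of side \<tau> in each coordinate of \<open>n\<close> and
  c/\<tau>^d in the value. Two pairs in one cell with different \<open>n\<close> would differ by a
  vector that separation forbids. With equal \<open>n\<close> the values of \<open>k\<close> differ
  by less than c/\<tau>^d, which is at most 1 because \<open>c < 1\<close>.\<close>

lemma separated_packing:
  fixes \<alpha> :: "real ^ 'n" and B H :: nat
  assumes sep: "separated \<alpha> \<tau> c" and c: "0 < c" "c < 1" and \<tau>: "0 < \<tau>"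
  defines "Q \<equiv> {(n, k). int_vec n \<and> k \<in> \<int> \<and> (\<forall>i. \<bar>n $ i\<bar> \<le> real B * real \<tau>) \<and>
     \<bar>n \<bullet> \<alpha> + k\<bar> \<le> real H * (c / real \<tau> ^ CARD('n))}"
  shows "finite Q" "card Q \<le> (2 * B + 1) ^ CARD('n) * (2 * H + 1)"
proof -
  define \<delta> where "\<delta> = c / real \<tau> ^ CARD('n)"
  have \<delta>: "0 < \<delta>" using c \<tau> by (simp add: \<delta>_def)
  have "1 \<le> real \<tau> ^ CARD('n)" using \<tau> by simp
  then have \<delta>1: "\<delta> \<le> 1" using c by (simp add: \<delta>_def divide_le_eq)
  define h where "h = (\<lambda>(n :: real ^ 'n, k). ((\<lambda>i. \<lfloor>n $ i / real \<tau>\<rfloor>), \<lfloor>(n \<bullet> \<alpha> + k) / \<delta>\<rfloor>))"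
  let ?R = "PiE (UNIV :: 'n set) (\<lambda>_. {- int B..int B}) \<times> {- int H..int H}"
  have flr: "\<lfloor>x\<rfloor> \<in> {- int b..int b}" if "\<bar>x\<bar> \<le> real b" for x b
    using that by (auto simp: abs_le_iff le_floor_iff floor_le_iff) 
  have "h ` Q \<subseteq> ?R"
  proof
    fix p assume "p \<in> h ` Q"
    then obtain n :: "real ^ 'n" and k where p: "p = h (n, k)" and a: "\<forall>i. \<bar>n $ i\<bar> \<le> real B * real \<tau>"
      "\<bar>n \<bullet> \<alpha> + k\<bar> \<le> real H * (c / real \<tau> ^ CARD('n))"
      unfolding Q_def by blast
    have "\<bar>n $ i / real \<tau>\<bar> \<le> real B" for i
      using a(1) \<tau> by (simp add: abs_divide divide_le_eq)
    moreover have "\<bar>n \<bullet> \<alpha> + k\<bar> \<le> real H * \<delta>" using a(2) by (simp add: \<delta>_def)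
    then have "\<bar>(n \<bullet> \<alpha> + k) / \<delta>\<bar> \<le> real H"
      using \<delta> by (simp add: abs_divide divide_le_eq)
    ultimately show "p \<in> ?R"
      unfolding p h_def using flr by auto
  qed
  moreover have "inj_on h Q"
  proof (rule inj_onI, clarsimp simp: Q_def simp del: inner_diff_left)
    fix n k n' k'
    assume a: "int_vec n" "int_vec n'" "k \<in> \<int>" "k' \<in> \<int>" and eq: "h (n, k) = h (n', k')"
    have 1: "\<lfloor>n $ i / real \<tau>\<rfloor> = \<lfloor>n' $ i / real \<tau>\<rfloor>" for i using eq by (auto simp: h_def fun_eq_iff)
    have "\<bar>n $ i / real \<tau> - n' $ i / real \<tau>\<bar> \<le> 1" for i using 1[of i] by linarith
    then have 2: "\<bar>(n - n') $ i\<bar> \<le> real \<tau>" for i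
      using \<tau> by (simp add: diff_divide_distrib[symmetric] abs_divide)
    have "\<lfloor>(n \<bullet> \<alpha> + k) / \<delta>\<rfloor> = \<lfloor>(n' \<bullet> \<alpha> + k') / \<delta>\<rfloor>" using eq by (auto simp: h_def)
    then have "\<bar>(n \<bullet> \<alpha> + k) / \<delta> - (n' \<bullet> \<alpha> + k') / \<delta>\<bar> < 1" by linarith
    then have 3: "\<bar>(n \<bullet> \<alpha> + k) - (n' \<bullet> \<alpha> + k')\<bar> < \<delta>"
      using \<delta> by (simp add: diff_divide_distrib[symmetric] abs_divide)
    have nn: "n = n'"
    proof (rule ccontr)
      assume "n \<noteq> n'"
      then have "\<bar>(n - n') \<bullet> \<alpha> + (k - k')\<bar> > \<delta>"
        using sep[unfolded separated_def, rule_format, of "n - n'" "k - k'"] a 2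
          int_vec_diff[OF a(1,2)] by (auto simp: \<delta>_def)
      then show False using 3 by (simp add: inner_diff_left algebra_simps)
    qed
    then have "\<bar>k - k'\<bar> < 1" using 3 \<delta>1 by simp
    then have "k = k'" using a by (auto elim!: Ints_cases simp flip: of_int_diff of_int_abs)
    with nn show "n = n' \<and> k = k'" by simp
  qed
  moreover have "finite ?R" by (intro finite_cartesian_product finite_PiE) auto
  ultimately show "finite Q" "card Q \<le> (2 * B + 1) ^ CARD('n) * (2 * H + 1)"
    using card_inj_on_le[of h Q ?R] inj_on_finite[of h Q ?R]
    by (auto simp: card_cartesian_product card_PiE nat_add_distrib nat_mult_distrib)
qed

section \<open>Null sets: singular vectors and porosity\<close>

text \<open>Translates of a slab along one axis by multiples of a fraction of its period are disjoint.\<close>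
lemma measure_near_integer_slab:
  fixes n :: "real ^ 'n" and N :: real and J :: nat
  assumes n: "int_vec n" "n \<noteq> 0" and x: "2 * x * real J < 1" and J: "0 < J" and N: "0 < N"
  defines "A \<equiv> {\<alpha> \<in> cbox (- (\<chi> i. N)) (\<chi> i. N). \<exists>k\<in>\<int>. \<bar>n \<bullet> \<alpha> + k\<bar> \<le> x}"
  shows "A \<in> lmeasurable" "real J * measure lebesgue A \<le> (2 * N + 1) ^ CARD('n)"
proof -
  obtain i where i: "n $ i \<noteq> 0" using n(2) by (auto simp: vec_eq_iff)
  define t where "t j = real j / (real J * \<bar>n $ i\<bar>)" for j :: nat
  \<comment> \<open>Since \<open>n $ i\<close> is a non-zero integer, all shifts \<open>t j\<close>
    are at most 1, so the translates fit into a box enlarged by one. A shift changes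
    \<open>n \<bullet> \<alpha>\<close> by j/J up to sign, and the slabs have width
    \<open>2 * x\<close>, which is below 1/J.\<close>
  have ni: "1 \<le> \<bar>n $ i\<bar>" using n(1) i by (auto simp: int_vec_def intro: Ints_nonzero_abs_ge1)
  have "A = cbox (- (\<chi> i. N)) (\<chi> i. N) \<inter> (\<Union>k\<in>\<int>. {\<alpha>. \<bar>n \<bullet> \<alpha> + k\<bar> \<le> x})"
    by (auto simp: A_def)
  moreover have "(\<Union>k\<in>\<int>. {\<alpha>. \<bar>n \<bullet> \<alpha> + k\<bar> \<le> x}) \<in> sets borel"
  proof (rule sets.countable_UN', rule countable_int, clarify)
    fix k :: real
    have "closed {\<alpha>. \<bar>n \<bullet> \<alpha> + k\<bar> \<le> x}"
      by (intro closed_Collect_le continuous_intros)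
    then show "{\<alpha>. \<bar>n \<bullet> \<alpha> + k\<bar> \<le> x} \<in> sets borel" by (rule borel_closed)
  qed
  ultimately have Ab: "A \<in> sets borel" by simp
  have Abnd: "A \<subseteq> cbox (- (\<chi> i. N)) (\<chi> i. N)" by (auto simp: A_def)
  show Am: "A \<in> lmeasurable"
    by (rule bounded_set_imp_lmeasurable) (use Ab bounded_subset[OF bounded_cbox Abnd] in auto)
  define T where "T j = (+) (t j *\<^sub>R axis i 1) ` A" for j
  have t: "0 \<le> t j" "t j \<le> 1" if "j < J" for j
  proof -
    show "0 \<le> t j" by (simp add: t_def)
    have "real j \<le> real J * 1" using that by simp
    also have "\<dots> \<le> real J * \<bar>n $ i\<bar>" using ni by (intro mult_left_mono) auto
    finally show "t j \<le> 1" using that i by (auto simp: t_def divide_le_eq)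
  qed
  have Tm: "T j \<in> lmeasurable" for j
    unfolding T_def by (rule measurable_translation[OF Am])
  have Tmeas: "measure lebesgue (T j) = measure lebesgue A" for j
    unfolding T_def by (rule measure_translation)
  have disj: "T j \<inter> T j' = {}" if j: "j < J" "j' < J" "j \<noteq> j'" for j j'
  proof (rule ccontr)
    assume "T j \<inter> T j' \<noteq> {}"
    then obtain a a' where a: "a \<in> A" "a' \<in> A" "t j *\<^sub>R axis i 1 + a = t j' *\<^sub>R axis i 1 + a'"
      by (auto simp: T_def)
    obtain k k' where k: "k \<in> \<int>" "\<bar>n \<bullet> a + k\<bar> \<le> x" "k' \<in> \<int>" "\<bar>n \<bullet> a' + k'\<bar> \<le> x"
      using a by (auto simp: A_def)
    have "a' = a + (t j - t j') *\<^sub>R axis i 1"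
      using a(3) by (simp add: algebra_simps) 
    then have "n \<bullet> a' = n \<bullet> a + (t j - t j') * n $ i"
      by (simp add: inner_add_right inner_axis)
    moreover have "(t j - t j') * n $ i = sgn (n $ i) * (real_of_int (int j - int j')) / real J"
      using i J by (simp add: t_def sgn_if field_simps)
    ultimately have "\<bar>sgn (n $ i) * (real_of_int (int j - int j')) / real J + (k' - k)\<bar> \<le> 2 * x"
      using k by (simp add: abs_le_iff)
    then have "\<bar>sgn (n $ i) * (real_of_int (int j - int j')) / real J + (k' - k)\<bar> * real J \<le> 2 * x * real J"
      by (intro mult_right_mono) auto
    also have "\<bar>sgn (n $ i) * (real_of_int (int j - int j')) / real J + (k' - k)\<bar> * real J
      = \<bar>sgn (n $ i) * (real_of_int (int j - int j')) + (k' - k) * real J\<bar>"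
    proof -
      have "\<bar>q / real J + r\<bar> * real J = \<bar>(q / real J + r) * real J\<bar>" for q r by (simp add: abs_mult)
      moreover have "(q / real J + r) * real J = q + r * real J" for q r using J by (simp add: distrib_right)
      ultimately show ?thesis by simp
    qed
    finally have lt: "\<bar>sgn (n $ i) * (real_of_int (int j - int j')) + (k' - k) * real J\<bar> < 1"
      using x by linarith
    obtain l where l: "k' - k = real_of_int l" using k by (metis Ints_cases Ints_diff)
    define sg :: int where "sg = (if n $ i > 0 then 1 else - 1)"
    have sg: "sgn (n $ i) = real_of_int sg" "sg = 1 \<or> sg = - 1" using i by (auto simp: sg_def)
    have "\<bar>real_of_int (sg * (int j - int j') + l * int J)\<bar> < 1"
      using lt unfolding l sg(1) by simp
    then have "\<bar>sg * (int j - int j') + l * int J\<bar> < 1" by linarith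
    then have "sg * (int j - int j') + l * int J = 0" by linarith
    then have "int J dvd sg * (int j - int j')"
      by (metis add.commute dvd_triv_right dvd_0_right dvd_add_right_iff)
    then have "int J dvd int j - int j'" using sg(2) by (auto simp: dvd_diff_commute)
    then show False using j zdvd_imp_le[of "int J" "\<bar>int j - int j'\<bar>"] by auto
  qed
  have Tbox: "T j \<subseteq> cbox (- (\<chi> i. N)) (\<chi> i. N + 1)" if "j < J" for j
  proof
    fix b assume "b \<in> T j"
    then obtain a where a: "a \<in> A" "b = t j *\<^sub>R axis i 1 + a" by (auto simp: T_def)
    have "- N \<le> a $ l \<and> a $ l \<le> N" for l using a(1) Abnd by (auto simp: mem_box_cart subset_eq)
    then show "b \<in> cbox (- (\<chi> i. N)) (\<chi> i. N + 1)"
      using t[OF that] unfolding a(2) mem_box_cart by (auto simp: axis_def) (smt (verit))+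
  qed
  have "real J * measure lebesgue A = (\<Sum>j<J. measure lebesgue (T j))"
    by (simp add: Tmeas)
  also have "\<dots> = measure lebesgue (\<Union>j<J. T j)"
    by (rule measure_UNION'[symmetric]) (use Tm disj in \<open>auto simp: pairwise_def disjnt_def\<close>)
  also have "\<dots> \<le> measure lebesgue (cbox (- (\<chi> i. N)) (\<chi> i. N + 1) :: (real ^ 'n) set)"
    by (rule measure_mono_fmeasurable) (use Tbox Tm in auto)
  also have "\<dots> = (2 * N + 1) ^ CARD('n)"
  proof -
    have "cbox (- (\<chi> i. N)) (\<chi> i. N + 1) \<noteq> ({} :: (real ^ 'n) set)"
      using N by (auto simp: interval_ne_empty_cart)
    from content_cbox_cart[OF this] show ?thesis by (simp add: algebra_simps)
  qed
  finally show "real J * measure lebesgue A \<le> (2 * N + 1) ^ CARD('n)" .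
qed


text \<open>At one scale the bad part of a box has measure O(c i): there are O(\<tau>^d) vectors,
  each with a slab of measure O(c i / \<tau>^d). Being bad at all scales from some point on costs no
  more than being bad at one of them, and these sets increase with the starting point. So a bound at
  each single scale is enough, without summing over scales.\<close>

lemma negligible_eventually_not_separated:
  fixes c :: "nat \<Rightarrow> real"
  assumes c: "\<And>i. 0 < c i" "c \<longlonglongrightarrow> 0"
  shows "negligible {\<alpha> :: real ^ 'n. \<forall>i. \<exists>\<tau>0. \<forall>\<tau>\<ge>\<tau>0. \<not> separated \<alpha> \<tau> (c i)}" (is "negligible ?S")
proof -
  have box: "negligible (?S \<inter> cbox (- (\<chi> i. N)) (\<chi> i. N))" if N: "0 < N" for N :: real
    unfolding negligible_outer_le
  proof (intro allI impI)
    fix e :: real assume e: "0 < e"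
    \<comment> \<open>The 8 combines the 4 in the choice of \<open>J\<close> with the 2 lost in
      rounding it down; \<open>3 ^ CARD('n)\<close> comes from counting vectors, as
      \<open>2 * \<tau> + 1\<close> is at most \<open>3 * \<tau>\<close>.\<close>
    define C where "C = 8 * 3 ^ CARD('n) * (2 * N + 1) ^ CARD('n)"
    have C: "0 < C" using N by (simp add: C_def)
    have "eventually (\<lambda>i. c i < min (e / C) (1 / 4)) sequentially"
      using c(2) e C by (intro order_tendstoD) auto
    then obtain i where i: "c i < e / C" "c i < 1 / 4"
      by (auto simp: eventually_sequentially)
    define B where "B \<tau> = {\<alpha> \<in> cbox (- (\<chi> i. N)) (\<chi> i. N) :: (real ^ 'n) set. \<not> separated \<alpha> \<tau> (c i)}" for \<tau>
    have B: "B \<tau> \<in> lmeasurable \<and> measure lebesgue (B \<tau>) \<le> e" if \<tau>: "1 \<le> \<tau>" for \<tau>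
    proof -
      define x where "x = c i / real \<tau> ^ CARD('n)"
      \<comment> \<open>The 4 leaves \<open>2 * x * J\<close> at most 1/2, and
        \<open>c i < 1 / 4\<close> keeps \<open>J\<close> positive.\<close>
      define J where "J = nat \<lfloor>real \<tau> ^ CARD('n) / (4 * c i)\<rfloor>"
      have \<tau>1: "1 \<le> real \<tau> ^ CARD('n)" using \<tau> by simp
      have r1: "1 \<le> real \<tau> ^ CARD('n) / (4 * c i)" using c(1)[of i] i(2) \<tau>1 by (simp add: le_divide_eq)
      have J: "real J \<le> real \<tau> ^ CARD('n) / (4 * c i)" "real \<tau> ^ CARD('n) / (4 * c i) \<le> 2 * real J" "0 < J"
      proof -
        have f1: "1 \<le> \<lfloor>real \<tau> ^ CARD('n) / (4 * c i)\<rfloor>" using r1 by (simp add: le_floor_iff)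
        then have "real J = of_int \<lfloor>real \<tau> ^ CARD('n) / (4 * c i)\<rfloor>" by (simp add: J_def)
        then show "real J \<le> real \<tau> ^ CARD('n) / (4 * c i)" "real \<tau> ^ CARD('n) / (4 * c i) \<le> 2 * real J"
          using f1 by linarith+
        show "0 < J" using f1 by (simp add: J_def)
      qed
      have xJ: "2 * x * real J < 1"
      proof -
        have "2 * x * real J \<le> 2 * x * (real \<tau> ^ CARD('n) / (4 * c i))"
          using c(1)[of i] \<tau> J by (intro mult_left_mono) (auto simp: x_def)
        also have "\<dots> = 1 / 2" using c(1)[of i] \<tau> by (simp add: x_def)
        finally show ?thesis by simp
      qed
      define I where "I = {n :: real ^ 'n. int_vec n \<and> n \<noteq> 0 \<and> (\<forall>i. \<bar>n $ i\<bar> \<le> real \<tau>)}"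
      define A where "A n = {\<alpha> \<in> cbox (- (\<chi> i. N)) (\<chi> i. N). \<exists>k\<in>\<int>. \<bar>n \<bullet> \<alpha> + k\<bar> \<le> x}" for n :: "real ^ 'n"
      have BA: "B \<tau> = (\<Union>n\<in>I. A n)"
        by (auto simp: B_def A_def I_def separated_def x_def not_less)
      have AI: "A n \<in> lmeasurable" "real J * measure lebesgue (A n) \<le> (2 * N + 1) ^ CARD('n)" if "n \<in> I" for n
        using measure_near_integer_slab[of n x J N] xJ J(3) N that by (auto simp: A_def I_def)
      have I: "finite I" "card I \<le> (3 * \<tau>) ^ CARD('n)"
      proof -
        let ?h = "\<lambda>n :: real ^ 'n. n + (\<chi> i. real \<tau>)"
        let ?K = "{n :: real ^ 'n. \<forall>i. \<exists>j<2 * \<tau> + 1. n $ i = real j}"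
        have "?h ` I \<subseteq> ?K"
        proof (clarsimp simp: I_def)
          fix n :: "real ^ 'n" and i assume n: "int_vec n" "\<forall>i. \<bar>n $ i\<bar> \<le> real \<tau>"
          obtain l where l: "n $ i = of_int l" using n(1) by (auto simp: int_vec_def elim: Ints_cases)
          have "\<bar>l\<bar> \<le> int \<tau>" using spec[OF n(2), of i] l by simp
          then have "n $ i + real \<tau> = real (nat (l + int \<tau>))" "nat (l + int \<tau>) < Suc (2 * \<tau>)"
            by (auto simp: l)
          then show "\<exists>j<Suc (2 * \<tau>). n $ i + real \<tau> = real j" by blast
        qed
        moreover have inj: "inj_on ?h I" by (auto simp: inj_on_def)
        moreover have K: "card ?K = (2 * \<tau> + 1) ^ CARD('n)" by (rule card_int_vec_box)
        moreover from this have "finite ?K" by (intro card_ge_0_finite) simp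
        ultimately have "finite I" "card I \<le> (2 * \<tau> + 1) ^ CARD('n)"
          using card_inj_on_le[of ?h I ?K] inj_on_finite[of ?h I ?K] by (auto simp only: K)
        moreover have "(2 * \<tau> + 1) ^ CARD('n) \<le> (3 * \<tau>) ^ CARD('n)"
          using \<tau> by (intro power_mono) auto
        ultimately show "finite I" "card I \<le> (3 * \<tau>) ^ CARD('n)" by auto
      qed
      have "measure lebesgue (B \<tau>) \<le> (\<Sum>n\<in>I. measure lebesgue (A n))"
        unfolding BA using AI I by (intro measure_UNION_le) auto
      also have "\<dots> \<le> (\<Sum>n\<in>I. (2 * N + 1) ^ CARD('n) / real J)"
        using AI J by (intro sum_mono) (auto simp: le_divide_eq mult.commute)
      also have "\<dots> = real (card I) * ((2 * N + 1) ^ CARD('n) / real J)" by simp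
      also have "\<dots> \<le> real ((3 * \<tau>) ^ CARD('n)) * ((2 * N + 1) ^ CARD('n) / real J)"
        using I(2) N by (intro mult_right_mono of_nat_mono) auto
      also have "\<dots> = C * (real \<tau> ^ CARD('n) / 8) / real J" by (simp add: C_def power_mult_distrib)
      also have "\<dots> \<le> C * (real J * c i) / real J"
        using J(2) c(1)[of i] C by (intro divide_right_mono mult_left_mono) (auto simp: field_simps)
      also have "\<dots> = C * c i" using J(3) by simp
      also have "\<dots> \<le> e" using i(1) C by (simp add: field_simps)
      finally have "measure lebesgue (B \<tau>) \<le> e" .
      moreover have "B \<tau> \<in> lmeasurable" unfolding BA using AI I by (intro fmeasurable.finite_UN) auto
      ultimately show ?thesis by simp
    qed
    show "\<exists>T. ?S \<inter> cbox (- (\<chi> i. N)) (\<chi> i. N) \<subseteq> T \<and> T \<in> lmeasurable \<and> measure lebesgue T \<le> e"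
    proof (intro exI conjI)
      \<comment> \<open>Starting at \<open>m + 1\<close> keeps to positive scales, where the bound
        for \<open>B\<close> holds.\<close>
      define E where "E m = (\<Inter>\<tau>\<in>{m + 1..}. B \<tau>)" for m
      have E: "E m \<in> lmeasurable" "measure lebesgue (E m) \<le> e" for m
      proof -
        have s: "E m \<in> sets lebesgue" unfolding E_def using B
          by (intro sets.countable_INT') (auto intro!: fmeasurableD)
        have sub: "E m \<subseteq> B (m + 1)" by (auto simp: E_def)
        have Bm: "B (m + 1) \<in> lmeasurable" "measure lebesgue (B (m + 1)) \<le> e"
          using B[of "m + 1"] by simp_all
        show "E m \<in> lmeasurable" by (rule fmeasurableI2[OF Bm(1) sub s])
        show "measure lebesgue (E m) \<le> e"
          using measure_mono_fmeasurable[OF sub s Bm(1)] Bm(2) by simp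
      qed
      have mono: "E m \<subseteq> E (Suc m)" for m by (auto simp: E_def)
      show "(\<Union>m. E m) \<in> lmeasurable" "measure lebesgue (\<Union>m. E m) \<le> e"
        using measurable_nested_Union[of E e, OF E mono] LIMSEQ_le_const2[OF measure_nested_Union[of E e, OF E mono]] E(2)
        by blast+
      show "?S \<inter> cbox (- (\<chi> i. N)) (\<chi> i. N) \<subseteq> (\<Union>m. E m)"
      proof clarsimp
        fix \<alpha> :: "real ^ 'n" assume a: "\<forall>i. \<exists>\<tau>0. \<forall>\<tau>\<ge>\<tau>0. \<not> separated \<alpha> \<tau> (c i)"
          "\<alpha> \<in> cbox (- (\<chi> i. N)) (\<chi> i. N)"
        then obtain \<tau>0 where "\<forall>\<tau>\<ge>\<tau>0. \<not> separated \<alpha> \<tau> (c i)" by blast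
        then have "\<alpha> \<in> E \<tau>0" using a(2) by (auto simp: E_def B_def)
        then show "\<exists>m. \<alpha> \<in> E m" by blast
      qed
    qed
  qed
  have "?S = (\<Union>N::nat. ?S \<inter> cbox (- (\<chi> i. real N + 1)) (\<chi> i. real N + 1))"
  proof -
    have "\<exists>N::nat. x \<in> cbox (- (\<chi> i. real N + 1)) (\<chi> i. real N + 1)" for x :: "real ^ 'n"
    proof -
      obtain N where N: "norm x \<le> real N" using real_arch_simple by blast
      have "- (real N + 1) \<le> x $ i \<and> x $ i \<le> real N + 1" for i
        using component_le_norm_cart[of x i] N by linarith
      then show ?thesis by (intro exI[of _ N]) (simp add: mem_box_cart)
    qed
    then show ?thesis by blast
  qed
  moreover have "negligible (\<Union>N::nat. ?S \<inter> cbox (- (\<chi> i. real N + 1)) (\<chi> i. real N + 1))"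
    by (intro negligible_countable_Union) (auto intro!: box)
  ultimately show ?thesis by simp
qed

section \<open>Porous sets\<close>

text \<open>Almost all of \<^term>\<open>A\<close> is covered by disjoint balls inside a slight enlargement of \<^term>\<open>F\<close>;
  a fixed proportion of each ball misses \<^term>\<open>F\<close>, so the balls have small total measure.\<close>
lemma negligible_porous:
  fixes F A :: "'a::euclidean_space set"
  assumes F: "closed F" and AF: "A \<subseteq> F" and \<kappa>: "0 < \<kappa>"
    and hole: "\<And>a r. a \<in> A \<Longrightarrow> 0 < r \<Longrightarrow>
      \<exists>s b. 0 < s \<and> s < r \<and> cball b (\<kappa> * s) \<subseteq> cball a s - F"
  shows "negligible A"
proof -
  have bd: "negligible (A \<inter> ball 0 N)" for N :: real
    unfolding negligible_outer_le
  proof (intro allI impI)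
    fix e :: real assume e: "0 < e"
    let ?d = "DIM('a)"
    have Fm: "F \<inter> ball 0 N \<in> lmeasurable"
      using F by (intro bounded_set_imp_lmeasurable) (auto intro: bounded_Int)
    have ek: "0 < e * \<kappa> ^ ?d" using e \<kappa> by simp
    \<comment> \<open>The holes occupy the fraction \<kappa>^d of the volume of the balls and lie in
      \<open>U - F\<close>. A surplus below e \<kappa>^d therefore bounds the volume of the balls by
      \<open>e\<close>.\<close>
    obtain U where U: "open U" "F \<inter> ball 0 N \<subseteq> U" "U \<in> lmeasurable"
      "measure lebesgue (U - F \<inter> ball 0 N) < e * \<kappa> ^ ?d"
    proof -
      obtain U where U: "open U" "F \<inter> ball 0 N \<subseteq> U" "U - F \<inter> ball 0 N \<in> lmeasurable"
        "emeasure lebesgue (U - F \<inter> ball 0 N) < ennreal (e * \<kappa> ^ ?d)"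
        by (rule sets_lebesgue_outer_open[OF fmeasurableD[OF Fm] ek])
      have "F \<inter> ball 0 N \<union> (U - F \<inter> ball 0 N) = U" using U(2) by blast
      then have "U \<in> lmeasurable"
        using fmeasurable.Un[OF Fm U(3)] by simp
      moreover have "measure lebesgue (U - F \<inter> ball 0 N) < e * \<kappa> ^ ?d"
        using U(4) unfolding emeasure_eq_measure2[OF U(3)] by (subst (asm) ennreal_less_iff) auto
      ultimately show thesis using that U by blast
    qed
    define K where "K = {(a, s). a \<in> A \<inter> ball 0 N \<and> 0 < s \<and> cball a s \<subseteq> U \<inter> ball 0 N \<and>
      (\<exists>b. cball b (\<kappa> * s) \<subseteq> cball a s - F)}"
    have K_pos: "0 < snd i" if "i \<in> K" for i using that by (auto simp: K_def)
    have K_sub: "cball (fst i) (snd i) \<subseteq> U" if "i \<in> K" for i using that unfolding K_def by force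
    \<comment> \<open>Holes exist at arbitrarily small radii, so the admissible balls form a fine
      cover, as Vitali's theorem demands.\<close>
    have cov: "\<exists>i. i \<in> K \<and> x \<in> cball (fst i) (snd i) \<and> snd i < r" if x: "x \<in> A \<inter> ball 0 N" and r: "0 < r" for x r
    proof -
      have "x \<in> U \<inter> ball 0 N" using x AF U by auto
      then obtain \<rho> where \<rho>: "0 < \<rho>" "cball x \<rho> \<subseteq> U \<inter> ball 0 N"
        using open_contains_cball[of "U \<inter> ball 0 N"] U(1) open_ball by blast
      obtain s b where "0 < s" "s < min r \<rho>" "cball b (\<kappa> * s) \<subseteq> cball x s - F"
        using hole[of x "min r \<rho>"] x r \<rho> by auto
      moreover from this have "cball x s \<subseteq> cball x \<rho>" by (intro subset_cball) simp
      then have "cball x s \<subseteq> U \<inter> ball 0 N" using \<rho>(2) by blast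
      ultimately have "(x, s) \<in> K" "s < r" using x unfolding K_def by (simp, blast, simp)
      then show ?thesis using K_pos[of "(x, s)"] by (intro exI[of _ "(x, s)"]) simp
    qed
    obtain C where C: "countable C" "C \<subseteq> K"
      "pairwise (\<lambda>i j. disjnt (cball (fst i) (snd i)) (cball (fst j) (snd j))) C"
      "negligible (A \<inter> ball 0 N - (\<Union>i\<in>C. cball (fst i) (snd i)))"
      by (rule Vitali_covering_theorem_cballs[of K snd "A \<inter> ball 0 N" fst])
        (use cov K_pos in blast)+
    define b where "b i = (SOME b. cball b (\<kappa> * snd i) \<subseteq> cball (fst i) (snd i) - F)" for i
    have b: "cball (b i) (\<kappa> * snd i) \<subseteq> cball (fst i) (snd i) - F" if "i \<in> C" for i
    proof -
      have "\<exists>b. cball b (\<kappa> * snd i) \<subseteq> cball (fst i) (snd i) - F"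
        using C(2) that unfolding K_def by force
      then show ?thesis unfolding b_def by (rule someI_ex)
    qed
    have s0: "0 < snd i" if "i \<in> C" for i using C(2) K_pos that by blast
    let ?V = "\<Union>i\<in>C. cball (fst i) (snd i)"
    have le: "measure lebesgue (\<Union>i\<in>I. cball (fst i) (snd i)) \<le> e" if I: "I \<subseteq> C" "finite I" for I
    proof -
      have "\<kappa> ^ ?d * measure lebesgue (\<Union>i\<in>I. cball (fst i) (snd i))
        = \<kappa> ^ ?d * (\<Sum>i\<in>I. measure lebesgue (cball (fst i) (snd i)))"
        using I C(3) by (subst measure_UNION') (auto intro: pairwise_subset)
      also have "\<dots> = (\<Sum>i\<in>I. measure lebesgue (cball (b i) (\<kappa> * snd i)))"
      proof -
        have "\<kappa> ^ ?d * measure lebesgue (cball (fst i) (snd i)) = measure lebesgue (cball (b i) (\<kappa> * snd i))"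
          if "i \<in> I" for i
        proof -
          have "0 < snd i" using s0 that I by blast
          then show ?thesis
            using content_cball[of "snd i" "fst i"] content_cball[of "\<kappa> * snd i" "b i"] \<kappa>
            by (simp add: power_mult_distrib)
        qed
        then show ?thesis by (simp add: sum_distrib_left)
      qed
      also have "\<dots> = measure lebesgue (\<Union>i\<in>I. cball (b i) (\<kappa> * snd i))"
      proof (rule measure_UNION'[symmetric])
        show "pairwise (\<lambda>i j. disjnt (cball (b i) (\<kappa> * snd i)) (cball (b j) (\<kappa> * snd j))) I"
        proof (rule pairwiseI)
          fix i j assume ij: "i \<in> I" "j \<in> I" "i \<noteq> j"
          then have "disjnt (cball (fst i) (snd i)) (cball (fst j) (snd j))"
            using C(3) I by (auto simp: pairwise_def)
          then show "disjnt (cball (b i) (\<kappa> * snd i)) (cball (b j) (\<kappa> * snd j))"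
            using b[of i] b[of j] I ij unfolding disjnt_def by blast
        qed
      qed (use I in auto)
      also have "\<dots> \<le> measure lebesgue (U - F \<inter> ball 0 N)"
      proof (rule measure_mono_fmeasurable)
        show "(\<Union>i\<in>I. cball (b i) (\<kappa> * snd i)) \<subseteq> U - F \<inter> ball 0 N"
        proof
          fix x assume "x \<in> (\<Union>i\<in>I. cball (b i) (\<kappa> * snd i))"
          then obtain i where i: "i \<in> C" "x \<in> cball (b i) (\<kappa> * snd i)" using I by blast
          then have "cball (fst i) (snd i) \<subseteq> U" using C(2) K_sub by blast
          then show "x \<in> U - F \<inter> ball 0 N" using b[OF i(1)] i(2) by blast
        qed
        show "U - F \<inter> ball 0 N \<in> lmeasurable" using U(3) Fm by (rule fmeasurable.Diff)
      qed (use I in auto)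
      also have "\<dots> \<le> \<kappa> ^ ?d * e" using U(4) by (simp add: mult.commute)
      finally show ?thesis using \<kappa> by simp
    qed
    have V: "?V \<in> lmeasurable" "measure lebesgue ?V \<le> e"
      using fmeasurable_UN_bound[of C "\<lambda>i. cball (fst i) (snd i)" lebesgue e]
        measure_UN_bound[of C "\<lambda>i. cball (fst i) (snd i)" lebesgue e] C(1) le by auto
    let ?Z = "A \<inter> ball 0 N - ?V"
    have Z: "?Z \<in> lmeasurable" "measure lebesgue ?Z = 0"
      using C(4) by (auto simp: negligible_imp_measurable negligible_imp_measure0)
    show "\<exists>T. A \<inter> ball 0 N \<subseteq> T \<and> T \<in> lmeasurable \<and> measure lebesgue T \<le> e"
    proof (intro exI conjI)
      show "A \<inter> ball 0 N \<subseteq> ?V \<union> ?Z" by blast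
      show "?V \<union> ?Z \<in> lmeasurable" using V Z by blast
      show "measure lebesgue (?V \<union> ?Z) \<le> e"
        using measure_Un_le[of ?V lebesgue ?Z] V Z by (simp add: fmeasurableD)
    qed
  qed
  have "A = (\<Union>N::nat. A \<inter> ball 0 (real N))"
    using reals_Archimedean2 by (auto, metis)
  moreover have "negligible (\<Union>N::nat. A \<inter> ball 0 (real N))"
    by (intro negligible_countable_Union) (auto intro!: bd)
  ultimately show ?thesis by simp
qed

section \<open>Few gaps\<close>

lemma scale_set_eq: "scale_set R D = {x. \<exists>y\<in>D. x = R *\<^sub>R y}"
  by (auto simp: scale_set_def)

lemma bounded_scale_set: "bounded D \<Longrightarrow> bounded (scale_set R D)"
  unfolding scale_set_def by (rule bounded_scaling)

text \<open>The window for \<open>R\<close> balances two needs. It begins where the dilated set has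
  room for the vectors that density provides, which makes all gaps short; it ends while differences
  of its points still have size O(\<tau>), so that packing leaves boundedly many candidates. The
  bound depends on \<open>D\<close> and \<open>c\<close> only.\<close>

lemma num_gaps_bounded:
  fixes D :: "(real ^ 'n) set"
  assumes D: "bounded D" "interior D \<noteq> {}" and c: "0 < c" "c < 1"
  obtains \<mu> C where "0 < \<mu>"
    "\<And>\<alpha> \<tau> R. separated \<alpha> \<tau> c \<Longrightarrow> 0 < \<tau> \<Longrightarrow> \<mu> * real \<tau> \<le> R \<Longrightarrow> R \<le> 2 * \<mu> * real \<tau> \<Longrightarrow>
       num_gaps \<alpha> (scale_set R D) \<le> C"
proof -
  let ?d = "CARD('n)"
  obtain z \<rho> where z: "0 < \<rho>" "cball z \<rho> \<subseteq> D"
    using D(2) by (metis ex_in_conv mem_interior_cball)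
  obtain r where r: "0 < r" "\<And>x. x \<in> D \<Longrightarrow> norm x \<le> r"
    using D(1) by (auto simp: bounded_pos)
  obtain J :: nat where J: "1 / c + 1 < real J" using reals_Archimedean2 by blast
  \<comment> \<open>Chosen so that the ball of radius \<open>R * \<rho>\<close> inside the dilated
    set holds a lattice point near its centre (error at most the dimension) shifted by any vector
    from the density lemma.\<close>
  define \<mu> where "\<mu> = (real ?d + real ?d * real (2 * J)) / \<rho>"
  have \<mu>: "0 < \<mu>" using z(1) unfolding \<mu>_def by (intro divide_pos_pos add_pos_nonneg) auto
  obtain B :: nat where B: "4 * \<mu> * r \<le> real B" using real_arch_simple by blast
  let ?H = "4 * J + 1"
  let ?C = "(2 * B + 1) ^ ?d * (2 * ?H + 1)"
  have "num_gaps \<alpha> (scale_set R D) \<le> ?C"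
    if sep: "separated \<alpha> \<tau> c" and \<tau>: "0 < \<tau>" and R: "\<mu> * real \<tau> \<le> R" "R \<le> 2 * \<mu> * real \<tau>" for \<alpha> :: "real ^ 'n" and \<tau> R
  proof -
    define \<delta> where "\<delta> = c / real \<tau> ^ ?d"
    have \<delta>: "0 < \<delta>" using c \<tau> by (simp add: \<delta>_def)
    have R0: "0 < R" using \<mu> \<tau> R by (smt (verit) mult_pos_pos of_nat_0_less_iff)
    define Q where "Q = {(n, k). int_vec n \<and> k \<in> \<int> \<and> (\<forall>i. \<bar>n $ i\<bar> \<le> real B * real \<tau>) \<and>
     \<bar>n \<bullet> \<alpha> + k\<bar> \<le> real ?H * (c / real \<tau> ^ CARD('n))}"
    have Q: "finite Q" "card Q \<le> ?C"
      using separated_packing[OF sep c \<tau>, of B ?H] by (simp_all add: Q_def)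
    let ?S = "gap_set \<alpha> (scale_set R D)"
    have bd: "bounded (scale_set R D)" by (rule bounded_scale_set[OF D(1)])
    have gap: "next_gap ?S x \<in> (\<lambda>(n, k). n \<bullet> \<alpha> + k) ` Q" if "x \<in> ?S" for x
    proof -
      obtain m where m: "m \<in> scale_set R D" "int_vec m" "x = frac (m \<bullet> \<alpha>)"
        using \<open>x \<in> ?S\<close> by (auto simp: gap_set_def int_vec_def)
      note ng = next_gap_gap_set[OF bd m(1,2), where \<alpha> = \<alpha>, folded m(3)]
      obtain n0 where n0: "int_vec n0" "norm (n0 - R *\<^sub>R z) \<le> real ?d" by (rule int_vec_near)
      \<comment> \<open>The target is a forward displacement of \<open>2 * J + 1\<close> units from
        \<open>m\<close>. An error of \<open>2 * J\<close> units leaves a positive value of at most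
        \<open>4 * J + 1\<close> units, which is \<open>?H\<close>.\<close>
      obtain n' k' where n': "int_vec n'" "k' \<in> \<int>" "\<forall>i. \<bar>n' $ i\<bar> \<le> real (2 * J) * real \<tau>"
        "\<bar>n' \<bullet> \<alpha> + k' - ((m - n0) \<bullet> \<alpha> + real (2 * J + 1) * \<delta>)\<bar> \<le> real (2 * J) * \<delta>"
        using separated_imp_dense[OF sep c(1) \<tau> J, of "(m - n0) \<bullet> \<alpha> + real (2 * J + 1) * \<delta>"]
        unfolding \<delta>_def by blast
      define n where "n = n0 + n'"
      have y: "\<bar>((n - m) \<bullet> \<alpha> + k') - real (2 * J + 1) * \<delta>\<bar> \<le> real (2 * J) * \<delta>"
        using n'(4) by (simp add: n_def inner_diff_left inner_add_left algebra_simps)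
      then have y0: "0 < (n - m) \<bullet> \<alpha> + k'" "(n - m) \<bullet> \<alpha> + k' \<le> real ?H * \<delta>"
        using \<delta> by (simp_all add: abs_le_iff algebra_simps)
      have "norm n' \<le> real ?d * (real (2 * J) * real \<tau>)"
        by (rule norm_le_card_components) (use n'(3) in auto)
      moreover have "norm (n - R *\<^sub>R z) \<le> norm (n0 - R *\<^sub>R z) + norm n'"
        using norm_triangle_ineq[of "n0 - R *\<^sub>R z" n'] by (simp add: n_def algebra_simps)
      ultimately have "norm (n - R *\<^sub>R z) \<le> real ?d * 1 + real ?d * (real (2 * J) * real \<tau>)"
        using n0(2) by simp
      also have "\<dots> \<le> real ?d * real \<tau> + real ?d * (real (2 * J) * real \<tau>)"
        using \<tau> by (intro add_right_mono mult_left_mono) auto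
      also have "\<dots> = \<mu> * real \<tau> * \<rho>" using z(1) by (simp add: \<mu>_def field_simps)
      also have "\<dots> \<le> R * \<rho>" using R(1) z(1) by (intro mult_right_mono) auto
      finally have nz: "norm (n - R *\<^sub>R z) \<le> R * \<rho>" .
      have "n - R *\<^sub>R z = R *\<^sub>R (n /\<^sub>R R - z)" using R0 by (simp add: algebra_simps)
      then have "norm (n /\<^sub>R R - z) * R \<le> R * \<rho>" using nz R0 by (simp add: mult.commute)
      then have "norm (n /\<^sub>R R - z) \<le> \<rho>" using R0 by (simp add: mult.commute)
      then have "n /\<^sub>R R \<in> D" using z(2) by (auto simp: dist_norm norm_minus_commute)
      then have "n \<in> scale_set R D" using R0 by (auto simp: scale_set_eq intro!: bexI[of _ "n /\<^sub>R R"])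
      then have le: "next_gap ?S x \<le> real ?H * \<delta>"
        using ng(3)[of n k'] y0 n'(2) int_vec_add[OF n0(1) n'(1)] unfolding n_def by linarith
      obtain l k where l: "l \<in> scale_set R D" "int_vec l" "k \<in> \<int>" "next_gap ?S x = (l - m) \<bullet> \<alpha> + k"
        using ng(2) by blast
      have "\<bar>(l - m) $ i\<bar> \<le> real B * real \<tau>" for i
      proof -
        have "norm l \<le> R * r" "norm m \<le> R * r"
          using l(1) m(1) r(2) R0 by (auto simp: scale_set_eq)
        then have "\<bar>(l - m) $ i\<bar> \<le> 2 * R * r"
          using component_le_norm_cart[of "l - m" i] norm_triangle_ineq4[of l m] by linarith
        also have "\<dots> \<le> 2 * (2 * \<mu> * real \<tau>) * r" using R(2) r(1) by (intro mult_right_mono mult_left_mono) auto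
        also have "\<dots> = (4 * \<mu> * r) * real \<tau>" by simp
        also have "\<dots> \<le> real B * real \<tau>" using B by (intro mult_right_mono) auto
        finally show ?thesis .
      qed
      then have "(l - m, k) \<in> Q"
        using l m ng(1) le int_vec_diff[OF l(2) m(2)] by (auto simp: Q_def \<delta>_def)
      then show ?thesis using l(4) by (intro image_eqI[where x = "(l - m, k)"]) auto
    qed
    have "num_gaps \<alpha> (scale_set R D) \<le> card ((\<lambda>(n, k). n \<bullet> \<alpha> + k) ` Q)"
      unfolding num_gaps_def using gap Q(1) by (intro card_mono finite_imageI) auto
    also have "\<dots> \<le> card Q" by (rule card_image_le[OF Q(1)])
    finally show ?thesis using Q(2) by simp
  qed
  then show thesis using that \<mu> by blast
qed

section \<open>Chords of convex sets\<close>

text \<open>A supremum, because \<open>D\<close> need not contain its boundary points. For a unit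
  vector \<open>e\<close> the exit times along \<open>e\<close> and \<open>- e\<close> add up to the
  length of the chord through \<open>z\<close>.\<close>

definition exit_time :: "(real ^ 'n) set \<Rightarrow> real ^ 'n \<Rightarrow> real ^ 'n \<Rightarrow> real" where
  "exit_time D e z = Sup {t. z + t *\<^sub>R e \<in> D}"

lemma convex_ray:
  assumes "convex D" "w \<in> D" "w + t *\<^sub>R u \<in> D" "0 \<le> s" "s \<le> t"
  shows "w + s *\<^sub>R u \<in> D"
proof (cases "t = 0")
  case False
  then have "(1 - s / t) *\<^sub>R w + (s / t) *\<^sub>R (w + t *\<^sub>R u) \<in> D"
    using assms by (intro convexD) auto
  moreover have "(1 - s / t) *\<^sub>R w + (s / t) *\<^sub>R (w + t *\<^sub>R u) = w + s *\<^sub>R u"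
    using False by (simp add: algebra_simps)
  ultimately show ?thesis by simp
qed (use assms in auto)

lemma bdd_above_ray:
  assumes "bounded D" "norm e = 1"
  shows "bdd_above {t. z + t *\<^sub>R e \<in> D}"
proof -
  obtain r where r: "\<And>x. x \<in> D \<Longrightarrow> norm x \<le> r" using assms(1) bounded_iff by blast
  have "t \<le> r + norm z" if "z + t *\<^sub>R e \<in> D" for t
  proof -
    have "norm (t *\<^sub>R e) \<le> norm (z + t *\<^sub>R e) + norm z"
      using norm_triangle_ineq4[of "z + t *\<^sub>R e" z] by simp
    then show ?thesis using r[OF that] assms(2) by simp
  qed
  then show ?thesis by (auto simp: bdd_above_def)
qed

lemma exit_time_props:
  assumes D: "bounded D" "convex D" and z: "z \<in> interior D" and e: "norm e = 1"
  shows "0 < exit_time D e z" "z + exit_time D e z *\<^sub>R e \<in> closure D"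
    "\<And>t. z + t *\<^sub>R e \<in> D \<Longrightarrow> t \<le> exit_time D e z"
    "\<And>t. 0 < t \<Longrightarrow> t < exit_time D e z \<Longrightarrow> z + t *\<^sub>R e \<in> interior D"
    "\<And>t. exit_time D e z < t \<Longrightarrow> z + t *\<^sub>R e \<notin> closure D"
proof -
  let ?S = "{t. z + t *\<^sub>R e \<in> D}"
  note bdd = bdd_above_ray[OF D(1) e, of z]
  show le: "t \<le> exit_time D e z" if "z + t *\<^sub>R e \<in> D" for t
    unfolding exit_time_def using that bdd by (intro cSup_upper) auto
  obtain \<rho> where \<rho>: "0 < \<rho>" "cball z \<rho> \<subseteq> D" using z mem_interior_cball by metis
  have "z + \<rho> *\<^sub>R e \<in> D" using \<rho> e by (intro subsetD[OF \<rho>(2)]) (auto simp: dist_norm)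
  then show pos: "0 < exit_time D e z" using le \<rho> by fastforce
  have ne: "?S \<noteq> {}" using \<open>z + \<rho> *\<^sub>R e \<in> D\<close> by auto
  have "closed {t. z + t *\<^sub>R e \<in> closure D}"
    unfolding vimage_def[symmetric, of "\<lambda>t. z + t *\<^sub>R e"] by (intro closed_vimage continuous_intros) auto
  then have "closure ?S \<subseteq> {t. z + t *\<^sub>R e \<in> closure D}"
    using closure_subset by (intro closure_minimal) auto
  then show "z + exit_time D e z *\<^sub>R e \<in> closure D"
    unfolding exit_time_def using closure_contains_Sup[OF ne bdd] by blast
  have seg: "z + s *\<^sub>R e \<in> interior D" if "z + t *\<^sub>R e \<in> closure D" "0 < s" "s < t" for s t
  proof -
    have "z + s *\<^sub>R e = (1 - s / t) *\<^sub>R z + (s / t) *\<^sub>R (z + t *\<^sub>R e)"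
      using that by (simp add: algebra_simps)
    moreover have "z \<noteq> z + t *\<^sub>R e" using that e by auto
    ultimately have "z + s *\<^sub>R e \<in> open_segment z (z + t *\<^sub>R e)"
      using that by (auto simp: in_segment intro!: exI[of _ "s / t"])
    then show ?thesis using in_interior_closure_convex_segment[OF D(2) z that(1)] by blast
  qed
  show "z + t *\<^sub>R e \<in> interior D" if "0 < t" "t < exit_time D e z" for t
    using seg[OF \<open>z + exit_time D e z *\<^sub>R e \<in> closure D\<close> that] .
  show "z + t *\<^sub>R e \<notin> closure D" if "exit_time D e z < t" for t
  proof
    assume a: "z + t *\<^sub>R e \<in> closure D"
    have "z + ((exit_time D e z + t) / 2) *\<^sub>R e \<in> interior D"
      using that pos by (intro seg[OF a]) auto
    then have "z + ((exit_time D e z + t) / 2) *\<^sub>R e \<in> D" using interior_subset by blast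
    then show False using le[of "(exit_time D e z + t) / 2"] that by simp
  qed
qed

text \<open>A lattice row starts only near \<open>z\<close>, runs only roughly along
  \<open>e\<close> and leaves \<open>D\<close> between two steps. One \<rho> serves all such rows:
  it is dictated by a ball inside \<open>D\<close> shortly before the exit and a ball outside the
  closure shortly after it. Convexity excludes a return after leaving.\<close>

lemma exit_steps:
  assumes D: "bounded D" "convex D" and z: "z \<in> interior D" and e: "norm e = 1" and \<sigma>: "0 < \<sigma>"
  obtains \<rho> where "0 < \<rho>" "cball z \<rho> \<subseteq> D"
    "\<And>w u h. norm (w - z) \<le> \<rho> \<Longrightarrow> 0 < h \<Longrightarrow> h \<le> \<rho> \<Longrightarrow> norm (u - h *\<^sub>R e) \<le> \<rho> * h \<Longrightarrow>
      \<exists>l::nat. w + real l *\<^sub>R u \<in> D \<and> (\<forall>l'>l. w + real l' *\<^sub>R u \<notin> D) \<and>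
        \<bar>real l * h - exit_time D e z\<bar> \<le> \<sigma>"
proof -
  define L where "L = exit_time D e z"
  note ex = exit_time_props[OF D z e, folded L_def]
  \<comment> \<open>The last step inside falls short of the exit by at most \<open>s + h\<close>,
    and \<open>h\<close> will be at most \<open>s\<close>; twice \<open>s\<close> has to stay within
    \<sigma>.\<close>
  define s where "s = min (\<sigma> / 2) (L / 2)"
  have s: "0 < s" "s < L" "2 * s \<le> \<sigma>" using \<sigma> ex(1) by (auto simp: s_def)
  obtain \<rho>0 where \<rho>0: "0 < \<rho>0" "cball z \<rho>0 \<subseteq> D" using z mem_interior_cball by metis
  have "z + (L - s) *\<^sub>R e \<in> interior D" using s by (intro ex(4)) auto
  then obtain \<rho>1 where \<rho>1: "0 < \<rho>1" "cball (z + (L - s) *\<^sub>R e) \<rho>1 \<subseteq> D" using mem_interior_cball by metis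
  have "z + (L + s) *\<^sub>R e \<in> - closure D" using s ex(5)[of "L + s"] by auto
  then obtain \<rho>2 where \<rho>2: "0 < \<rho>2" "cball (z + (L + s) *\<^sub>R e) \<rho>2 \<subseteq> - closure D"
    using open_contains_cball[of "- closure D"] by blast
  \<comment> \<open>Up to time \<open>L + s\<close> the errors in start and direction accumulate to
    at most \<open>\<rho> * (1 + L + s)\<close>, which must not exceed either ball radius.\<close>
  define \<rho> where "\<rho> = min (min \<rho>0 s) (min \<rho>1 \<rho>2 / (1 + L + s))"
  have Ls: "0 < 1 + L + s" using s by simp
  have \<rho>: "0 < \<rho>" "\<rho> \<le> \<rho>0" "\<rho> \<le> s" "\<rho> * (1 + L + s) \<le> \<rho>1" "\<rho> * (1 + L + s) \<le> \<rho>2"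
  proof -
    show "0 < \<rho>" "\<rho> \<le> \<rho>0" "\<rho> \<le> s" using \<rho>0 \<rho>1 \<rho>2 s Ls by (auto simp: \<rho>_def)
    have "\<rho> \<le> min \<rho>1 \<rho>2 / (1 + L + s)" by (simp add: \<rho>_def)
    then have "\<rho> * (1 + L + s) \<le> min \<rho>1 \<rho>2" using Ls by (simp add: le_divide_eq)
    then show "\<rho> * (1 + L + s) \<le> \<rho>1" "\<rho> * (1 + L + s) \<le> \<rho>2" by auto
  qed
  have main: "\<exists>l::nat. w + real l *\<^sub>R u \<in> D \<and> (\<forall>l'>l. w + real l' *\<^sub>R u \<notin> D) \<and> \<bar>real l * h - L\<bar> \<le> \<sigma>"
    if w: "norm (w - z) \<le> \<rho>" and h: "0 < h" "h \<le> \<rho>" and u: "norm (u - h *\<^sub>R e) \<le> \<rho> * h" for w u h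
  proof -
    have err: "dist (z + t *\<^sub>R e) (w + (t / h) *\<^sub>R u) \<le> \<rho> * (1 + L + s)" if t: "0 \<le> t" "t \<le> L + s" for t
    proof -
      have "(w + (t / h) *\<^sub>R u) - (z + t *\<^sub>R e) = (w - z) + (t / h) *\<^sub>R (u - h *\<^sub>R e)"
        using h by (simp add: algebra_simps)
      then have "dist (z + t *\<^sub>R e) (w + (t / h) *\<^sub>R u) \<le> norm (w - z) + norm ((t / h) *\<^sub>R (u - h *\<^sub>R e))"
        by (metis dist_norm norm_minus_commute norm_triangle_ineq)
      also have "norm ((t / h) *\<^sub>R (u - h *\<^sub>R e)) = (t / h) * norm (u - h *\<^sub>R e)" using t h by simp
      also have "\<dots> \<le> (t / h) * (\<rho> * h)" using t h u by (intro mult_left_mono) auto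
      also have "\<dots> = \<rho> * t" using h by simp
      also have "\<dots> \<le> \<rho> * (L + s)" using t \<rho> by (intro mult_left_mono) auto
      finally show ?thesis using w by (simp add: algebra_simps)
    qed
    have wD: "w \<in> D" using w \<rho> \<rho>0 by (auto simp: dist_norm norm_minus_commute subset_iff)
    have in1: "w + ((L - s) / h) *\<^sub>R u \<in> D"
      using err[of "L - s"] s \<rho> \<rho>1 by (intro subsetD[OF \<rho>1(2)]) auto
    have "w + ((L + s) / h) *\<^sub>R u \<in> - closure D"
      using err[of "L + s"] s \<rho> by (intro subsetD[OF \<rho>2(2)]) auto
    then have out2: "w + ((L + s) / h) *\<^sub>R u \<notin> D" using closure_subset by blast
    let ?S = "{l::nat. w + real l *\<^sub>R u \<in> D}"
    have up: "real l < (L + s) / h" if "l \<in> ?S" for l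
    proof (rule ccontr)
      assume "\<not> real l < (L + s) / h"
      moreover have "0 \<le> (L + s) / h" using s h by simp
      ultimately have "w + ((L + s) / h) *\<^sub>R u \<in> D"
        using that convex_ray[OF D(2) wD, of "real l" u "(L + s) / h"] by simp
      then show False using out2 by simp
    qed
    have "?S \<subseteq> {..nat \<lceil>(L + s) / h\<rceil>}"
    proof
      fix l assume "l \<in> ?S"
      from up[OF this] show "l \<in> {..nat \<lceil>(L + s) / h\<rceil>}" by simp linarith
    qed
    then have fin: "finite ?S" by (rule finite_subset) simp
    define l0 where "l0 = nat \<lfloor>(L - s) / h\<rfloor>"
    have r0: "0 \<le> (L - s) / h" using s h by simp
    then have l0: "real l0 \<le> (L - s) / h" "(L - s) / h - 1 < real l0" unfolding l0_def by linarith+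
    have l0S: "l0 \<in> ?S" using convex_ray[OF D(2) wD in1, of "real l0"] l0 by simp
    define l where "l = Max ?S"
    have lS: "l \<in> ?S" unfolding l_def using fin l0S by (intro Max_in) auto
    have "l0 \<le> l" unfolding l_def using fin l0S by simp
    then have "(L - s) / h - 1 < real l" using l0(2) by linarith
    then have "(L - s) - h < real l * h" using h by (simp add: field_simps)
    moreover have "real l * h < L + s" using up[OF lS] h by (simp add: less_divide_eq)
    ultimately have "\<bar>real l * h - L\<bar> \<le> \<sigma>" using h \<rho> s by (simp add: abs_le_iff)
    moreover have "w + real l' *\<^sub>R u \<notin> D" if "l < l'" for l'
      using that Max_ge[OF fin, of l'] by (auto simp: l_def)
    ultimately show ?thesis using lS by blast
  qed
  have "cball z \<rho> \<subseteq> D" using \<rho>0(2) subset_cball[OF \<rho>(2), of z] by blast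
  from \<rho>(1) this show thesis by (rule that) (rule main[unfolded L_def])
qed

text \<open>The direction is that of a diameter of the closure: by the parallelogram law no parallel chord
  is as long, while chords close to the diameter have almost the same length.\<close>
lemma infinite_chord_lengths:
  fixes D :: "(real ^ 'n) set"
  assumes card: "CARD('n) \<ge> 2" and D: "bounded D" "convex D" "interior D \<noteq> {}"
  obtains e where "norm e = 1"
    "infinite ((\<lambda>z. exit_time D e z + exit_time D (- e) z) ` interior D)"
proof -
  have C: "compact (closure D)" "closure D \<noteq> {}"
    using D closure_subset interior_subset by (auto simp: compact_closure)
  obtain x y where xy: "x \<in> closure D" "y \<in> closure D" "dist x y = diameter (closure D)"
    using diameter_compact_attained[OF C] by blast
  define L where "L = dist x y"
  have dL: "norm (p - q) \<le> L" if "p \<in> closure D" "q \<in> closure D" for p q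
    using diameter_bounded_bound[of "closure D" p q] that C xy by (auto simp: L_def dist_norm compact_imp_bounded)
  obtain z1 where z1: "z1 \<in> interior D" using D(3) by blast
  obtain \<rho> where \<rho>: "0 < \<rho>" "ball z1 \<rho> \<subseteq> interior D" using z1 open_contains_ball[of "interior D"] by blast
  obtain i0 i1 :: 'n where i: "i0 \<noteq> i1"
    using card_le_Suc0_iff_eq[of "UNIV :: 'n set"] card by auto
  have near: "z1 + (\<rho> / 2) *\<^sub>R axis i 1 \<in> interior D" for i
    using \<rho> by (intro subsetD[OF \<rho>(2)]) (auto simp: dist_norm norm_axis_1)
  have "norm (z1 + (\<rho> / 2) *\<^sub>R axis i0 1 - z1) \<le> L"
    using near[of i0] z1 interior_subset closure_subset by (intro dL) blast+
  then have Lpos: "0 < L" using \<rho> by (simp add: norm_axis_1)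
  define e where "e = (y - x) /\<^sub>R L"
  have e: "norm e = 1" using Lpos by (simp add: e_def L_def dist_norm norm_minus_commute)
  have yx: "y = x + L *\<^sub>R e" using Lpos by (simp add: e_def)
  \<comment> \<open>Were the interior contained in the line of the diameter, two orthogonal axis
    vectors would both be multiples of \<open>e\<close>.\<close>
  have "\<exists>z0. z0 \<in> interior D \<and> (\<forall>t. z0 \<noteq> x + t *\<^sub>R e)"
  proof (rule ccontr)
    assume "\<not> ?thesis"
    then have on: "\<exists>t. z = x + t *\<^sub>R e" if "z \<in> interior D" for z using that by blast
    obtain t where t: "z1 = x + t *\<^sub>R e" using on[OF z1] by blast
    have "\<exists>s. axis i (1::real) = s *\<^sub>R e" for i
    proof -
      obtain s where "z1 + (\<rho> / 2) *\<^sub>R axis i 1 = x + s *\<^sub>R e" using on[OF near] by blast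
      then have "(\<rho> / 2) *\<^sub>R axis i 1 = (s - t) *\<^sub>R e" using t by (simp add: algebra_simps)
      then have "(2 / \<rho>) *\<^sub>R ((\<rho> / 2) *\<^sub>R axis i 1) = (2 / \<rho>) *\<^sub>R ((s - t) *\<^sub>R e)" by simp
      then show ?thesis using \<rho> by (auto simp: intro!: exI[of _ "2 / \<rho> * (s - t)"])
    qed
    then obtain a b where ab: "axis i0 (1::real) = a *\<^sub>R e" "axis i1 (1::real) = b *\<^sub>R e" by metis
    have "axis i0 (1::real) \<bullet> axis i1 1 = a * b * (e \<bullet> e)" by (simp add: ab)
    then have "a * b = 0" using i e by (simp add: inner_axis_axis dot_square_norm)
    then show False using ab by (metis axis_eq_0_iff mult_eq_0_iff scaleR_zero_left zero_neq_one)
  qed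
  then obtain z0 where z0: "z0 \<in> interior D" "\<And>t. z0 \<noteq> x + t *\<^sub>R e" by blast
  let ?len = "\<lambda>z. exit_time D e z + exit_time D (- e) z"
  have e': "norm (- e) = 1" using e by simp
  \<comment> \<open>The path from the midpoint of the diameter to \<open>z0\<close>. The chord
    through \<open>zz \<mu>\<close> contains a copy of the diameter shrunk by
    \<open>1 - \<mu>\<close>.\<close>
  define zz where "zz \<mu> = (1 - \<mu>) *\<^sub>R (x + (L / 2) *\<^sub>R e) + \<mu> *\<^sub>R z0" for \<mu>
  have shrink: "(1 - \<mu>) *\<^sub>R p + \<mu> *\<^sub>R z0 \<in> interior D" if "p \<in> closure D" "0 < \<mu>" "\<mu> \<le> 1" for p \<mu>
    using mem_interior_closure_convex_shrink[OF D(2) z0(1) that] by (simp add: algebra_simps)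
  have zint: "zz \<mu> \<in> interior D" if "0 < \<mu>" "\<mu> \<le> 1" for \<mu>
  proof -
    have "convex (closure D)" using D(2) by (rule convex_closure)
    then have "x + (L / 2) *\<^sub>R e \<in> closure D"
      using convex_ray[of "closure D" x L e "L / 2"] xy yx Lpos by simp
    then show ?thesis unfolding zz_def using that by (rule shrink)
  qed
  have lower: "(1 - \<mu>) * L \<le> ?len (zz \<mu>)" if \<mu>: "0 < \<mu>" "\<mu> \<le> 1" for \<mu>
  proof -
    have "zz \<mu> + ((1 - \<mu>) * L / 2) *\<^sub>R e = (1 - \<mu>) *\<^sub>R y + \<mu> *\<^sub>R z0"
      by (simp add: zz_def yx vec_eq_iff field_simps)
    then have "zz \<mu> + ((1 - \<mu>) * L / 2) *\<^sub>R e \<in> D" using shrink[OF xy(2) \<mu>] interior_subset by auto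
    then have 1: "(1 - \<mu>) * L / 2 \<le> exit_time D e (zz \<mu>)" by (rule exit_time_props(3)[OF D(1,2) zint[OF \<mu>] e])
    have "zz \<mu> + ((1 - \<mu>) * L / 2) *\<^sub>R (- e) = (1 - \<mu>) *\<^sub>R x + \<mu> *\<^sub>R z0"
      by (simp add: zz_def vec_eq_iff field_simps)
    then have "zz \<mu> + ((1 - \<mu>) * L / 2) *\<^sub>R (- e) \<in> D" using shrink[OF xy(1) \<mu>] interior_subset by auto
    then have 2: "(1 - \<mu>) * L / 2 \<le> exit_time D (- e) (zz \<mu>)" by (rule exit_time_props(3)[OF D(1,2) zint[OF \<mu>] e'])
    from 1 2 show ?thesis by linarith
  qed
  have upper: "?len (zz \<mu>) < L" if \<mu>: "0 < \<mu>" "\<mu> \<le> 1" for \<mu>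
  proof (rule ccontr)
    assume not: "\<not> ?len (zz \<mu>) < L"
    define x' where "x' = zz \<mu> + exit_time D (- e) (zz \<mu>) *\<^sub>R (- e)"
    define y' where "y' = zz \<mu> + exit_time D e (zz \<mu>) *\<^sub>R e"
    have cl: "x' \<in> closure D" "y' \<in> closure D"
      unfolding x'_def y'_def by (rule exit_time_props(2)[OF D(1,2) zint[OF \<mu>]], rule e e')+
    have "y' - x' = ?len (zz \<mu>) *\<^sub>R e" by (simp add: x'_def y'_def algebra_simps)
    moreover from this have "?len (zz \<mu>) \<le> L" using dL[OF cl(2,1)] e by simp
    ultimately have yx': "y' - x' = L *\<^sub>R e" using not by simp
    \<comment> \<open>The offset between the diameter and a parallel chord of the same length. Both
      diagonals \<open>w + L *\<^sub>R e\<close> and \<open>w - L *\<^sub>R e\<close> join points of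
      the closure, so the parallelogram law forces the offset to vanish, which would put
      \<open>z0\<close> on the diameter line.\<close>
    define w where "w = x' - x"
    have "w \<noteq> 0"
    proof
      assume "w = 0"
      then have "zz \<mu> = x + exit_time D (- e) (zz \<mu>) *\<^sub>R e" by (simp add: w_def x'_def algebra_simps)
      then have "\<mu> *\<^sub>R z0 = \<mu> *\<^sub>R x + (exit_time D (- e) (zz \<mu>) - (1 - \<mu>) * L / 2) *\<^sub>R e"
        by (simp add: zz_def vec_eq_iff field_simps)
      then have "(1 / \<mu>) *\<^sub>R (\<mu> *\<^sub>R z0) = (1 / \<mu>) *\<^sub>R (\<mu> *\<^sub>R x + (exit_time D (- e) (zz \<mu>) - (1 - \<mu>) * L / 2) *\<^sub>R e)" by simp
      then have "z0 = x + ((1 / \<mu>) * (exit_time D (- e) (zz \<mu>) - (1 - \<mu>) * L / 2)) *\<^sub>R e"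
        using \<mu> by (simp add: scaleR_right_distrib)
      then show False using z0(2) by blast
    qed
    have "norm (w + L *\<^sub>R e) \<le> L" using dL[OF cl(2) xy(1)] yx' by (simp add: w_def algebra_simps)
    moreover have "norm (w - L *\<^sub>R e) \<le> L" using dL[OF cl(1) xy(2)] by (simp add: w_def yx algebra_simps)
    ultimately have "(norm (w + L *\<^sub>R e))\<^sup>2 + (norm (w - L *\<^sub>R e))\<^sup>2 \<le> L\<^sup>2 + L\<^sup>2"
      by (intro add_mono power_mono) auto
    moreover have "(norm (a + b))\<^sup>2 + (norm (a - b))\<^sup>2 = 2 * (norm a)\<^sup>2 + 2 * (norm b)\<^sup>2" for a b :: "real ^ 'n"
      unfolding power2_norm_eq_inner by (simp add: inner_add inner_diff inner_commute)
    from this[of w "L *\<^sub>R e"] have "(norm (w + L *\<^sub>R e))\<^sup>2 + (norm (w - L *\<^sub>R e))\<^sup>2 = 2 * (norm w)\<^sup>2 + 2 * L\<^sup>2"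
      using e by simp
    ultimately have "(norm w)\<^sup>2 \<le> 0" by simp
    then show False using \<open>w \<noteq> 0\<close> by simp
  qed
  have "infinite (?len ` interior D)"
  proof
    assume fin: "finite (?len ` interior D)"
    let ?V = "?len ` (zz ` {0<..1})"
    have V: "finite ?V" "?V \<noteq> {}"
    proof -
      have "?V \<subseteq> ?len ` interior D" using zint by (intro image_mono) auto
      then show "finite ?V" using fin by (rule finite_subset)
    qed auto
    have "Max ?V \<in> ?V" by (rule Max_in[OF V])
    then have Mlt: "Max ?V < L" using upper by auto
    \<comment> \<open>The lengths stay below \<open>L\<close> but approach it as \<mu> tends to 0;
      this \<mu> brings the length past the supposed maximum.\<close>
    define \<mu> where "\<mu> = min 1 ((L - Max ?V) / (2 * L))"
    have \<mu>: "0 < \<mu>" "\<mu> \<le> 1" "\<mu> * (2 * L) \<le> L - Max ?V"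
    proof -
      show "0 < \<mu>" "\<mu> \<le> 1" using Mlt Lpos by (auto simp: \<mu>_def)
      have "\<mu> \<le> (L - Max ?V) / (2 * L)" by (simp add: \<mu>_def)
      then show "\<mu> * (2 * L) \<le> L - Max ?V" using Lpos by (simp add: le_divide_eq)
    qed
    have "?len (zz \<mu>) \<le> Max ?V" using \<mu> by (intro Max_ge[OF V(1)]) auto
    then have "L - \<mu> * L \<le> Max ?V" using lower[OF \<mu>(1,2)] by (simp add: algebra_simps)
    then show False using \<mu>(3) Mlt by linarith
  qed
  then show thesis using that e by blast
qed

section \<open>Many gaps\<close>

text \<open>At scale \<^term>\<open>T\<close>, the only vectors \<^term>\<open>n\<close> with \<^term>\<open>n \<bullet> \<alpha>\<close> modulo one slightly positive form
  two rows in direction \<^term>\<open>v\<close>, which is short and almost antiparallel to \<^term>\<open>e\<close>.\<close>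
definition row_structured :: "real ^ 'n \<Rightarrow> real \<Rightarrow> real \<Rightarrow> real \<Rightarrow> real \<Rightarrow> real ^ 'n \<Rightarrow> bool" where
  "row_structured e \<epsilon> \<delta> \<Delta> T \<alpha> \<longleftrightarrow> (\<exists>v kv b kb Y w.
     int_vec v \<and> kv \<in> \<int> \<and> int_vec b \<and> kb \<in> \<int> \<and> 0 < w \<and> w \<le> \<epsilon> * T \<and>
     norm (v + w *\<^sub>R e) \<le> \<delta> * w \<and> norm b \<le> 3 * w \<and> 0 < v \<bullet> \<alpha> + kv \<and>
     (\<forall>n k. int_vec n \<and> k \<in> \<int> \<and> norm n \<le> \<Delta> * T \<and> 0 < n \<bullet> \<alpha> + k \<and> n \<bullet> \<alpha> + k < Y \<longrightarrow>
        (\<exists>l::int. n = of_int l *\<^sub>R v \<and> k = of_int l * kv) \<or>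
        (\<exists>l::int. n = b + of_int l *\<^sub>R v \<and> k = kb + of_int l * kv)) \<and>
     (\<forall>l::int. norm (b + of_int l *\<^sub>R v) \<le> \<Delta> * T \<longrightarrow>
        0 < (b + of_int l *\<^sub>R v) \<bullet> \<alpha> + (kb + of_int l * kv) \<and>
        (b + of_int l *\<^sub>R v) \<bullet> \<alpha> + (kb + of_int l * kv) < Y))"

text \<open>Lets a direction from a countable dense set stand in for the one dictated by the convex
  set: the distance of the two directions is paid for by the angular tolerance.\<close>

lemma row_structured_mono:
  assumes "row_structured e \<epsilon> \<delta> \<Delta> T \<alpha>" "\<epsilon> \<le> \<epsilon>'" "\<delta> \<le> \<delta>'" "\<Delta>' \<le> \<Delta>" "0 \<le> T" "norm (e - e') \<le> \<delta>'' - \<delta>'"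
  shows "row_structured e' \<epsilon>' \<delta>'' \<Delta>' T \<alpha>"
proof -
  have DT: "\<Delta>' * T \<le> \<Delta> * T" "\<epsilon> * T \<le> \<epsilon>' * T" using assms by (auto intro: mult_right_mono)
  have near: "norm (v + w *\<^sub>R e') \<le> \<delta>'' * w" if "0 < w" "norm (v + w *\<^sub>R e) \<le> \<delta> * w" for v w
  proof -
    have "v + w *\<^sub>R e' = (v + w *\<^sub>R e) - w *\<^sub>R (e - e')" by (simp add: algebra_simps)
    then have "norm (v + w *\<^sub>R e') \<le> norm (v + w *\<^sub>R e) + norm (w *\<^sub>R (e - e'))"
      by (metis norm_triangle_ineq4)
    also have "norm (w *\<^sub>R (e - e')) \<le> w * (\<delta>'' - \<delta>')"
      using that assms(6) by simp
    also have "norm (v + w *\<^sub>R e) \<le> \<delta>' * w"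
      using that assms(3) mult_right_mono[of \<delta> \<delta>' w] by linarith
    finally show ?thesis by (simp add: algebra_simps)
  qed
  obtain v kv b kb Y w where rs:
     "int_vec v" "kv \<in> \<int>" "int_vec b" "kb \<in> \<int>" "0 < w" "w \<le> \<epsilon> * T"
     "norm (v + w *\<^sub>R e) \<le> \<delta> * w" "norm b \<le> 3 * w" "0 < v \<bullet> \<alpha> + kv"
     "\<forall>n k. int_vec n \<and> k \<in> \<int> \<and> norm n \<le> \<Delta> * T \<and> 0 < n \<bullet> \<alpha> + k \<and> n \<bullet> \<alpha> + k < Y \<longrightarrow>
        (\<exists>l::int. n = of_int l *\<^sub>R v \<and> k = of_int l * kv) \<or>
        (\<exists>l::int. n = b + of_int l *\<^sub>R v \<and> k = kb + of_int l * kv)"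
     "\<forall>l::int. norm (b + of_int l *\<^sub>R v) \<le> \<Delta> * T \<longrightarrow>
        0 < (b + of_int l *\<^sub>R v) \<bullet> \<alpha> + (kb + of_int l * kv) \<and>
        (b + of_int l *\<^sub>R v) \<bullet> \<alpha> + (kb + of_int l * kv) < Y"
    using assms(1) unfolding row_structured_def by blast
  show ?thesis unfolding row_structured_def
  proof (intro exI conjI)
    show "w \<le> \<epsilon>' * T" using rs(6) DT by linarith
    show "norm (v + w *\<^sub>R e') \<le> \<delta>'' * w" using near rs(5,7) .
    show "\<forall>n k. int_vec n \<and> k \<in> \<int> \<and> norm n \<le> \<Delta>' * T \<and> 0 < n \<bullet> \<alpha> + k \<and> n \<bullet> \<alpha> + k < Y \<longrightarrow>
        (\<exists>l::int. n = of_int l *\<^sub>R v \<and> k = of_int l * kv) \<or>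
        (\<exists>l::int. n = b + of_int l *\<^sub>R v \<and> k = kb + of_int l * kv)"
      using rs(10) DT(1) order_trans by blast
    show "\<forall>l::int. norm (b + of_int l *\<^sub>R v) \<le> \<Delta>' * T \<longrightarrow>
        0 < (b + of_int l *\<^sub>R v) \<bullet> \<alpha> + (kb + of_int l * kv) \<and>
        (b + of_int l *\<^sub>R v) \<bullet> \<alpha> + (kb + of_int l * kv) < Y"
      using rs(11) DT(1) order_trans by blast
  qed (use rs in auto)
qed

text \<open>A step along the row of \<open>m\<close> by a positive multiple of \<open>v\<close>
  would, by convexity, put \<open>m + v\<close> into \<open>E\<close>. So the next point lies in the
  row through \<open>m + b\<close>, and since \<open>v\<close> has positive value, the smallest
  value there belongs to the largest admissible \<open>K\<close>.\<close>

lemma next_gap_row_end: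
  assumes E: "bounded E" "convex E" "\<And>x. x \<in> E \<Longrightarrow> norm x \<le> r"
    and v: "int_vec v" "kv \<in> \<int>" "0 < v \<bullet> \<alpha> + kv" and b: "int_vec b" "kb \<in> \<int>"
    and rows: "\<And>n k. int_vec n \<Longrightarrow> k \<in> \<int> \<Longrightarrow> norm n \<le> 2 * r \<Longrightarrow> 0 < n \<bullet> \<alpha> + k \<Longrightarrow> n \<bullet> \<alpha> + k < Y \<Longrightarrow>
        (\<exists>l::int. n = of_int l *\<^sub>R v \<and> k = of_int l * kv) \<or>
        (\<exists>l::int. n = b + of_int l *\<^sub>R v \<and> k = kb + of_int l * kv)"
    and brow: "\<And>l::int. norm (b + of_int l *\<^sub>R v) \<le> 2 * r \<Longrightarrow>
        0 < (b + of_int l *\<^sub>R v) \<bullet> \<alpha> + (kb + of_int l * kv) \<and>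
        (b + of_int l *\<^sub>R v) \<bullet> \<alpha> + (kb + of_int l * kv) < Y"
    and m: "m \<in> E" "int_vec m" "m + v \<notin> E"
    and K: "m + b - of_int K *\<^sub>R v \<in> E" "\<And>K'::int. K < K' \<Longrightarrow> m + b - of_int K' *\<^sub>R v \<notin> E"
  shows "next_gap (gap_set \<alpha> E) (frac (m \<bullet> \<alpha>)) = b \<bullet> \<alpha> + kb - of_int K * (v \<bullet> \<alpha> + kv)"
proof -
  let ?g = "next_gap (gap_set \<alpha> E) (frac (m \<bullet> \<alpha>))"
  note ng = next_gap_gap_set[OF E(1) m(1,2), where \<alpha> = \<alpha>]
  have diff: "norm (n - m) \<le> 2 * r" if "n \<in> E" for n
    using norm_triangle_ineq4[of n m] E(3)[OF that] E(3)[OF m(1)] by linarith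
  define c where "c = b + of_int (- K) *\<^sub>R v"
  have c: "c = (m + b - of_int K *\<^sub>R v) - m" by (simp add: c_def)
  have cv: "c \<bullet> \<alpha> + (kb + of_int (- K) * kv) = b \<bullet> \<alpha> + kb - of_int K * (v \<bullet> \<alpha> + kv)"
    by (simp add: c_def inner_diff_left algebra_simps)
  have "norm c \<le> 2 * r" unfolding c by (rule diff[OF K(1)])
  then have cY: "0 < c \<bullet> \<alpha> + (kb + of_int (- K) * kv)" "c \<bullet> \<alpha> + (kb + of_int (- K) * kv) < Y"
    using brow[of "- K"] unfolding c_def by blast+
  have iv: "int_vec (m + b - of_int K *\<^sub>R v)"
    by (intro int_vec_diff int_vec_add int_vec_scaleR m b v) simp
  have kk: "kb + of_int (- K) * kv \<in> \<int>" using b v by (intro Ints_add Ints_mult) auto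
  have le: "?g \<le> b \<bullet> \<alpha> + kb - of_int K * (v \<bullet> \<alpha> + kv)"
    using ng(3)[OF K(1) iv kk] cY(1) unfolding c cv[symmetric] by simp
  obtain n k where n: "n \<in> E" "int_vec n" "k \<in> \<int>" "?g = (n - m) \<bullet> \<alpha> + k" using ng(2) by blast
  have gY: "?g < Y" using le cY(2) cv by linarith
  from rows[OF int_vec_diff[OF n(2) m(2)] n(3) diff[OF n(1)]] ng(1) gY n(4)
  consider l :: int where "n - m = of_int l *\<^sub>R v" "k = of_int l * kv"
    | l :: int where "n - m = b + of_int l *\<^sub>R v" "k = kb + of_int l * kv" by auto
  then show ?thesis
  proof cases
    case 1
    have "?g = of_int l * (v \<bullet> \<alpha> + kv)" by (simp add: n(4) 1 algebra_simps)
    then have "0 < l" using ng(1) v(3) by (simp add: zero_less_mult_iff)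
    then have "1 \<le> real_of_int l" by linarith
    moreover have "m + of_int l *\<^sub>R v \<in> E" using n(1) 1(1) by (metis add.commute diff_add_cancel)
    ultimately have "m + 1 *\<^sub>R v \<in> E" using convex_ray[OF E(2) m(1), of "of_int l" v 1] by simp
    then show ?thesis using m(3) by simp
  next
    case 2
    have "n = m + b - of_int (- l) *\<^sub>R v" using 2(1) by (simp add: algebra_simps)
    then have "- l \<le> K" using K(2)[of "- l"] n(1) by force
    then have "real_of_int (- K) * (v \<bullet> \<alpha> + kv) \<le> of_int l * (v \<bullet> \<alpha> + kv)"
      using v(3) by (intro mult_right_mono) auto
    moreover have "?g = b \<bullet> \<alpha> + kb + of_int l * (v \<bullet> \<alpha> + kv)" by (simp add: n(4) 2 inner_add_left algebra_simps)
    ultimately show ?thesis using le by simp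
  qed
qed

text \<open>The gap after a row end is an injective affine function of the index \<open>K\<close>,
  and \<open>K\<close> measures a chord: the steps from near \<open>z\<close> forward to the end of
  its row, plus the steps from there back to the start of the neighbouring row. In units of the step
  length \<open>h\<close> this is the chord length up to a small error, so chords of different
  lengths produce different gaps.\<close>

lemma many_gaps:
  fixes D :: "(real ^ 'n) set"
  assumes card: "CARD('n) \<ge> 2" and D: "bounded D" "convex D" "interior D \<noteq> {}"
  obtains e \<eta> T0 where "norm e = 1" "0 < \<eta>"
    "\<And>\<alpha> T R. row_structured e \<eta> \<eta> (1 / \<eta>) T \<alpha> \<Longrightarrow> T0 \<le> T \<Longrightarrow> T \<le> R \<Longrightarrow> R \<le> 2 * T \<Longrightarrow>
       N \<le> num_gaps \<alpha> (scale_set R D)"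
proof -
  obtain e where e: "norm e = 1" and inf: "infinite ((\<lambda>z. exit_time D e z + exit_time D (- e) z) ` interior D)"
    using infinite_chord_lengths[OF card D] by blast
  define len where "len z = exit_time D e z + exit_time D (- e) z" for z
  obtain V where V: "V \<subseteq> len ` interior D" "finite V" "card V = N"
    using infinite_arbitrarily_large[OF inf, of N] unfolding len_def by blast
  obtain Z where Z: "Z \<subseteq> interior D" "V = len ` Z" "inj_on len Z"
    using V(1) by (meson subset_image_inj)
  have Zf: "finite Z" "card Z = N" using V(2,3) Z(2,3) finite_image_iff card_image by metis+
  obtain \<gamma> where \<gamma>: "0 < \<gamma>" "\<And>z z'. z \<in> Z \<Longrightarrow> z' \<in> Z \<Longrightarrow> z \<noteq> z' \<Longrightarrow> \<gamma> \<le> \<bar>len z - len z'\<bar>"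
  proof -
    let ?P = "{p \<in> Z \<times> Z. fst p \<noteq> snd p}"
    have fin: "finite ((\<lambda>p. \<bar>len (fst p) - len (snd p)\<bar>) ` ?P)" using Zf by simp
    define \<gamma> where "\<gamma> = Min (insert 1 ((\<lambda>p. \<bar>len (fst p) - len (snd p)\<bar>) ` ?P))"
    have "0 < \<gamma>" unfolding \<gamma>_def using fin Z(3) by (subst Min_gr_iff) (auto simp: inj_on_def)
    moreover have "\<gamma> \<le> \<bar>len z - len z'\<bar>" if "z \<in> Z" "z' \<in> Z" "z \<noteq> z'" for z z'
      unfolding \<gamma>_def using fin that by (intro Min_le) force+
    ultimately show thesis using that by blast
  qed
  \<comment> \<open>Each chord length is recovered within \<open>2 * \<sigma>\<close>, so equal
    indices mean lengths within \<open>4 * \<sigma>\<close>, which has to be below \<gamma>.\<close>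
  define \<sigma> where "\<sigma> = \<gamma> / 5"
  have \<sigma>: "0 < \<sigma>" "4 * \<sigma> < \<gamma>" using \<gamma>(1) by (auto simp: \<sigma>_def)
  define steps where "steps e z \<rho> \<longleftrightarrow> 0 < \<rho> \<and> cball z \<rho> \<subseteq> D \<and>
    (\<forall>w u h. norm (w - z) \<le> \<rho> \<longrightarrow> 0 < h \<longrightarrow> h \<le> \<rho> \<longrightarrow> norm (u - h *\<^sub>R e) \<le> \<rho> * h \<longrightarrow>
      (\<exists>l::nat. w + real l *\<^sub>R u \<in> D \<and> (\<forall>l'>l. w + real l' *\<^sub>R u \<notin> D) \<and>
        \<bar>real l * h - exit_time D e z\<bar> \<le> \<sigma>))" for e z \<rho>
  have ex: "\<exists>\<rho>. steps e z \<rho>" if "z \<in> interior D" "norm e = 1" for e z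
    using exit_steps[OF D(1,2) that \<sigma>(1)] unfolding steps_def by metis
  have mono: "steps e z \<rho>'" if s: "steps e z \<rho>" "0 < \<rho>'" "\<rho>' \<le> \<rho>" for e z \<rho> \<rho>'
    unfolding steps_def
  proof (intro conjI allI impI)
    show "cball z \<rho>' \<subseteq> D" using s subset_cball[of \<rho>' \<rho> z] unfolding steps_def by blast
    fix w u h assume a: "norm (w - z) \<le> \<rho>'" "0 < h" "h \<le> \<rho>'" "norm (u - h *\<^sub>R e) \<le> \<rho>' * h"
    then have "norm (u - h *\<^sub>R e) \<le> \<rho> * h" using mult_right_mono[of \<rho>' \<rho> h] s(3) by linarith
    then show "\<exists>l::nat. w + real l *\<^sub>R u \<in> D \<and> (\<forall>l'>l. w + real l' *\<^sub>R u \<notin> D) \<and>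
        \<bar>real l * h - exit_time D e z\<bar> \<le> \<sigma>"
      using s(1) a s(3) unfolding steps_def by (meson order_trans)
  qed (use s in auto)
  obtain \<rho> where \<rho>: "0 < \<rho>" "\<And>z. z \<in> Z \<Longrightarrow> steps e z \<rho> \<and> steps (- e) z \<rho>"
  proof -
    define f where "f z = min (SOME \<rho>. steps e z \<rho>) (SOME \<rho>. steps (- e) z \<rho>)" for z
    have f: "0 < f z" "steps e z (f z)" "steps (- e) z (f z)" if "z \<in> Z" for z
    proof -
      have zD: "z \<in> interior D" and e': "norm (- e) = 1" using Z(1) that e by auto
      have 1: "steps e z (SOME \<rho>. steps e z \<rho>)" using ex[OF zD e] by (rule someI_ex)
      have 2: "steps (- e) z (SOME \<rho>. steps (- e) z \<rho>)" using ex[OF zD e'] by (rule someI_ex)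
      show pos: "0 < f z" using 1 2 unfolding f_def steps_def by simp
      show "steps e z (f z)" by (rule mono[OF 1 pos]) (simp add: f_def)
      show "steps (- e) z (f z)" by (rule mono[OF 2 pos]) (simp add: f_def)
    qed
    define \<rho> where "\<rho> = Min (insert 1 (f ` Z))"
    have "0 < \<rho>" unfolding \<rho>_def using Zf f by (subst Min_gr_iff) auto
    moreover have "\<rho> \<le> f z" if "z \<in> Z" for z unfolding \<rho>_def using Zf that by (intro Min_le) auto
    ultimately show thesis using that[of \<rho>] f mono by blast
  qed
  obtain r where r: "0 < r" "\<And>x. x \<in> D \<Longrightarrow> norm x \<le> r" using D(1) by (auto simp: bounded_pos)
  \<comment> \<open>The first term makes the rescaled \<open>b\<close>, of norm at most
    \<open>3 * h\<close>, at most half of \<rho>. The second makes all differences of points of the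
    dilated set, of norm at most \<open>4 * r * T\<close>, fall into the range controlled by
    \<open>row_structured\<close>.\<close>
  define \<eta> where "\<eta> = min (\<rho> / 6) (1 / (4 * r))"
  have \<eta>: "0 < \<eta>" "6 * \<eta> \<le> \<rho>" "4 * r \<le> 1 / \<eta>"
  proof -
    show "0 < \<eta>" "6 * \<eta> \<le> \<rho>" using \<rho>(1) r(1) by (auto simp: \<eta>_def)
    have "\<eta> \<le> 1 / (4 * r)" by (simp add: \<eta>_def)
    then show "4 * r \<le> 1 / \<eta>" using \<open>0 < \<eta>\<close> r(1) by (simp add: field_simps)
  qed
  \<comment> \<open>Rounding \<open>R *\<^sub>R z\<close> to an integer vector then costs at most
    half of \<rho> after rescaling; the other half is left for \<open>b\<close>.\<close>
  define T0 where "T0 = 1 + 2 * real CARD('n) / \<rho>"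
  have T0: "1 \<le> T0" "2 * real CARD('n) \<le> \<rho> * T0" using \<rho>(1) by (auto simp: T0_def field_simps)
  have "N \<le> num_gaps \<alpha> (scale_set R D)"
    if row: "row_structured e \<eta> \<eta> (1 / \<eta>) T \<alpha>" and T: "T0 \<le> T" and R: "T \<le> R" "R \<le> 2 * T" for \<alpha> T R
  proof -
    obtain v kv b kb Y w where rs:
       "int_vec v" "kv \<in> \<int>" "int_vec b" "kb \<in> \<int>" "0 < w" "w \<le> \<eta> * T"
       "norm (v + w *\<^sub>R e) \<le> \<eta> * w" "norm b \<le> 3 * w" "0 < v \<bullet> \<alpha> + kv"
      and rows: "\<forall>n k. int_vec n \<and> k \<in> \<int> \<and> norm n \<le> 1 / \<eta> * T \<and> 0 < n \<bullet> \<alpha> + k \<and> n \<bullet> \<alpha> + k < Y \<longrightarrow>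
          (\<exists>l::int. n = of_int l *\<^sub>R v \<and> k = of_int l * kv) \<or>
          (\<exists>l::int. n = b + of_int l *\<^sub>R v \<and> k = kb + of_int l * kv)"
      and brow: "\<forall>l::int. norm (b + of_int l *\<^sub>R v) \<le> 1 / \<eta> * T \<longrightarrow>
          0 < (b + of_int l *\<^sub>R v) \<bullet> \<alpha> + (kb + of_int l * kv) \<and>
          (b + of_int l *\<^sub>R v) \<bullet> \<alpha> + (kb + of_int l * kv) < Y"
      using row unfolding row_structured_def by blast
    have R0: "0 < R" "0 < T" using R T T0 by auto
    let ?E = "scale_set R D"
    have inE: "R *\<^sub>R x \<in> ?E \<longleftrightarrow> x \<in> D" for x using R0 by (auto simp: scale_set_eq)
    have E: "bounded ?E" "convex ?E" using D bounded_scale_set convex_scaling by (auto simp: scale_set_def)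
    have Er: "norm x \<le> R * r" if "x \<in> ?E" for x
      using that r(2) R0 by (auto simp: scale_set_eq intro!: mult_left_mono)
    have big: "2 * (R * r) \<le> 1 / \<eta> * T"
    proof -
      have "2 * (R * r) \<le> 4 * r * T" using mult_right_mono[OF R(2), of r] r(1) by simp
      also have "\<dots> \<le> 1 / \<eta> * T" using \<eta>(3) R0 by (intro mult_right_mono) auto
      finally show ?thesis .
    qed
    define u where "u = v /\<^sub>R R"
    define h where "h = w / R"
    define \<beta> where "\<beta> = b /\<^sub>R R"
    have Ru: "R *\<^sub>R u = v" "R *\<^sub>R \<beta> = b" using R0 by (auto simp: u_def \<beta>_def)
    have h: "0 < h" "h \<le> \<eta>"
    proof -
      show "0 < h" using rs(5) R0 by (simp add: h_def)
      have "w \<le> \<eta> * R" using rs(6) mult_left_mono[OF R(1), of \<eta>] \<eta>(1) by linarith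
      then show "h \<le> \<eta>" using R0 by (simp add: h_def divide_le_eq)
    qed
    have uh: "norm (u + h *\<^sub>R e) \<le> \<rho> * h"
    proof -
      have "u + h *\<^sub>R e = (v + w *\<^sub>R e) /\<^sub>R R" by (simp add: u_def h_def divide_inverse algebra_simps)
      then have "norm (u + h *\<^sub>R e) = norm (v + w *\<^sub>R e) / R" using R0 by (simp add: divide_inverse mult.commute)
      also have "\<dots> \<le> \<eta> * w / R" using rs(7) R0 by (intro divide_right_mono) auto
      also have "\<dots> = \<eta> * h" by (simp add: h_def)
      also have "\<dots> \<le> \<rho> * h" using h \<eta> by (intro mult_right_mono) auto
      finally show ?thesis .
    qed
    have \<beta>: "norm \<beta> \<le> \<rho> / 2"
    proof -
      have "norm \<beta> = norm b / R" using R0 by (simp add: \<beta>_def divide_inverse mult.commute)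
      also have "\<dots> \<le> 3 * w / R" using rs(8) R0 by (intro divide_right_mono) auto
      also have "\<dots> = 3 * h" by (simp add: h_def)
      finally show ?thesis using h \<eta> by linarith
    qed
    have "\<forall>z\<in>Z. \<exists>K::int. b \<bullet> \<alpha> + kb - of_int K * (v \<bullet> \<alpha> + kv) \<in> next_gap (gap_set \<alpha> ?E) ` gap_set \<alpha> ?E \<and>
        \<bar>of_int K * h - len z\<bar> \<le> 2 * \<sigma>"
    proof
      fix z assume z: "z \<in> Z"
      obtain m where m: "int_vec m" "norm (m - R *\<^sub>R z) \<le> real CARD('n)" by (rule int_vec_near)
      define a where "a = m /\<^sub>R R"
      have Ra: "R *\<^sub>R a = m" using R0 by (simp add: a_def)
      have "R * norm (a - z) = norm (m - R *\<^sub>R z)"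
        using R0 by (simp flip: Ra norm_scaleR scaleR_right_diff_distrib) (simp add: scaleR_right_diff_distrib flip: scaleR_right_diff_distrib)
      also have "\<dots> \<le> \<rho> * R / 2" using m(2) T0(2) mult_left_mono[of T0 R \<rho>] \<rho>(1) T R by linarith
      finally have az: "norm (a - z) \<le> \<rho> / 2" using R0 by (simp add: field_simps)
      have st: "steps e z \<rho>" "steps (- e) z \<rho>" using \<rho>(2)[OF z] by auto
      obtain l :: nat where l: "a + real l *\<^sub>R u \<in> D" "\<forall>l'>l. a + real l' *\<^sub>R u \<notin> D"
        "\<bar>real l * h - exit_time D (- e) z\<bar> \<le> \<sigma>"
        using st(2) az h \<eta> \<rho>(1) uh unfolding steps_def
        by (elim conjE) (drule spec[of _ a], drule spec[of _ u], drule spec[of _ h], auto)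
      have abz: "norm (a + \<beta> - z) \<le> \<rho>"
        using az \<beta> norm_triangle_ineq[of "a - z" \<beta>] by (simp add: algebra_simps)
      have uh': "norm (- u - h *\<^sub>R e) \<le> \<rho> * h" using uh norm_minus_cancel[of "u + h *\<^sub>R e"] by simp
      obtain j :: nat where j: "(a + \<beta>) + real j *\<^sub>R (- u) \<in> D" "\<forall>j'>j. (a + \<beta>) + real j' *\<^sub>R (- u) \<notin> D"
        "\<bar>real j * h - exit_time D e z\<bar> \<le> \<sigma>"
        using st(1) abz h \<eta> \<rho>(1) uh' unfolding steps_def
        by (elim conjE) (drule spec[of _ "a + \<beta>"], drule spec[of _ "- u"], drule spec[of _ h], auto)
      define m' where "m' = m + real l *\<^sub>R v"
      have m'R: "m' = R *\<^sub>R (a + real l *\<^sub>R u)" by (simp add: m'_def scaleR_right_distrib Ra flip: Ru)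
      have m': "m' \<in> ?E" "int_vec m'" "m' + v \<notin> ?E"
      proof -
        show "m' \<in> ?E" unfolding m'R inE by (rule l(1))
        show "int_vec m'" unfolding m'_def by (intro int_vec_add int_vec_scaleR m rs) simp
        have "m' + v = R *\<^sub>R (a + real (Suc l) *\<^sub>R u)" by (simp add: m'R Ru(1)[symmetric] algebra_simps)
        then show "m' + v \<notin> ?E" using l(2) by (simp only: inE) auto
      qed
      \<comment> \<open>Relative to the row end \<open>m'\<close>, the first \<open>l\<close> steps
        back undo the way from \<open>m\<close>; the other \<open>j\<close> steps lead on to the far
        boundary in direction \<open>e\<close>.\<close>
      define K where "K = int (l + j)"
      have mK: "m' + b - of_int K' *\<^sub>R v = R *\<^sub>R ((a + \<beta>) + of_int (K' - int l) *\<^sub>R (- u))" for K'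
        by (simp add: m'_def Ru(1)[symmetric] Ru(2)[symmetric] Ra[symmetric] algebra_simps)
      have K: "m' + b - of_int K *\<^sub>R v \<in> ?E" "\<And>K'. K < K' \<Longrightarrow> m' + b - of_int K' *\<^sub>R v \<notin> ?E"
      proof -
        show "m' + b - of_int K *\<^sub>R v \<in> ?E" unfolding mK inE using j(1) by (simp add: K_def)
        fix K' assume "K < K'"
        then have "K' - int l = int (nat (K' - int l))" "j < nat (K' - int l)" by (auto simp: K_def)
        then obtain j' where "K' - int l = int j'" "j < j'" by blast
        then show "m' + b - of_int K' *\<^sub>R v \<notin> ?E" unfolding mK inE using j(2) by simp
      qed
      have "next_gap (gap_set \<alpha> ?E) (frac (m' \<bullet> \<alpha>)) = b \<bullet> \<alpha> + kb - of_int K * (v \<bullet> \<alpha> + kv)"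
        using rows brow order_trans[OF _ big]
        by (intro next_gap_row_end[OF E Er rs(1,2,9,3,4) _ _ m' K, where Y = Y]) auto
      moreover have "frac (m' \<bullet> \<alpha>) \<in> gap_set \<alpha> ?E" using m' by (auto simp: gap_set_def int_vec_def)
      moreover have "\<bar>of_int K * h - len z\<bar> \<le> 2 * \<sigma>"
        using l(3) j(3) by (simp add: K_def len_def distrib_right)
      ultimately show "\<exists>K::int. b \<bullet> \<alpha> + kb - of_int K * (v \<bullet> \<alpha> + kv) \<in> next_gap (gap_set \<alpha> ?E) ` gap_set \<alpha> ?E \<and>
        \<bar>of_int K * h - len z\<bar> \<le> 2 * \<sigma>" by (metis imageI)
    qed
    from bchoice[OF this] obtain Kz where Kz: "\<And>z. z \<in> Z \<Longrightarrow>
      b \<bullet> \<alpha> + kb - of_int (Kz z) * (v \<bullet> \<alpha> + kv) \<in> next_gap (gap_set \<alpha> ?E) ` gap_set \<alpha> ?E"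
      "\<And>z. z \<in> Z \<Longrightarrow> \<bar>of_int (Kz z :: int) * h - len z\<bar> \<le> 2 * \<sigma>" by blast
    let ?g = "\<lambda>z. b \<bullet> \<alpha> + kb - of_int (Kz z) * (v \<bullet> \<alpha> + kv)"
    have "inj_on ?g Z"
    proof (rule inj_onI, rule ccontr)
      fix z z' assume zz: "z \<in> Z" "z' \<in> Z" "?g z = ?g z'" "z \<noteq> z'"
      then have eq: "Kz z = Kz z'" using rs(9) by simp
      have "\<bar>len z - len z'\<bar> \<le> 4 * \<sigma>"
        using Kz(2)[OF zz(1)] Kz(2)[OF zz(2)] unfolding eq by linarith
      then show False using \<gamma>(2)[OF zz(1,2,4)] \<sigma>(2) by linarith
    qed
    then have "card Z \<le> card (next_gap (gap_set \<alpha> ?E) ` gap_set \<alpha> ?E)"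
      using Kz(1) finite_gap_set[OF E(1)] by (intro card_inj_on_le[of ?g]) auto
    then show ?thesis using Zf by (simp add: num_gaps_def)
  qed
  then show thesis using that e \<eta>(1) by blast
qed

section \<open>Structured perturbations of lattices\<close>

definition add_subgroup :: "'a::real_vector set \<Rightarrow> bool" where
  "add_subgroup N \<longleftrightarrow> 0 \<in> N \<and> (\<forall>x\<in>N. \<forall>y\<in>N. x - y \<in> N)"

lemma add_subgroup_diff: "add_subgroup N \<Longrightarrow> x \<in> N \<Longrightarrow> y \<in> N \<Longrightarrow> x - y \<in> N"
  by (simp add: add_subgroup_def)

lemma add_subgroup_uminus: "add_subgroup N \<Longrightarrow> x \<in> N \<Longrightarrow> - x \<in> N"
  by (metis add_subgroup_def diff_0)

lemma add_subgroup_add: "add_subgroup N \<Longrightarrow> x \<in> N \<Longrightarrow> y \<in> N \<Longrightarrow> x + y \<in> N"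
  by (metis add_subgroup_diff add_subgroup_uminus diff_minus_eq_add)

lemma add_subgroup_scaleR_nat:
  assumes N: "add_subgroup N" and x: "x \<in> N"
  shows "real j *\<^sub>R x \<in> N"
proof (induction j)
  case 0
  show ?case using N by (simp add: add_subgroup_def)
next
  case (Suc j)
  then show ?case using add_subgroup_add[OF N x Suc] by (simp add: scaleR_left_distrib)
qed

lemma add_subgroup_scaleR_int:
  assumes N: "add_subgroup N" and x: "x \<in> N"
  shows "of_int l *\<^sub>R x \<in> N"
proof (cases "0 \<le> l")
  case True
  then show ?thesis using add_subgroup_scaleR_nat[OF N x, of "nat l"] by simp
next
  case False
  then show ?thesis
    using add_subgroup_uminus[OF N add_subgroup_scaleR_nat[OF N x, of "nat (- l)"]] by simp
qed

lemma add_subgroup_sum: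
  assumes "add_subgroup N" "\<And>i. i \<in> I \<Longrightarrow> g i \<in> N"
  shows "sum g I \<in> N"
proof (cases "finite I")
  case True
  then show ?thesis using assms(2)
    by (induction I) (use assms(1) in \<open>auto simp: add_subgroup_def intro: add_subgroup_add[OF assms(1)]\<close>)
qed (use assms(1) in \<open>simp add: add_subgroup_def\<close>)

text \<open>The common denominator makes the subgroup discrete, so its least positive element
  generates it by division with remainder. Both bounds on the generator depend on \<open>q\<close>
  alone.\<close>

lemma add_subgroup_real_cyclic:
  fixes S :: "real set"
  assumes S: "add_subgroup S" "1 \<in> S" and q: "0 < q" "\<And>x. x \<in> S \<Longrightarrow> real q * x \<in> \<int>"
  obtains t where "t \<in> S" "0 < t" "t \<le> 1" "1 / real q \<le> t" "\<And>x. x \<in> S \<Longrightarrow> \<exists>l::int. x = of_int l * t"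
proof -
  define P where "P j \<longleftrightarrow> 0 < j \<and> real j / real q \<in> S" for j :: nat
  have "P q" using S q by (simp add: P_def)
  define j where "j = (LEAST j. P j)"
  have j: "P j" unfolding j_def using \<open>P q\<close> by (rule LeastI)
  have least: "j \<le> i" if "P i" for i unfolding j_def using that by (rule Least_le)
  define t where "t = real j / real q"
  have t: "t \<in> S" "0 < t" using j q(1) by (auto simp: P_def t_def)
  have "j \<le> q" using least[OF \<open>P q\<close>] .
  have "\<exists>l::int. x = of_int l * t" if x: "x \<in> S" for x
  proof -
    obtain i where i: "real q * x = of_int i" using q(2)[OF x] by (auto elim: Ints_cases)
    define r where "r = i mod int j"
    have r: "0 \<le> r" "r < int j" using j by (auto simp: r_def P_def)
    have xi: "x = of_int i / real q" using i q(1) by (simp add: field_simps)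
    have "x - of_int (i div int j) * t = of_int r / real q"
    proof -
      have "i = (i div int j) * int j + r" by (simp add: r_def)
      then have "real_of_int i = of_int (i div int j) * real j + of_int r" by (metis of_int_add of_int_mult of_int_of_nat_eq)
      then show ?thesis by (simp add: xi t_def diff_divide_distrib[symmetric])
    qed
    moreover have "x - of_int (i div int j) * t \<in> S"
      using add_subgroup_diff[OF S(1) x add_subgroup_scaleR_int[OF S(1) t(1), of "i div int j"]] by simp
    ultimately have "real (nat r) / real q \<in> S" using r by simp
    then have "0 < r \<Longrightarrow> j \<le> nat r" using least[of "nat r"] by (simp add: P_def)
    then have "r = 0" using r by linarith
    then have "x = of_int (i div int j) * t"
      using \<open>x - of_int (i div int j) * t = of_int r / real q\<close> by simp
    then show ?thesis by blast
  qed
  moreover have "t \<le> 1" using \<open>j \<le> q\<close> q(1) by (simp add: t_def)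
  moreover have "1 / real q \<le> t" using j by (auto simp: t_def P_def intro!: divide_right_mono)
  ultimately show thesis using that t by blast
qed

text \<open>The point is that \<open>q\<close> depends on \<sigma> only, not on \<open>N\<close>. By
  pigeonhole two of the multiples of \<open>c\<close> up to a fixed bound almost agree modulo the
  integer lattice; separation makes the agreement exact. Thus \<open>c\<close> has bounded order
  modulo the integer lattice, and one factorial is a multiple of all possible orders.\<close>

lemma common_denominator:
  assumes \<sigma>: "0 < \<sigma>"
  obtains q :: nat where "0 < q"
    "\<And>(N :: 'a::euclidean_space set) c u. add_subgroup N \<Longrightarrow> Basis \<subseteq> N \<Longrightarrow>
       (\<And>x. x \<in> N \<Longrightarrow> norm x \<le> \<sigma> \<Longrightarrow> x = 0) \<Longrightarrow> c \<in> N \<Longrightarrow> u \<in> Basis \<Longrightarrow> real q * (c \<bullet> u) \<in> \<int>"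
proof -
  let ?d = "DIM('a)"
  obtain q :: nat where q: "real ?d / \<sigma> < real q" using reals_Archimedean2 by blast
  have q0: "0 < q" using q \<sigma> by (metis DIM_positive divide_pos_pos less_trans of_nat_0_less_iff)
  \<comment> \<open>The number of cubes of side 1/q in the unit cube, against \<open>m + 1\<close>
    multiples of \<open>c\<close>.\<close>
  define m where "m = q ^ ?d"
  have "real (fact m) * (c \<bullet> u) \<in> \<int>"
    if N: "add_subgroup N" "Basis \<subseteq> N" and sep: "\<And>x. x \<in> N \<Longrightarrow> norm x \<le> \<sigma> \<Longrightarrow> x = 0"
      and c: "c \<in> N" and u: "u \<in> Basis" for N :: "'a set" and c u
  proof -
    define h where "h j = (\<lambda>b\<in>Basis. nat \<lfloor>frac (real j * (c \<bullet> b)) * real q\<rfloor>)" for j :: nat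
    let ?R = "PiE (Basis :: 'a set) (\<lambda>_. {..<q})"
    have hR: "h j \<in> ?R" for j
    proof (intro PiE_I)
      fix b :: 'a assume "b \<in> Basis"
      have "frac (real j * (c \<bullet> b)) * real q < real q"
        using q0 frac_lt_1[of "real j * (c \<bullet> b)"] by simp
      then have "\<lfloor>frac (real j * (c \<bullet> b)) * real q\<rfloor> < int q" by (simp add: floor_less_iff)
      then show "h j b \<in> {..<q}" using \<open>b \<in> Basis\<close> q0 by (simp add: h_def nat_less_iff)
    qed (simp add: h_def)
    have "\<not> inj_on h {..m}"
    proof
      assume "inj_on h {..m}"
      then have "card {..m} \<le> card ?R" by (rule card_inj_on_le) (use hR in \<open>auto intro!: finite_PiE\<close>)
      then show False by (simp add: card_PiE m_def)
    qed
    then obtain i j where ij: "i < j" "j \<le> m" "h i = h j"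
      unfolding inj_on_def by (metis atMost_iff linorder_neqE_nat)
    define x where "x = real (j - i) *\<^sub>R c - (\<Sum>b\<in>Basis. of_int (\<lfloor>real j * (c \<bullet> b)\<rfloor> - \<lfloor>real i * (c \<bullet> b)\<rfloor>) *\<^sub>R b)"
    have xN: "x \<in> N" unfolding x_def using N c
      by (intro add_subgroup_diff[OF N(1)] add_subgroup_scaleR_nat add_subgroup_sum add_subgroup_scaleR_int) auto
    have xb: "x \<bullet> b = frac (real j * (c \<bullet> b)) - frac (real i * (c \<bullet> b))" if "b \<in> Basis" for b
      unfolding x_def inner_diff_left inner_sum_left_Basis[OF that] inner_scaleR_left
      using ij(1) by (simp add: frac_def of_nat_diff algebra_simps)
    have small: "\<bar>x \<bullet> b\<bar> \<le> 1 / real q" if b: "b \<in> Basis" for b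
    proof -
      have "h i b = h j b" using ij(3) by simp
      then have "\<lfloor>frac (real i * (c \<bullet> b)) * real q\<rfloor> = \<lfloor>frac (real j * (c \<bullet> b)) * real q\<rfloor>"
        using b by (simp add: h_def eq_nat_nat_iff)
      then have "\<bar>frac (real j * (c \<bullet> b)) * real q - frac (real i * (c \<bullet> b)) * real q\<bar> \<le> 1" by linarith
      then have "\<bar>x \<bullet> b\<bar> * real q \<le> 1" unfolding xb[OF b]
        using q0 by (simp add: left_diff_distrib[symmetric] abs_mult)
      then show ?thesis using q0 by (simp add: le_divide_eq)
    qed
    have "norm x \<le> (\<Sum>b\<in>Basis. \<bar>x \<bullet> b\<bar>)" by (rule norm_le_l1)
    also have "\<dots> \<le> real ?d * (1 / real q)"
      using sum_bounded_above[of Basis "\<lambda>b. \<bar>x \<bullet> b\<bar>" "1 / real q"] small by simp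
    also have "\<dots> \<le> \<sigma>" using q \<sigma> q0 by (simp add: field_simps)
    finally have "x = 0" using sep xN by blast
    then have "frac (real j * (c \<bullet> u)) = frac (real i * (c \<bullet> u))" using xb[OF u] by simp
    then have "real (j - i) * (c \<bullet> u) = of_int (\<lfloor>real j * (c \<bullet> u)\<rfloor> - \<lfloor>real i * (c \<bullet> u)\<rfloor>)"
      using ij(1) by (simp add: frac_def of_nat_diff algebra_simps)
    then have int: "real (j - i) * (c \<bullet> u) \<in> \<int>" by (metis Ints_of_int)
    have "j - i dvd fact m" using ij by (intro dvd_fact) auto
    then obtain k where "fact m = (j - i) * k" by (elim dvdE)
    then have "real (fact m) * (c \<bullet> u) = real k * (real (j - i) * (c \<bullet> u))"
      by (metis mult.assoc mult.commute of_nat_mult)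
    then show ?thesis using int by (metis Ints_mult Ints_of_nat)
  qed
  moreover have "(0::nat) < fact m" by simp
  ultimately show thesis using that by blast
qed

section \<open>Coordinates, a generic functional and a row direction\<close>

text \<open>Lattice points close to large multiples of the basis vectors are linearly independent by
  diagonal dominance.\<close>
lemma near_scaling_coordinates:
  fixes M :: "'a::euclidean_space set"
  assumes M: "add_subgroup M" and K: "0 \<le> K" "\<And>p. \<exists>q\<in>M. norm (q - p) \<le> K"
  defines "W \<equiv> real DIM('a) * K + 1"
  obtains G where "linear G" "\<And>u. u \<in> Basis \<Longrightarrow> G u \<in> M"
    "\<And>c. norm (G c - W *\<^sub>R c) \<le> (W - 1) * norm c"
    "\<And>c. norm c \<le> norm (G c)" "\<And>c. norm (G c) \<le> 2 * W * norm c" "surj G"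
proof -
  define g where "g b = (SOME q. q \<in> M \<and> norm (q - W *\<^sub>R b) \<le> K)" for b
  have g: "g b \<in> M \<and> norm (g b - W *\<^sub>R b) \<le> K" for b
    using K(2)[of "W *\<^sub>R b"] unfolding g_def Bex_def by (rule someI_ex)
  define G where "G c = (\<Sum>b\<in>Basis. (c \<bullet> b) *\<^sub>R g b)" for c
  have lin: "linear G"
    by (intro linearI) (simp_all add: G_def inner_add_left scaleR_add_left sum.distrib scaleR_sum_right)
  have W: "1 \<le> W" using K(1) by (simp add: W_def)
  \<comment> \<open>Each of the generators errs by at most \<open>K\<close>, so together they err by
    \<open>W - 1\<close> times the norm; the remaining 1 gives the lower bound for
    \<open>G\<close>.\<close>
  have near: "norm (G c - W *\<^sub>R c) \<le> (W - 1) * norm c" for c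
  proof -
    have "W *\<^sub>R c = (\<Sum>b\<in>Basis. (c \<bullet> b) *\<^sub>R (W *\<^sub>R b))"
    proof -
      have "(\<Sum>b\<in>Basis. (c \<bullet> b) *\<^sub>R (W *\<^sub>R b)) = W *\<^sub>R (\<Sum>b\<in>Basis. (c \<bullet> b) *\<^sub>R b)"
        by (simp add: scaleR_sum_right mult.commute)
      then show ?thesis by (simp add: euclidean_representation)
    qed
    then have "G c - W *\<^sub>R c = (\<Sum>b\<in>Basis. (c \<bullet> b) *\<^sub>R (g b - W *\<^sub>R b))"
      by (simp add: G_def sum_subtractf scaleR_diff_right)
    also have "norm \<dots> \<le> (\<Sum>b\<in>(Basis::'a set). norm c * K)"
    proof (rule sum_norm_le)
      fix b :: 'a assume "b \<in> Basis"
      then show "norm ((c \<bullet> b) *\<^sub>R (g b - W *\<^sub>R b)) \<le> norm c * K"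
        using g[of b] Basis_le_norm[of b c] by (simp add: mult_mono)
    qed
    finally show ?thesis by (simp add: W_def mult.commute mult.left_commute)
  qed
  have lower: "norm c \<le> norm (G c)" for c
  proof -
    have "norm (W *\<^sub>R c) \<le> norm (G c) + norm (G c - W *\<^sub>R c)"
      using norm_triangle_sub[of "W *\<^sub>R c" "G c"] by (simp add: norm_minus_commute)
    then show ?thesis using near[of c] W by (simp add: algebra_simps)
  qed
  have upper: "norm (G c) \<le> 2 * W * norm c" for c
  proof -
    have "norm (G c) \<le> norm (W *\<^sub>R c) + norm (G c - W *\<^sub>R c)"
      using norm_triangle_sub[of "G c" "W *\<^sub>R c"] by simp
    also have "\<dots> \<le> W * norm c + (W - 1) * norm c" using near[of c] W by simp
    also have "\<dots> \<le> 2 * W * norm c" by (simp add: algebra_simps)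
    finally show ?thesis .
  qed
  have "inj G"
    using lower lin by (simp add: linear_injective_0) (metis norm_le_zero_iff norm_zero)
  then have "surj G" using lin by (simp add: linear_injective_imp_surjective)
  moreover have "G u \<in> M" if "u \<in> Basis" for u
  proof -
    have "G u = (\<Sum>b\<in>Basis. if b = u then g u else 0)"
      unfolding G_def using that by (intro sum.cong) (auto simp: inner_Basis)
    then show ?thesis using that g[of u] by simp
  qed
  ultimately show thesis using that[OF lin _ near lower upper] by blast
qed

text \<open>Add to the coordinate \<open>i0\<close> a large multiple \<Lambda> of a vector
  \<open>E\<close> that is orthogonal to axis \<open>i0\<close>, close to axis \<open>i1\<close> and
  non-zero on all relevant projections. A large \<Lambda> pushes the values on \<open>Z\<close> off
  the axis beyond 3. Since \<open>norm F\<close> and the value at \<omega> both grow like \<Lambda>,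
  their ratio stays below 12/a whatever \<open>Z\<close> is.\<close>

lemma generic_functional:
  fixes Z :: "(real ^ 'n) set"
  assumes Z: "finite Z" and i: "i0 \<noteq> i1" and a: "0 < a" and A: "0 < A"
  obtains F where "F $ i0 = 1"
    "\<And>w. w \<in> Z \<Longrightarrow> w \<noteq> w $ i0 *\<^sub>R axis i0 1 \<Longrightarrow> 3 \<le> \<bar>F \<bullet> w\<bar>"
    "\<And>\<omega>. a \<le> \<bar>\<omega> $ i1\<bar> \<Longrightarrow> norm \<omega> \<le> A \<Longrightarrow> 1 \<le> \<bar>F \<bullet> \<omega>\<bar> \<and> norm F \<le> 12 / a * \<bar>F \<bullet> \<omega>\<bar>"
proof -
  define pr where "pr x = x - x $ i0 *\<^sub>R axis i0 1" for x :: "real ^ 'n"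
  define Z' where "Z' = pr ` Z - {0}"
  \<comment> \<open>Keeps \<open>E\<close> so close to axis \<open>i1\<close> that its value at
    \<omega> is still at least a/2.\<close>
  define r where "r = min 1 (a / (2 * A))"
  have r: "0 < r" "r \<le> 1" "r * A \<le> a / 2"
  proof -
    show "0 < r" "r \<le> 1" using a A by (auto simp: r_def)
    have "r \<le> a / (2 * A)" by (simp add: r_def)
    then show "r * A \<le> a / 2" using A by (simp add: field_simps)
  qed
  have "negligible (\<Union>z\<in>Z'. {x. z \<bullet> x = 0})"
    using Z by (intro negligible_Union) (auto simp: Z'_def intro!: negligible_hyperplane)
  moreover have "\<not> negligible (ball (axis i1 1 :: real ^ 'n) r)"
    using open_not_negligible[of "ball (axis i1 1 :: real ^ 'n) r"] r by simp
  ultimately have "\<not> ball (axis i1 1) r \<subseteq> (\<Union>z\<in>Z'. {x. z \<bullet> x = 0})"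
    using negligible_subset by blast
  then obtain F' where F': "F' \<in> ball (axis i1 1) r" "\<And>z. z \<in> Z' \<Longrightarrow> z \<bullet> F' \<noteq> 0" by blast
  define E where "E = pr F'"
  have prpr: "pr x \<bullet> y = x \<bullet> pr y" for x y by (simp add: pr_def inner_diff_left inner_diff_right inner_axis inner_axis')
  have Ez: "E \<bullet> w = F' \<bullet> pr w" for w by (simp add: E_def prpr)
  have Ei: "E $ i0 = 0" by (simp add: E_def pr_def)
  have norm_pr: "norm (pr x) \<le> norm x" for x
    by (intro norm_le_componentwise_cart) (auto simp: pr_def axis_def)
  have "pr (F' - axis i1 1) = E - axis i1 1" using i by (simp add: E_def pr_def axis_def algebra_simps)
  then have En: "norm (E - axis i1 1) \<le> r"
    using norm_pr[of "F' - axis i1 1"] F'(1) by (simp add: dist_norm norm_minus_commute)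
  have E2: "norm E \<le> 2"
    using norm_triangle_sub[of E "axis i1 1"] En r by simp
  have E\<omega>: "a / 2 \<le> \<bar>E \<bullet> \<omega>\<bar>" if "a \<le> \<bar>\<omega> $ i1\<bar>" "norm \<omega> \<le> A" for \<omega>
  proof -
    have "\<omega> $ i1 = E \<bullet> \<omega> - (E - axis i1 1) \<bullet> \<omega>" by (simp add: inner_diff_left inner_axis')
    moreover have "\<bar>(E - axis i1 1) \<bullet> \<omega>\<bar> \<le> r * A"
      using Cauchy_Schwarz_ineq2[of "E - axis i1 1" \<omega>] mult_mono[OF En that(2)] r by simp
    ultimately show ?thesis using that(1) r(3) by linarith
  qed
  define \<mu> where "\<mu> = Min (insert 1 ((\<lambda>z. \<bar>E \<bullet> z\<bar>) ` Z'))"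
  have fin: "finite (insert 1 ((\<lambda>z. \<bar>E \<bullet> z\<bar>) ` Z'))" using Z by (simp add: Z'_def)
  have prid: "pr z = z" if "z \<in> Z'" for z using that by (auto simp: Z'_def pr_def)
  have \<mu>: "0 < \<mu>" "\<And>z. z \<in> Z' \<Longrightarrow> \<mu> \<le> \<bar>E \<bullet> z\<bar>"
  proof -
    have "0 < \<bar>E \<bullet> z\<bar>" if "z \<in> Z'" for z using F'(2)[OF that] prid[OF that] by (simp add: Ez inner_commute)
    then show "0 < \<mu>" unfolding \<mu>_def using fin by (subst Min_gr_iff) auto
    show "\<mu> \<le> \<bar>E \<bullet> z\<bar>" if "z \<in> Z'" for z unfolding \<mu>_def using fin that by (intro Min_le) auto
  qed
  obtain B where B: "\<And>w. w \<in> Z \<Longrightarrow> \<bar>w $ i0\<bar> \<le> B" "0 \<le> B"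
  proof -
    have "finite ((\<lambda>w. \<bar>w $ i0\<bar>) ` Z)" using Z by simp
    then have "\<bar>w $ i0\<bar> \<le> Max (insert 0 ((\<lambda>w. \<bar>w $ i0\<bar>) ` Z))" if "w \<in> Z" for w
      using that by (intro Max_ge) auto
    then show thesis using that[of "Max (insert 0 ((\<lambda>w. \<bar>w $ i0\<bar>) ` Z))"] Z by (auto intro!: Max_ge)
  qed
  \<comment> \<open>The second entry beats the \<open>i0\<close> coordinate of vectors in
    \<open>Z\<close>; the third leaves a quarter of \<Lambda> a, plus one, at \<omega>.\<close>
  define \<Lambda> where "\<Lambda> = max 1 (max ((B + 3) / \<mu>) (4 * (A + 1) / a))"
  have \<Lambda>: "1 \<le> \<Lambda>" "B + 3 \<le> \<Lambda> * \<mu>" "4 * (A + 1) \<le> \<Lambda> * a"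
  proof -
    show "1 \<le> \<Lambda>" by (simp add: \<Lambda>_def)
    have "(B + 3) / \<mu> \<le> \<Lambda>" "4 * (A + 1) / a \<le> \<Lambda>" by (auto simp: \<Lambda>_def)
    then show "B + 3 \<le> \<Lambda> * \<mu>" "4 * (A + 1) \<le> \<Lambda> * a" using \<mu>(1) a by (auto simp: divide_le_eq)
  qed
  define F where "F = axis i0 1 + \<Lambda> *\<^sub>R E"
  have Fw: "F \<bullet> w = w $ i0 + \<Lambda> * (E \<bullet> w)" for w by (simp add: F_def inner_add_left inner_axis')
  show thesis
  proof (rule that)
    show "F $ i0 = 1" using Ei by (simp add: F_def)
    show "3 \<le> \<bar>F \<bullet> w\<bar>" if w: "w \<in> Z" "w \<noteq> w $ i0 *\<^sub>R axis i0 1" for w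
    proof -
      have "pr w \<in> Z'" using w by (auto simp: Z'_def pr_def)
      moreover have "pr (pr w) = pr w" using prid calculation by blast
      ultimately have "\<mu> \<le> \<bar>E \<bullet> w\<bar>" using \<mu>(2)[of "pr w"] by (simp add: Ez)
      then have "\<Lambda> * \<mu> \<le> \<bar>\<Lambda> * (E \<bullet> w)\<bar>" using \<Lambda>(1) by (simp add: abs_mult)
      then show ?thesis using \<Lambda>(2) B(1)[OF w(1)] unfolding Fw by linarith
    qed
    show "1 \<le> \<bar>F \<bullet> \<omega>\<bar> \<and> norm F \<le> 12 / a * \<bar>F \<bullet> \<omega>\<bar>" if \<omega>: "a \<le> \<bar>\<omega> $ i1\<bar>" "norm \<omega> \<le> A" for \<omega>
    proof -
      have "\<Lambda> * (a / 2) \<le> \<bar>\<Lambda> * (E \<bullet> \<omega>)\<bar>" using E\<omega>[OF \<omega>] \<Lambda>(1) by (simp add: abs_mult)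
      moreover have "\<bar>\<omega> $ i0\<bar> \<le> A" using component_le_norm_cart[of \<omega> i0] \<omega>(2) by linarith
      ultimately have "\<Lambda> * (a / 2) - A \<le> \<bar>F \<bullet> \<omega>\<bar>" unfolding Fw by linarith
      then have big: "\<Lambda> * a / 4 + 1 \<le> \<bar>F \<bullet> \<omega>\<bar>" using \<Lambda>(3) by simp
      have "norm F \<le> 1 + \<Lambda> * norm E"
        using norm_triangle_ineq[of "axis i0 1 :: real ^ 'n" "\<Lambda> *\<^sub>R E"] \<Lambda>(1) by (simp add: F_def)
      also have "\<dots> \<le> 3 * \<Lambda>" using mult_left_mono[OF E2, of \<Lambda>] \<Lambda>(1) by linarith
      also have "\<dots> = 12 / a * (\<Lambda> * a / 4)" using a by simp
      also have "\<dots> \<le> 12 / a * \<bar>F \<bullet> \<omega>\<bar>" using big a by (intro mult_left_mono) auto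
      finally have "norm F \<le> 12 / a * \<bar>F \<bullet> \<omega>\<bar>" .
      moreover have "0 \<le> \<Lambda> * a / 4" using a \<Lambda>(1) by simp
      ultimately show ?thesis using big by linarith
    qed
  qed
qed

text \<open>Supplies a lattice vector that is primitive in the coordinates, as its last entry is 1,
  and whose image points nearly along \<open>- e\<close>. The last conclusion keeps \<eta>, the
  preimage of the vertical vector, away from the kernel of the projection along (n, 1), so that a
  functional vanishing on the row can be normalised to 1 on the vertical vector.\<close>

lemma choose_long_direction:
  fixes G :: "(real ^ 'n) \<times> real \<Rightarrow> (real ^ 'n) \<times> real" and e :: "real ^ 'n"
  assumes lin: "linear G" and W: "1 \<le> W"
    and near: "\<And>c. norm (G c - W *\<^sub>R c) \<le> (W - 1) * norm c"
    and upper: "\<And>c. norm (G c) \<le> 2 * W * norm c"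
    and e: "norm e = 1" and \<rho>: "0 < \<rho>" and \<eta>: "G \<eta> = (0, 1)"
  obtains n where "int_vec n" "norm (fst (G (n, 1)) + \<rho> *\<^sub>R e) \<le> 2 * W * (real CARD('n) + 1)"
    "norm n \<le> \<rho> + real CARD('n)" "1 / (4 * W\<^sup>2) \<le> \<bar>(fst \<eta> - snd \<eta> *\<^sub>R n) $ i1\<bar>"
proof -
  define A where "A x = fst (G (x, 0))" for x
  have linA: "linear A"
  proof (rule linearI)
    show "A (x + y) = A x + A y" for x y
      using linear_add[OF lin, of "(x, 0)" "(y, 0)"] by (simp add: A_def)
    show "A (r *\<^sub>R x) = r *\<^sub>R A x" for r x
      using linear_scale[OF lin, of r "(x, 0)"] by (simp add: A_def)
  qed
  have normfst: "norm (fst p) \<le> norm p" for p :: "(real ^ 'n) \<times> real" by (metis norm_fst_le prod.collapse)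
  have lowA: "norm x \<le> norm (A x)" for x
  proof -
    have "norm (A x - W *\<^sub>R x) \<le> (W - 1) * norm x"
      using near[of "(x, 0)"] normfst[of "G (x, 0) - W *\<^sub>R (x, 0)"] by (simp add: A_def)
    moreover have "norm (W *\<^sub>R x) \<le> norm (A x) + norm (A x - W *\<^sub>R x)"
      using norm_triangle_sub[of "W *\<^sub>R x" "A x"] by (simp add: norm_minus_commute)
    ultimately show ?thesis using W by (simp add: algebra_simps)
  qed
  have upA: "norm (A x) \<le> 2 * W * norm x" for x
    using upper[of "(x, 0)"] normfst[of "G (x, 0)"] by (simp add: A_def)
  have "inj A" using lowA linA by (simp add: linear_injective_0) (metis norm_le_zero_iff norm_zero)
  then have "surj A" using linA by (simp add: linear_injective_imp_surjective)
  then obtain x where x: "A x = - \<rho> *\<^sub>R e" by (metis surjD)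
  have nx: "norm x \<le> \<rho>" using lowA[of x] e \<rho> by (simp add: x)
  have f01: "norm (fst (G (0, 1))) \<le> W"
    using near[of "(0, 1)"] normfst[of "G (0, 1) - W *\<^sub>R (0, 1)"] by simp
  have split: "(fst \<eta>, 0) + snd \<eta> *\<^sub>R (0, 1) = \<eta>" by (simp add: prod_eq_iff)
  have "G \<eta> = G (fst \<eta>, 0) + snd \<eta> *\<^sub>R G (0, 1)"
    unfolding linear_scale[OF lin, symmetric] linear_add[OF lin, symmetric] split ..
  then have A\<eta>: "A (fst \<eta>) = - snd \<eta> *\<^sub>R fst (G (0, 1))"
    using \<eta> by (simp add: A_def prod_eq_iff eq_neg_iff_add_eq_0)
  have \<eta>1: "norm (fst \<eta>) \<le> \<bar>snd \<eta>\<bar> * (W - 1)"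
  proof -
    have "norm (fst (G (0, 1))) \<le> W - 1"
      using near[of "(0, 1)"] normfst[of "G (0, 1) - W *\<^sub>R (0, 1)"] by simp
    then show ?thesis using lowA[of "fst \<eta>"] A\<eta> mult_left_mono[of "norm (fst (G (0, 1)))" "W - 1" "\<bar>snd \<eta>\<bar>"] by simp
  qed
  have "1 \<le> 2 * W * norm \<eta>" using upper[of \<eta>] by (simp add: \<eta>)
  also have "norm \<eta> \<le> norm (fst \<eta>) + \<bar>snd \<eta>\<bar>"
    by (metis norm_Pair_le prod.collapse real_norm_def)
  also have "\<dots> \<le> \<bar>snd \<eta>\<bar> * W" using \<eta>1 by (simp add: algebra_simps)
  finally have "1 \<le> 2 * W * (\<bar>snd \<eta>\<bar> * W)" using W by simp
  then have \<eta>2: "1 / (2 * W\<^sup>2) \<le> \<bar>snd \<eta>\<bar>" using W by (simp add: field_simps power2_eq_square)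
  define n0 :: "real ^ 'n" where "n0 = (\<chi> i. of_int \<lfloor>x $ i\<rfloor>)"
  \<comment> \<open>Passing from \<open>n0\<close> to the second candidate changes the
    \<open>i1\<close> component by \<open>snd \<eta>\<close>, which is at least 1/(2 W^2) in size;
    so one of the two components is at least half of that.\<close>
  define n where "n = (if 1 / (4 * W\<^sup>2) \<le> \<bar>(fst \<eta> - snd \<eta> *\<^sub>R n0) $ i1\<bar> then n0 else n0 + axis i1 1)"
  have "int_vec n" by (auto simp: n_def n0_def int_vec_def axis_def)
  have ni: "\<bar>(n - x) $ i\<bar> \<le> 1" for i
  proof -
    have "- 1 \<le> n0 $ i - x $ i" "n0 $ i - x $ i \<le> 0" unfolding n0_def by simp_all linarith+
    then show ?thesis by (auto simp: n_def axis_def abs_le_iff)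
  qed
  then have nd: "norm (n - x) \<le> real CARD('n)" using norm_le_card_components[of "n - x" 1] by simp
  show thesis
  proof (rule that)
    show "int_vec n" by fact
    show "norm n \<le> \<rho> + real CARD('n)" using norm_triangle_sub[of n x] nx nd by linarith
    show "1 / (4 * W\<^sup>2) \<le> \<bar>(fst \<eta> - snd \<eta> *\<^sub>R n) $ i1\<bar>"
    proof (cases "1 / (4 * W\<^sup>2) \<le> \<bar>(fst \<eta> - snd \<eta> *\<^sub>R n0) $ i1\<bar>")
      case False
      then have "(fst \<eta> - snd \<eta> *\<^sub>R n) $ i1 = (fst \<eta> - snd \<eta> *\<^sub>R n0) $ i1 - snd \<eta>"
        by (simp add: n_def algebra_simps)
      moreover have "1 / (2 * W\<^sup>2) = 2 * (1 / (4 * W\<^sup>2))" by simp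
      ultimately show ?thesis using False \<eta>2 by linarith
    qed (simp add: n_def)
    have "G (n, 1) = G (n - x, 0) + G (x, 0) + G (0, 1)"
      by (simp flip: linear_add[OF lin])
    then have "fst (G (n, 1)) = A (n - x) + A x + fst (G (0, 1))" by (simp add: A_def)
    then have "fst (G (n, 1)) + \<rho> *\<^sub>R e = A (n - x) + fst (G (0, 1))" by (simp add: x)
    then have "norm (fst (G (n, 1)) + \<rho> *\<^sub>R e) \<le> norm (A (n - x)) + norm (fst (G (0, 1)))"
      by (metis norm_triangle_ineq)
    also have "\<dots> \<le> 2 * W * real CARD('n) + W"
      using upA[of "n - x"] mult_left_mono[OF nd, of "2 * W"] f01 W by linarith
    also have "\<dots> \<le> 2 * W * (real CARD('n) + 1)" using W by (simp add: algebra_simps)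
    finally show "norm (fst (G (n, 1)) + \<rho> *\<^sub>R e) \<le> 2 * W * (real CARD('n) + 1)" .
  qed
qed

text \<open>The structure of \<^const>\<open>row_structured\<close>, for a lattice in rescaled coordinates that is sheared by
  \<open>(x, y) \<mapsto> (x, y + \<psi> \<bullet> x)\<close>.\<close>
definition lattice_rows :: "((real ^ 'n) \<times> real) set \<Rightarrow> real ^ 'n \<Rightarrow> real \<Rightarrow> real \<Rightarrow> real \<Rightarrow> real \<Rightarrow> real ^ 'n \<Rightarrow> bool" where
  "lattice_rows M e \<epsilon> \<delta> \<Delta> s \<psi> \<longleftrightarrow> (\<exists>v\<in>M. \<exists>b\<in>M. \<exists>Y w. 0 < w \<and> w \<le> \<epsilon> * s \<and>
     norm (fst v + w *\<^sub>R e) \<le> \<delta> * w \<and> norm (fst b) \<le> 3 * w \<and> 0 < snd v + \<psi> \<bullet> fst v \<and>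
     (\<forall>p\<in>M. norm (fst p) \<le> \<Delta> * s \<and> 0 < snd p + \<psi> \<bullet> fst p \<and> snd p + \<psi> \<bullet> fst p < Y \<longrightarrow>
        (\<exists>l::int. p = of_int l *\<^sub>R v) \<or> (\<exists>l::int. p = b + of_int l *\<^sub>R v)) \<and>
     (\<forall>l::int. norm (fst (b + of_int l *\<^sub>R v)) \<le> \<Delta> * s \<longrightarrow>
        0 < snd (b + of_int l *\<^sub>R v) + \<psi> \<bullet> fst (b + of_int l *\<^sub>R v) \<and>
        snd (b + of_int l *\<^sub>R v) + \<psi> \<bullet> fst (b + of_int l *\<^sub>R v) < Y))"

lemma norm_fst_le_norm: "norm (fst p) \<le> norm p"
  by (metis norm_fst_le prod.collapse)

lemma norm_snd_le_norm: "\<bar>snd p\<bar> \<le> norm (p :: 'a::real_normed_vector \<times> real)"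
  by (metis norm_snd_le prod.collapse real_norm_def)

lemma norm_le_fst_snd: "norm (p :: 'a::real_normed_vector \<times> real) \<le> norm (fst p) + \<bar>snd p\<bar>"
  by (metis norm_Pair_le prod.collapse real_norm_def)

text \<open>The rows span a rank two sublattice.  The vector \<^term>\<open>\<phi>\<close> makes the second coordinate
  proportional to a functional that vanishes on the row direction, is small on the second generator
  and, being generic, large on all other lattice vectors of bounded size.\<close>
lemma structured_perturbation:
  fixes e :: "real ^ 'n"
  assumes card: "CARD('n) \<ge> 2" and e: "norm e = 1" and pos: "0 < \<epsilon>" "0 < \<delta>" "\<delta> \<le> 1 / 4" "0 < \<Delta>"
    and c: "0 < c" and K: "0 \<le> K"
  obtains s C \<kappa> where "0 < s" "0 < C" "0 < \<kappa>"
    "\<And>M. add_subgroup M \<Longrightarrow> (\<And>p. p \<in> M \<Longrightarrow> norm p \<le> c \<Longrightarrow> p = 0) \<Longrightarrow>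
       (\<And>p. \<exists>q\<in>M. norm (q - p) \<le> K) \<Longrightarrow>
       \<exists>\<phi>. norm \<phi> \<le> C \<and> (\<forall>\<psi>\<in>ball \<phi> \<kappa>. lattice_rows M e \<epsilon> \<delta> \<Delta> s \<psi>)"
proof -
  obtain i0 i1 :: 'n where i: "i0 \<noteq> i1"
    using card_le_Suc0_iff_eq[of "UNIV :: 'n set"] card by auto
  define W where "W = real DIM((real ^ 'n) \<times> real) * K + 1"
  have W: "1 \<le> W" using K by (simp add: W_def)
  define \<sigma> where "\<sigma> = c / (2 * W)"
  have \<sigma>: "0 < \<sigma>" using c W by (simp add: \<sigma>_def)
  obtain q where q: "0 < q" and qden: "\<And>(N :: ((real ^ 'n) \<times> real) set) c u. add_subgroup N \<Longrightarrow> Basis \<subseteq> N \<Longrightarrow>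
       (\<And>x. x \<in> N \<Longrightarrow> norm x \<le> \<sigma> \<Longrightarrow> x = 0) \<Longrightarrow> c \<in> N \<Longrightarrow> u \<in> Basis \<Longrightarrow> real q * (c \<bullet> u) \<in> \<int>"
    using common_denominator[OF \<sigma>] by blast
  define C1 where "C1 = 2 * W * (real CARD('n) + 1)"
  have C1: "0 < C1" using W by (simp add: C1_def)
  define \<rho> where "\<rho> = C1 / \<delta> + 2 * real q * W"
  have \<rho>: "0 < \<rho>" "C1 \<le> \<delta> * \<rho>" "2 * W * real q \<le> \<rho>"
  proof -
    show "0 < \<rho>" using C1 pos W q by (simp add: \<rho>_def add_pos_pos)
    show "C1 \<le> \<delta> * \<rho>" using pos W by (simp add: \<rho>_def distrib_left)
    show "2 * W * real q \<le> \<rho>" using C1 pos by (simp add: \<rho>_def)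
  qed
  define s where "s = \<rho> / \<epsilon>"
  have s: "0 < s" "\<epsilon> * s = \<rho>" using \<rho> pos by (auto simp: s_def)
  define nb where "nb = \<rho> + real CARD('n)"
  have nb: "0 < nb" using \<rho> by (simp add: nb_def)
  define A where "A = 1 + nb"
  have A: "0 < A" using nb by (simp add: A_def)
  define a where "a = 1 / (4 * W\<^sup>2)"
  have a: "0 < a" using W by (simp add: a_def)
  define C\<phi> where "C\<phi> = 12 / a * A"
  have C\<phi>: "0 < C\<phi>" using a A by (simp add: C\<phi>_def)
  \<comment> \<open>Bounds the projection of every lattice vector that can compete in the range
    \<open>\<Delta> * s\<close>. It uses \<open>C\<phi>\<close>, the bound on the shear, which is
    available before \<open>F\<close> is chosen.\<close>
  define B where "B = (\<Delta> * s + (2 + (C\<phi> + 1) * (\<Delta> * s))) * A"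
  define Z where "Z = {w :: real ^ 'n. norm w \<le> B \<and> int_vec (real q *\<^sub>R w)}"
  have "finite Z"
  proof -
    have "finite {n \<in> cball 0 (real q * B). int_vec (n :: real ^ 'n)}" by (rule finite_int_vec_bounded) simp
    moreover have "(\<lambda>w. real q *\<^sub>R w) ` Z \<subseteq> {n \<in> cball 0 (real q * B). int_vec n}"
      by (auto simp: Z_def intro!: mult_left_mono)
    moreover have "inj_on (\<lambda>w. real q *\<^sub>R w) Z" using q by (auto simp: inj_on_def)
    ultimately show ?thesis using inj_on_finite by blast
  qed
  then obtain F where F: "F $ i0 = 1"
    "\<And>w. w \<in> Z \<Longrightarrow> w \<noteq> w $ i0 *\<^sub>R axis i0 1 \<Longrightarrow> 3 \<le> \<bar>F \<bullet> w\<bar>"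
    "\<And>\<omega>. a \<le> \<bar>\<omega> $ i1\<bar> \<Longrightarrow> norm \<omega> \<le> A \<Longrightarrow> 1 \<le> \<bar>F \<bullet> \<omega>\<bar> \<and> norm F \<le> 12 / a * \<bar>F \<bullet> \<omega>\<bar>"
    using generic_functional[OF _ i a A] by metis
  have F0: "0 < norm F" using F(1) by auto
  \<comment> \<open>A lower bound for the later normalising factor \<open>h\<close> that does not
    depend on the lattice; this makes \<kappa>1 uniform.\<close>
  define h0 where "h0 = 1 / (norm F * A)"
  have h0: "0 < h0" using F0 A by (simp add: h0_def)
  define \<kappa>1 where "\<kappa>1 = min 1 (h0 / (8 * real q * (\<Delta> * s)))"
  have \<kappa>1: "0 < \<kappa>1" "\<kappa>1 \<le> 1" "\<kappa>1 * (\<Delta> * s) \<le> h0 * (1 / real q) / 8"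
  proof -
    show "0 < \<kappa>1" "\<kappa>1 \<le> 1" using h0 q pos s by (auto simp: \<kappa>1_def)
    have "\<kappa>1 \<le> h0 / (8 * real q * (\<Delta> * s))" by (simp add: \<kappa>1_def)
    then show "\<kappa>1 * (\<Delta> * s) \<le> h0 * (1 / real q) / 8" using q pos s by (simp add: field_simps)
  qed
  have "\<exists>\<phi>. norm \<phi> \<le> C\<phi> + 1 \<and> (\<forall>\<psi>\<in>ball \<phi> (\<kappa>1 / 8). lattice_rows M e \<epsilon> \<delta> \<Delta> s \<psi>)"
    if M: "add_subgroup M" and sep: "\<And>p. p \<in> M \<Longrightarrow> norm p \<le> c \<Longrightarrow> p = 0" and cov: "\<And>p. \<exists>q\<in>M. norm (q - p) \<le> K" for M
  proof -
    obtain G where G: "linear G" "\<And>u. u \<in> Basis \<Longrightarrow> G u \<in> M"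
      "\<And>c. norm (G c - W *\<^sub>R c) \<le> (W - 1) * norm c"
      "\<And>c. norm c \<le> norm (G c)" "\<And>c. norm (G c) \<le> 2 * W * norm c" "surj G"
      using near_scaling_coordinates[OF M K cov] unfolding W_def by blast
    note Gadd = linear_add[OF G(1)] and Gscale = linear_scale[OF G(1)]
    obtain H where H: "linear H" "\<And>p. G (H p) = p"
      using linear_surjective_right_inverse[OF G(1,6)] by (metis comp_apply id_apply)
    have HG: "H (G c) = c" for c
    proof -
      have "norm (H (G c) - c) \<le> norm (G (H (G c) - c))" by (rule G(4))
      also have "\<dots> = 0" by (simp add: linear_diff[OF G(1)] H(2))
      finally show ?thesis by simp
    qed
    have Hnorm: "norm (H p) \<le> norm p" for p using G(4)[of "H p"] by (simp add: H(2))
    \<comment> \<open>The lattice in the coordinates of \<open>G\<close>: it contains the integer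
      lattice and has denominator \<open>q\<close>.\<close>
    define N where "N = {c. G c \<in> M}"
    have N: "add_subgroup N"
      using M unfolding add_subgroup_def N_def by (auto simp: linear_diff[OF G(1)] linear_0[OF G(1)])
    have BN: "Basis \<subseteq> N" using G(2) by (auto simp: N_def)
    have sepN: "x = 0" if "x \<in> N" "norm x \<le> \<sigma>" for x
    proof -
      have "norm (G x) \<le> 2 * W * norm x" by (rule G(5))
      also have "\<dots> \<le> 2 * W * \<sigma>" using that W by (intro mult_left_mono) auto
      also have "\<dots> = c" using W by (simp add: \<sigma>_def)
      finally have "G x = 0" using sep that by (simp add: N_def)
      then show ?thesis using G(4)[of x] by simp
    qed
    have den: "int_vec (real q *\<^sub>R fst x)" "real q * snd x \<in> \<int>" if "x \<in> N" for x
    proof -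
      have "real q * (x \<bullet> (axis i 1, 0)) \<in> \<int>" for i
        by (rule qden[OF N BN sepN that]) (auto simp: Basis_prod_def axis_in_Basis_iff)
      then show "int_vec (real q *\<^sub>R fst x)" by (simp add: int_vec_def inner_prod_def inner_axis)
      have "real q * (x \<bullet> (0, 1)) \<in> \<int>"
        by (rule qden[OF N BN sepN that]) (auto simp: Basis_prod_def)
      then show "real q * snd x \<in> \<int>" by (simp add: inner_prod_def)
    qed
    have intN: "(x, k) \<in> N" if xk: "int_vec x" "k \<in> \<int>" for x k
    proof -
      have xeq: "(x, k) = (\<Sum>i\<in>UNIV. (x $ i) *\<^sub>R (axis i 1, 0)) + k *\<^sub>R (0, 1)"
        using basis_expansion[of x] by (simp add: prod_eq_iff fst_sum snd_sum scalar_mult_eq_scaleR)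
      have in1: "(x $ i) *\<^sub>R (axis i 1, 0) \<in> N" for i
      proof -
        obtain l where "x $ i = of_int l" using xk(1) unfolding int_vec_def by (meson Ints_cases)
        moreover have "(axis i 1, 0) \<in> N" using BN by (auto simp: Basis_prod_def axis_in_Basis_iff)
        ultimately show ?thesis using add_subgroup_scaleR_int[OF N, of "(axis i 1, 0)" l] by simp
      qed
      have in2: "k *\<^sub>R (0, 1) \<in> N"
      proof -
        obtain l where "k = of_int l" using xk(2) by (meson Ints_cases)
        moreover have "(0, 1) \<in> N" using BN by (auto simp: Basis_prod_def)
        ultimately show ?thesis using add_subgroup_scaleR_int[OF N, of "(0, 1)" l] by simp
      qed
      show ?thesis unfolding xeq
        by (intro add_subgroup_add[OF N] add_subgroup_sum[OF N] in1 in2)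
    qed
    define \<eta> where "\<eta> = H (0, 1)"
    have G\<eta>: "G \<eta> = (0, 1)" by (simp add: \<eta>_def H(2))
    have \<eta>1: "norm \<eta> \<le> 1" using Hnorm[of "(0, 1)"] by (simp add: \<eta>_def)
    obtain n where n': "int_vec n" "norm (fst (G (n, 1)) + \<rho> *\<^sub>R e) \<le> 2 * W * (real CARD('n) + 1)"
      "norm n \<le> \<rho> + real CARD('n)" "1 / (4 * W\<^sup>2) \<le> \<bar>(fst \<eta> - snd \<eta> *\<^sub>R n) $ i1\<bar>"
      by (rule choose_long_direction[OF G(1) W G(3,5) e \<rho>(1) G\<eta>])
    note n = n'[folded C1_def nb_def a_def]
    \<comment> \<open>The quotient by the line through (n, 1), which will be the row
      direction.\<close>
    define P where "P x = fst x - snd x *\<^sub>R n" for x :: "(real ^ 'n) \<times> real"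
    have Pn: "norm (P x) \<le> norm x * A" for x
    proof -
      have "norm (P x) \<le> norm (fst x) + \<bar>snd x\<bar> * norm n"
        using norm_triangle_ineq4[of "fst x" "snd x *\<^sub>R n"] by (simp add: P_def)
      also have "\<dots> \<le> norm x + norm x * nb"
        using norm_fst_le_norm[of x] norm_snd_le_norm[of x] n(3) by (intro add_mono mult_mono) auto
      finally show ?thesis by (simp add: A_def algebra_simps)
    qed
    have Plin: "P (x + y) = P x + P y" "P (r *\<^sub>R x) = r *\<^sub>R P x" "P (x - y) = P x - P y" for x y r
      by (simp_all add: P_def algebra_simps)
    have \<omega>: "norm (P \<eta>) \<le> A" using Pn[of \<eta>] \<eta>1 A mult_right_mono[of "norm \<eta>" 1 A] by linarith
    have F\<omega>: "1 \<le> \<bar>F \<bullet> P \<eta>\<bar>" "norm F \<le> 12 / a * \<bar>F \<bullet> P \<eta>\<bar>"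
      using F(3)[of "P \<eta>"] n(4) \<omega> unfolding P_def by blast+
    \<comment> \<open>The sign makes \<open>f \<eta>\<close> positive, hence also the factor
      \<open>h\<close> that normalises it to 1.\<close>
    define sg where "sg = sgn (F \<bullet> P \<eta>)"
    have sg: "\<bar>sg\<bar> = 1" "sg * sg = 1" using F\<omega>(1) by (auto simp: sg_def sgn_if)
    define f where "f x = sg * (F \<bullet> P x)" for x
    have flin: "f (x + y) = f x + f y" "f (r *\<^sub>R x) = r * f x" "f (x - y) = f x - f y" for x y r
      by (simp_all add: f_def Plin inner_add_right inner_diff_right algebra_simps)
    have fle: "\<bar>f x\<bar> \<le> norm F * (norm x * A)" for x
    proof -
      have "\<bar>f x\<bar> = \<bar>F \<bullet> P x\<bar>" using sg by (simp add: f_def abs_mult)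
      also have "\<dots> \<le> norm F * norm (P x)" by (rule Cauchy_Schwarz_ineq2)
      also have "\<dots> \<le> norm F * (norm x * A)" using Pn[of x] by (intro mult_left_mono) auto
      finally show ?thesis .
    qed
    define h where "h = 1 / \<bar>F \<bullet> P \<eta>\<bar>"
    have f\<eta>: "f \<eta> = \<bar>F \<bullet> P \<eta>\<bar>" by (simp add: f_def sg_def abs_sgn mult.commute)
    have h: "0 < h" "h \<le> 1" "h0 \<le> h" "h * norm F \<le> 12 / a" "h * f \<eta> = 1"
    proof -
      show "0 < h" "h \<le> 1" using F\<omega>(1) by (auto simp: h_def)
      show "h * f \<eta> = 1" using F\<omega>(1) by (simp add: h_def f\<eta>)
      show "h * norm F \<le> 12 / a" using F\<omega> by (simp add: h_def divide_le_eq)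
      have "\<bar>F \<bullet> P \<eta>\<bar> \<le> norm F * A"
        using Cauchy_Schwarz_ineq2[of F "P \<eta>"] mult_left_mono[OF \<omega>, of "norm F"] by simp
      then show "h0 \<le> h" unfolding h0_def h_def using F\<omega>(1) by (intro divide_left_mono mult_pos_pos F0 A) auto
    qed
    \<comment> \<open>The functional \<open>h * f\<close>, read in the original coordinates, equals
      1 on the vertical vector. It therefore has the form y + \<phi> \<bullet> x, and the shear by
      \<phi> makes it the second coordinate.\<close>
    define gf where "gf x = h * f (H (x, 0))" for x
    have "linear gf"
    proof (rule linearI)
      show "gf (x + y) = gf x + gf y" for x y
        using linear_add[OF H(1), of "(x, 0)" "(y, 0)"] by (simp add: gf_def flin algebra_simps)
      show "gf (r *\<^sub>R x) = r *\<^sub>R gf x" for r x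
        using linear_scale[OF H(1), of r "(x, 0)"] by (simp add: gf_def flin)
    qed
    define \<phi> where "\<phi> = adjoint gf 1"
    have \<phi>: "\<phi> \<bullet> x = gf x" for x
      using adjoint_works[OF \<open>linear gf\<close>, of x 1] by (simp add: \<phi>_def inner_commute)
    have key: "snd (G x) + \<phi> \<bullet> fst (G x) = h * f x" for x
    proof -
      have "G x = (fst (G x), 0) + snd (G x) *\<^sub>R (0, 1)" by (simp add: prod_eq_iff)
      then have "H (G x) = H (fst (G x), 0) + snd (G x) *\<^sub>R \<eta>"
        unfolding \<eta>_def by (metis linear_add[OF H(1)] linear_scale[OF H(1)])
      then have "f x = f (H (fst (G x), 0)) + snd (G x) * f \<eta>" by (metis HG flin(1,2))
      then have "h * f x = gf (fst (G x)) + snd (G x) * (h * f \<eta>)" by (simp add: gf_def algebra_simps)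
      then show ?thesis using h(5) \<phi> by simp
    qed
    have \<phi>n: "norm \<phi> \<le> C\<phi>"
    proof -
      have "norm \<phi> * norm \<phi> = h * f (H (\<phi>, 0))"
        using \<phi>[of \<phi>] by (simp add: gf_def dot_square_norm power2_eq_square)
      also have "\<dots> \<le> h * (norm F * (norm \<phi> * A))"
      proof (intro mult_left_mono)
        have "f (H (\<phi>, 0)) \<le> norm F * (norm (H (\<phi>, 0)) * A)" using fle[of "H (\<phi>, 0)"] by linarith
        also have "\<dots> \<le> norm F * (norm \<phi> * A)"
          using Hnorm[of "(\<phi>, 0)"] A by (intro mult_left_mono mult_right_mono) auto
        finally show "f (H (\<phi>, 0)) \<le> norm F * (norm \<phi> * A)" .
      qed (use h in auto)
      also have "\<dots> = (h * norm F) * (norm \<phi> * A)" by simp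
      also have "\<dots> \<le> (12 / a) * (norm \<phi> * A)" using h(4) A by (intro mult_right_mono) auto
      also have "\<dots> = C\<phi> * norm \<phi>" by (simp add: C\<phi>_def)
      finally show ?thesis using C\<phi> by (cases "\<phi> = 0") auto
    qed
    define m1 :: "(real ^ 'n) \<times> real" where "m1 = (n, 1)"
    have m1: "m1 \<in> N" "P m1 = 0" unfolding m1_def using intN n(1) by (auto simp: P_def)
    obtain t where t: "t *\<^sub>R m1 \<in> N" "0 < t" "t \<le> 1" "1 / real q \<le> t"
      "\<And>r. r *\<^sub>R m1 \<in> N \<Longrightarrow> \<exists>l::int. r = of_int l * t"
    proof -
      let ?S = "{r. r *\<^sub>R m1 \<in> N}"
      have "add_subgroup ?S" using N by (auto simp: add_subgroup_def scaleR_left_diff_distrib)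
      moreover have "1 \<in> ?S" using m1 by simp
      moreover have "real q * x \<in> \<int>" if "x \<in> ?S" for x
        using den(2)[of "x *\<^sub>R m1"] that by (simp add: m1_def)
      ultimately show thesis using add_subgroup_real_cyclic[of ?S q] q that by (metis mem_Collect_eq)
    qed
    define v0 where "v0 = t *\<^sub>R m1"
    have v0: "v0 \<in> N" "P v0 = 0" using t m1 by (auto simp: v0_def Plin)
    \<comment> \<open>The rank two sublattice carrying the rows. On it \<open>f\<close> is the
      \<open>i0\<close> coordinate of the projection up to sign, because \<open>F $ i0 = 1\<close>;
      lattice vectors of bounded size outside it are excluded by genericity.\<close>
    define R where "R = {x \<in> N. P x = P x $ i0 *\<^sub>R axis i0 1}"
    have fR: "f x = sg * P x $ i0" if "x \<in> R" for x
    proof -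
      have "F \<bullet> P x = P x $ i0 * F $ i0" using that unfolding R_def
        by (metis (mono_tags, lifting) inner_axis inner_real_def inner_scaleR_right mem_Collect_eq mult.right_neutral real_inner_1_right)
      then show ?thesis using F(1) by (simp add: f_def)
    qed
    have Rsub: "add_subgroup R"
      using N unfolding add_subgroup_def R_def
      by (auto simp: Plin scaleR_left_diff_distrib) (simp add: P_def)
    obtain f0 where f0: "f0 \<in> f ` R" "0 < f0" "f0 \<le> 1" "1 / real q \<le> f0"
      "\<And>x. x \<in> f ` R \<Longrightarrow> \<exists>l::int. x = of_int l * f0"
    proof -
      have "add_subgroup (f ` R)"
        unfolding add_subgroup_def
      proof (intro conjI ballI)
        show "0 \<in> f ` R" using Rsub by (auto simp: add_subgroup_def f_def P_def intro!: image_eqI[of _ _ 0])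
        fix x y assume "x \<in> f ` R" "y \<in> f ` R"
        then obtain x' y' where "x' \<in> R" "y' \<in> R" "x = f x'" "y = f y'" by blast
        then show "x - y \<in> f ` R"
          using add_subgroup_diff[OF Rsub] by (intro image_eqI[of _ _ "x' - y'"]) (auto simp: flin)
      qed
      moreover have "1 \<in> f ` R"
      proof (rule image_eqI)
        have iv: "int_vec (sg *\<^sub>R axis i0 (1::real))"
          using sg by (auto simp: int_vec_def axis_def sg_def sgn_if)
        show "(sg *\<^sub>R axis i0 1, 0) \<in> R" using intN[OF iv, of 0] by (simp add: R_def P_def)
        then show "1 = f (sg *\<^sub>R axis i0 1, 0)" using fR sg by (simp add: P_def)
      qed
      moreover have "real q * x \<in> \<int>" if xR: "x \<in> f ` R" for x
      proof -
        obtain y where y: "y \<in> R" "x = f y" using xR by blast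
        then have yN: "y \<in> N" by (simp add: R_def)
        have "real q * fst y $ i0 \<in> \<int>" using den(1)[OF yN] by (simp add: int_vec_def)
        moreover have "(real q * snd y) * n $ i0 \<in> \<int>" using n(1) by (intro Ints_mult[OF den(2)[OF yN]]) (simp add: int_vec_def)
        ultimately have "real q * fst y $ i0 - (real q * snd y) * n $ i0 \<in> \<int>" by (rule Ints_diff)
        moreover have "real q * fst y $ i0 - (real q * snd y) * n $ i0 = real q * P y $ i0"
          by (simp add: P_def right_diff_distrib)
        ultimately have "real q * P y $ i0 \<in> \<int>" by simp
        moreover have "sg \<in> \<int>" by (simp add: sg_def sgn_if)
        ultimately have "sg * (real q * P y $ i0) \<in> \<int>" using Ints_mult by blast
        then show ?thesis using fR[OF y(1)] y(2) by (simp add: mult.left_commute)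
      qed
      ultimately show thesis using add_subgroup_real_cyclic[of "f ` R" q] q that by metis
    qed
    obtain b0 where b0: "b0 \<in> R" "f b0 = f0" using f0(1) by auto
    \<comment> \<open>Multiples of \<open>v0\<close> do not change \<open>f\<close>, so the last
      coordinate can be reduced to at most \<open>t\<close>; this keeps \<open>b\<close> comparable
      to one row step.\<close>
    define b1 where "b1 = b0 - of_int \<lfloor>snd b0 / t\<rfloor> *\<^sub>R v0"
    have b1N: "b1 \<in> N" unfolding b1_def using b0 v0 R_def
      by (intro add_subgroup_diff[OF N] add_subgroup_scaleR_int[OF N]) auto
    have Pb1: "P b1 = P b0" by (simp add: b1_def Plin v0)
    have b1R: "b1 \<in> R" using b1N b0 Pb1 by (simp add: R_def)
    have fb1: "f b1 = f0" using Pb1 b0 by (simp add: f_def)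
    have sb1: "0 \<le> snd b1" "snd b1 \<le> t"
    proof -
      have "snd b1 = (snd b0 / t - of_int \<lfloor>snd b0 / t\<rfloor>) * t"
        using t(2) by (simp add: b1_def v0_def m1_def left_diff_distrib)
      moreover have "0 \<le> snd b0 / t - of_int \<lfloor>snd b0 / t\<rfloor>" "snd b0 / t - of_int \<lfloor>snd b0 / t\<rfloor> \<le> 1" by linarith+
      ultimately show "0 \<le> snd b1" "snd b1 \<le> t"
        using t(2) mult_right_mono[of "snd b0 / t - of_int \<lfloor>snd b0 / t\<rfloor>" 1 t] by auto
    qed
    have rows: "\<exists>l l'. x = of_int l *\<^sub>R b1 + of_int l' *\<^sub>R v0 \<and> f x = of_int l * f0" if x: "x \<in> R" for x
    proof -
      obtain l :: int where l: "f x = of_int l * f0" using f0(5) x by blast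
      define x' where "x' = x - of_int l *\<^sub>R b1"
      have x'R: "x' \<in> R" unfolding x'_def
        by (intro add_subgroup_diff[OF Rsub] add_subgroup_scaleR_int[OF Rsub] x b1R)
      have "f x' = 0" by (simp add: x'_def flin l fb1)
      then have "P x' $ i0 = 0" using fR[OF x'R] sg by auto
      then have "P x' = 0" using x'R by (simp add: R_def)
      then have "x' = snd x' *\<^sub>R m1" by (simp add: P_def m1_def prod_eq_iff)
      moreover have "x' \<in> N" using x'R by (simp add: R_def)
      ultimately obtain l' :: int where "snd x' = of_int l' * t" using t(5) by metis
      then have "x' = of_int l' *\<^sub>R v0" using \<open>x' = snd x' *\<^sub>R m1\<close> by (simp add: v0_def)
      then show ?thesis using l by (metis x'_def add.commute diff_add_cancel)
    qed
    have rowsR: "of_int l *\<^sub>R b1 + of_int l' *\<^sub>R v0 \<in> R" for l l'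
    proof -
      have "v0 \<in> R" using v0 by (simp add: R_def)
      then show ?thesis
        by (intro add_subgroup_add[OF Rsub] add_subgroup_scaleR_int[OF Rsub] b1R)
    qed
    have fv0: "f v0 = 0" using v0 by (simp add: f_def)
    have Gm1: "norm (fst (G m1) + \<rho> *\<^sub>R e) \<le> C1" using n(2) by (simp add: m1_def)
    have fstGm1: "norm (fst (G m1)) \<le> \<rho> + C1"
      using norm_triangle_ineq4[of "fst (G m1) + \<rho> *\<^sub>R e" "\<rho> *\<^sub>R e"] Gm1 e \<rho>(1) by simp
    define w where "w = t * \<rho>"
    have w: "0 < w" "w \<le> \<epsilon> * s" using t \<rho>(1) s(2) by (auto simp: w_def mult_le_cancel_right1)
    have Gv: "norm (fst (G v0) + w *\<^sub>R e) \<le> \<delta> * w"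
    proof -
      have "fst (G v0) + w *\<^sub>R e = t *\<^sub>R (fst (G m1) + \<rho> *\<^sub>R e)"
        by (simp add: v0_def w_def Gscale scaleR_right_distrib)
      then have "norm (fst (G v0) + w *\<^sub>R e) \<le> t * C1" using t(2) Gm1 by (simp add: mult_left_mono)
      also have "\<dots> \<le> t * (\<delta> * \<rho>)" using \<rho>(2) t(2) by (intro mult_left_mono) auto
      finally show ?thesis by (simp add: w_def mult.left_commute mult.commute)
    qed
    \<comment> \<open>The part transversal to the row contributes at most \<open>2 * W\<close>,
      hence at most \<open>w\<close>, and the part along it at most \<open>2 * w\<close>.\<close>
    have Gb: "norm (fst (G b1)) \<le> 3 * w"
    proof -
      have "b1 = (P b1, 0) + snd b1 *\<^sub>R m1" by (simp add: P_def m1_def prod_eq_iff)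
      then have "G b1 = G (P b1, 0) + snd b1 *\<^sub>R G m1" by (metis Gadd Gscale)
      then have "norm (fst (G b1)) \<le> norm (fst (G (P b1, 0))) + norm (snd b1 *\<^sub>R fst (G m1))"
        using norm_triangle_ineq[of "fst (G (P b1, 0))" "snd b1 *\<^sub>R fst (G m1)"] by simp
      also have "norm (fst (G (P b1, 0))) \<le> 2 * W * norm (P b1)"
        using G(5)[of "(P b1, 0)"] norm_fst_le_norm[of "G (P b1, 0)"] by simp
      also have "norm (P b1) = f0"
      proof -
        have "norm (P b1) = \<bar>P b1 $ i0\<bar>" using b1R unfolding R_def
          by (metis (mono_tags, lifting) mem_Collect_eq mult.right_neutral norm_axis_1 norm_scaleR)
        then show ?thesis using fR[OF b1R] sg fb1 f0(2) by (metis abs_mult abs_of_pos mult_1)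
      qed
      also have "2 * W * f0 \<le> 2 * W" using f0 W by simp
      also have "2 * W \<le> w"
      proof -
        have "2 * W = 1 / real q * (2 * W * real q)" using q by simp
        also have "\<dots> \<le> t * \<rho>" using t(2,4) \<rho>(3) W by (intro mult_mono) auto
        finally show ?thesis by (simp add: w_def)
      qed
      also have "norm (snd b1 *\<^sub>R fst (G m1)) \<le> t * (\<rho> + C1)"
        using sb1 fstGm1 by (simp add: mult_mono)
      also have "t * (\<rho> + C1) \<le> t * (2 * \<rho>)"
      proof (intro mult_left_mono)
        have "\<delta> * \<rho> \<le> 1 * \<rho>" using pos(3) \<rho>(1) by (intro mult_right_mono) auto
        then show "\<rho> + C1 \<le> 2 * \<rho>" using \<rho>(2) by linarith
      qed (use t in auto)
      finally show ?thesis by (simp add: w_def mult.commute)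
    qed
    \<comment> \<open>Perturbations change values by at most an eighth of \<open>h * f0\<close>. So
      the row of \<open>b\<close> stays below this threshold, while rows with index at least 2 stay
      above it and those with negative index stay negative.\<close>
    define Y where "Y = 5 / 4 * (h * f0)"
    have hf0: "0 < h * f0" "h * f0 \<le> 1" using h f0 by (auto intro: mult_le_one)
    \<comment> \<open>The unperturbed functional vanishes on \<open>v0\<close>. As \<open>v0\<close>
      maps to about \<open>- w *\<^sub>R e\<close>, the shift by
      \<open>- (\<kappa>1 / 2) *\<^sub>R e\<close> gives it a value near \<kappa>1 w / 2; radius
      \<kappa>1 / 8 and \<open>\<delta> \<le> 1 / 4\<close> are small enough to keep it
      positive.\<close>
    have "lattice_rows M e \<epsilon> \<delta> \<Delta> s \<psi>" if \<psi>: "\<psi> \<in> ball (\<phi> - (\<kappa>1 / 2) *\<^sub>R e) (\<kappa>1 / 8)" for \<psi>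
    proof -
      define \<xi>' where "\<xi>' = \<psi> - (\<phi> - (\<kappa>1 / 2) *\<^sub>R e)"
      have \<xi>': "norm \<xi>' \<le> \<kappa>1 / 8" using \<psi> by (simp add: \<xi>'_def dist_norm norm_minus_commute)
      define \<xi> where "\<xi> = \<psi> - \<phi>"
      have \<xi>: "\<xi> = \<xi>' - (\<kappa>1 / 2) *\<^sub>R e" by (simp add: \<xi>_def \<xi>'_def)
      have \<xi>n: "norm \<xi> \<le> \<kappa>1"
        unfolding \<xi> using norm_triangle_ineq4[of \<xi>' "(\<kappa>1 / 2) *\<^sub>R e"] \<xi>' e \<kappa>1(1) by simp
      have y: "snd (G x) + \<psi> \<bullet> fst (G x) = h * f x + \<xi> \<bullet> fst (G x)" for x
        using key[of x] by (simp add: \<xi>_def inner_diff_left)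
      have small: "\<bar>\<xi> \<bullet> u\<bar> \<le> h * f0 / 8" if "norm u \<le> \<Delta> * s" for u
      proof -
        have "\<bar>\<xi> \<bullet> u\<bar> \<le> norm \<xi> * norm u" by (rule Cauchy_Schwarz_ineq2)
        also have "\<dots> \<le> \<kappa>1 * (\<Delta> * s)" using that \<xi>n \<kappa>1 by (intro mult_mono) auto
        also have "\<dots> \<le> h0 * (1 / real q) / 8" by (rule \<kappa>1(3))
        also have "\<dots> \<le> h * f0 / 8" using h h0 f0(4) q by (intro divide_right_mono mult_mono) auto
        finally show ?thesis .
      qed
      have yv: "0 < snd (G v0) + \<psi> \<bullet> fst (G v0)"
      proof -
        define z where "z = fst (G v0) + w *\<^sub>R e"
        have z: "norm z \<le> w / 4" using Gv pos(3) w(1) mult_right_mono[of \<delta> "1 / 4" w] unfolding z_def by linarith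
        have fz: "fst (G v0) = z - w *\<^sub>R e" by (simp add: z_def)
        have ee: "e \<bullet> e = 1" using e by (simp add: dot_square_norm)
        have "\<xi> \<bullet> fst (G v0) = \<xi>' \<bullet> z - w * (\<xi>' \<bullet> e) - \<kappa>1 / 2 * (e \<bullet> z) + \<kappa>1 / 2 * w"
          unfolding \<xi> fz by (simp add: inner_diff_left inner_diff_right ee algebra_simps)
        moreover have "\<bar>\<xi>' \<bullet> z\<bar> \<le> \<kappa>1 / 8 * (w / 4)"
          using Cauchy_Schwarz_ineq2[of \<xi>' z] mult_mono[OF \<xi>' z] \<kappa>1(1) by simp
        moreover have "\<bar>w * (\<xi>' \<bullet> e)\<bar> \<le> w * (\<kappa>1 / 8)"
          using Cauchy_Schwarz_ineq2[of \<xi>' e] \<xi>' e w(1) by (simp add: abs_mult)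
        moreover have "\<bar>\<kappa>1 / 2 * (e \<bullet> z)\<bar> \<le> \<kappa>1 / 2 * (w / 4)"
          using Cauchy_Schwarz_ineq2[of e z] z e \<kappa>1(1) by (simp add: abs_mult)
        moreover have "0 < \<kappa>1 * w" using \<kappa>1(1) w(1) by simp
        ultimately have "0 < \<xi> \<bullet> fst (G v0)" by (simp add: mult.commute abs_le_iff) 
        then show ?thesis unfolding y by (simp add: fv0)
      qed
      show ?thesis unfolding lattice_rows_def
      proof (rule bexI[of _ "G v0"], rule bexI[of _ "G b1"], rule exI[of _ Y], rule exI[of _ w],
          intro conjI ballI impI allI)
        show "G v0 \<in> M" "G b1 \<in> M" using v0 b1N by (auto simp: N_def)
        show "0 < w" "w \<le> \<epsilon> * s" by fact+
        show "norm (fst (G v0) + w *\<^sub>R e) \<le> \<delta> * w" by fact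
        show "norm (fst (G b1)) \<le> 3 * w" by fact
        show "0 < snd (G v0) + \<psi> \<bullet> fst (G v0)" by fact
        have Glin: "G b1 + of_int l *\<^sub>R G v0 = G (of_int 1 *\<^sub>R b1 + of_int l *\<^sub>R v0)" for l
          by (simp add: Gadd Gscale)
        have fl: "f (of_int 1 *\<^sub>R b1 + of_int l *\<^sub>R v0) = f0" for l :: int
          by (simp add: flin fb1 fv0)
        show "0 < snd (G b1 + of_int l *\<^sub>R G v0) + \<psi> \<bullet> fst (G b1 + of_int l *\<^sub>R G v0)"
          "snd (G b1 + of_int l *\<^sub>R G v0) + \<psi> \<bullet> fst (G b1 + of_int l *\<^sub>R G v0) < Y"
          if "norm (fst (G b1 + of_int l *\<^sub>R G v0)) \<le> \<Delta> * s" for l :: int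
          using small[OF that] hf0(1) unfolding Glin y fl Y_def by linarith+
        fix p assume p: "p \<in> M" "norm (fst p) \<le> \<Delta> * s \<and> 0 < snd p + \<psi> \<bullet> fst p \<and> snd p + \<psi> \<bullet> fst p < Y"
        define x where "x = H p"
        have Gx: "G x = p" by (simp add: x_def H(2))
        have xN: "x \<in> N" using p(1) by (simp add: N_def Gx)
        have py: "0 < h * f x + \<xi> \<bullet> fst p" "h * f x + \<xi> \<bullet> fst p < Y" using p(2) y[of x] by (auto simp: Gx)
        then have hf: "- (h * f0 / 8) < h * f x" "h * f x < 11 / 8 * (h * f0)"
          using small[of "fst p"] p(2) unfolding Y_def by linarith+
        have fx: "- (f0 / 8) < f x" "f x < 11 / 8 * f0"
        proof -
          have "h * (- (f0 / 8)) < h * f x" "h * f x < h * (11 / 8 * f0)" using hf by simp_all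
          then show "- (f0 / 8) < f x" "f x < 11 / 8 * f0" using h(1) by (simp_all only: mult_less_cancel_left_pos)
        qed
        have "P x \<in> Z"
        proof -
          have Ds: "0 < \<Delta> * s" using pos s by simp
          have "norm \<psi> \<le> C\<phi> + 1"
            using norm_triangle_ineq[of \<phi> \<xi>] \<phi>n \<xi>n \<kappa>1(2) by (simp add: \<xi>_def)
          then have "\<bar>\<psi> \<bullet> fst p\<bar> \<le> (C\<phi> + 1) * (\<Delta> * s)"
            using Cauchy_Schwarz_ineq2[of \<psi> "fst p"] mult_mono[of "norm \<psi>" "C\<phi> + 1" "norm (fst p)" "\<Delta> * s"] p(2) C\<phi> by simp
          moreover have "Y \<le> 2" using hf0 by (simp add: Y_def)
          ultimately have "\<bar>snd p\<bar> \<le> 2 + (C\<phi> + 1) * (\<Delta> * s)" using p(2) by linarith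
          then have "norm p \<le> \<Delta> * s + (2 + (C\<phi> + 1) * (\<Delta> * s))" using norm_le_fst_snd[of p] p(2) by linarith
          then have "norm x \<le> \<Delta> * s + (2 + (C\<phi> + 1) * (\<Delta> * s))" using Hnorm[of p] by (simp add: x_def)
          then have "norm (P x) \<le> B" using Pn[of x] A mult_right_mono[of "norm x" _ A] unfolding B_def by (meson less_imp_le order_trans)
          moreover have "real q *\<^sub>R P x = real q *\<^sub>R fst x - (real q * snd x) *\<^sub>R n"
            by (simp add: P_def scaleR_right_diff_distrib)
          then have "int_vec (real q *\<^sub>R P x)"
            using den[OF xN] n(1) by (simp add: int_vec_diff int_vec_scaleR)
          ultimately show ?thesis by (simp add: Z_def)
        qed
        moreover have "\<bar>F \<bullet> P x\<bar> < 3"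
        proof -
          have "\<bar>F \<bullet> P x\<bar> = \<bar>f x\<bar>" using sg by (simp add: f_def abs_mult)
          also have "\<dots> < 3" using fx f0(3) by (simp add: abs_less_iff)
          finally show ?thesis .
        qed
        ultimately have "x \<in> R" using F(2)[of "P x"] xN by (force simp: R_def)
        then obtain l l' :: int where l: "x = of_int l *\<^sub>R b1 + of_int l' *\<^sub>R v0" "f x = of_int l * f0"
          using rows by blast
        have "of_int (- 1) * f0 < of_int l * f0" "of_int l * f0 < of_int 2 * f0" using fx f0(2) unfolding l(2) by simp_all
        then have "- 1 < l" "l < 2" using f0(2) by (simp_all only: mult_less_cancel_right_pos of_int_less_iff)
        then consider "l = 0" | "l = 1" by linarith
        then show "(\<exists>l::int. p = of_int l *\<^sub>R G v0) \<or> (\<exists>l::int. p = G b1 + of_int l *\<^sub>R G v0)"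
          using l(1) Gx by cases (auto simp: Gadd Gscale)
      qed
    qed
    moreover have "norm (\<phi> - (\<kappa>1 / 2) *\<^sub>R e) \<le> C\<phi> + 1"
      using norm_triangle_ineq4[of \<phi> "(\<kappa>1 / 2) *\<^sub>R e"] \<phi>n \<kappa>1 e by simp
    ultimately show ?thesis by blast
  qed
  then show thesis using that[of s "C\<phi> + 1" "\<kappa>1 / 8"] s(1) C\<phi> \<kappa>1(1) by simp
qed

section \<open>Recurrence of structured approximations\<close>

text \<open>Separation bounds the short vectors of the rescaled lattice from below, and the density
  that it implies bounds the covering radius, so one set of constants from
  \<open>structured_perturbation\<close> serves all \<alpha> and \<tau>. Undoing the rescaling turns
  a shear of bounded size into a change of \<alpha> of order \<tau>^-(d+1).\<close>

lemma structured_hole: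
  fixes e :: "real ^ 'n"
  assumes card: "CARD('n) \<ge> 2" and e: "norm e = 1" and pos: "0 < \<epsilon>" "0 < \<delta>" "\<delta> \<le> 1 / 4" "0 < \<Delta>"
    and c: "0 < c" "c < 1"
  obtains s C \<kappa> where "0 < s" "0 < C" "0 < \<kappa>"
    "\<And>\<alpha> \<tau>. separated \<alpha> \<tau> c \<Longrightarrow> 0 < \<tau> \<Longrightarrow>
       \<exists>\<beta>. norm (\<beta> - \<alpha>) \<le> C / real \<tau> ^ (CARD('n) + 1) \<and>
         (\<forall>\<alpha>'\<in>ball \<beta> (\<kappa> / real \<tau> ^ (CARD('n) + 1)). row_structured e \<epsilon> \<delta> \<Delta> (s * real \<tau>) \<alpha>')"
proof -
  let ?d = "CARD('n)"
  obtain J :: nat where J: "1 / c + 1 < real J" using reals_Archimedean2 by blast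
  define K where "K = real ?d + real ?d * real (2 * J) + real (2 * J)"
  have K: "0 \<le> K" by (simp add: K_def)
  obtain s C \<kappa> where sC: "0 < s" "0 < C" "0 < \<kappa>" and pert:
    "\<And>M. add_subgroup M \<Longrightarrow> (\<And>p. p \<in> M \<Longrightarrow> norm p \<le> c \<Longrightarrow> p = 0) \<Longrightarrow>
       (\<And>p. \<exists>q\<in>M. norm (q - p) \<le> K) \<Longrightarrow>
       \<exists>\<phi>. norm \<phi> \<le> C \<and> (\<forall>\<psi>\<in>ball \<phi> \<kappa>. lattice_rows M e \<epsilon> \<delta> \<Delta> s \<psi>)"
    using structured_perturbation[OF card e pos c(1) K] by metis
  have "\<exists>\<beta>. norm (\<beta> - \<alpha>) \<le> C / real \<tau> ^ (?d + 1) \<and>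
         (\<forall>\<alpha>'\<in>ball \<beta> (\<kappa> / real \<tau> ^ (?d + 1)). row_structured e \<epsilon> \<delta> \<Delta> (s * real \<tau>) \<alpha>')"
    if sep: "separated \<alpha> \<tau> c" and \<tau>: "0 < \<tau>" for \<alpha> :: "real ^ 'n" and \<tau>
  proof -
    define t where "t = real \<tau>"
    define D where "D = t ^ ?d"
    have t: "1 \<le> t" using \<tau> by (simp add: t_def)
    have D: "1 \<le> D" using t by (simp add: D_def)
    have tD: "t ^ (?d + 1) = t * D" by (simp add: D_def)
    \<comment> \<open>Positions shrink by \<tau> and values grow by \<tau>^d, so that separation and
      density both become statements at unit scale.\<close>
    define \<Phi> where "\<Phi> n k = (n /\<^sub>R t, D * (n \<bullet> \<alpha> + k))" for n :: "real ^ 'n" and k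
    define M where "M = {\<Phi> n k | n k. int_vec n \<and> k \<in> \<int>}"
    have \<Phi>I: "\<Phi> n k \<in> M" if "int_vec n" "k \<in> \<int>" for n k using that by (auto simp: M_def)
    have \<Phi>add: "\<Phi> n k + r *\<^sub>R \<Phi> m l = \<Phi> (n + r *\<^sub>R m) (k + r * l)" for n k r m l
      by (simp add: \<Phi>_def inner_add_left algebra_simps)
    have \<Phi>scale: "r *\<^sub>R \<Phi> m l = \<Phi> (r *\<^sub>R m) (r * l)" for r m l
      by (simp add: \<Phi>_def algebra_simps)
    have \<Phi>inj: "n = m \<and> k = l" if "\<Phi> n k = \<Phi> m l" for n k m l
    proof -
      have "n /\<^sub>R t = m /\<^sub>R t" "D * (n \<bullet> \<alpha> + k) = D * (m \<bullet> \<alpha> + l)"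
        using that by (simp_all only: \<Phi>_def prod.inject)
      then show ?thesis using t D by simp
    qed
    have Msub: "add_subgroup M" unfolding add_subgroup_def
    proof (intro conjI ballI)
      have "\<Phi> 0 0 = 0" by (simp add: \<Phi>_def zero_prod_def)
      then show "0 \<in> M" using \<Phi>I[of 0 0] by (simp add: int_vec_def)
      fix x y assume "x \<in> M" "y \<in> M"
      then obtain n k m l where xy: "x = \<Phi> n k" "int_vec n" "k \<in> \<int>" "y = \<Phi> m l" "int_vec m" "l \<in> \<int>"
        by (auto simp: M_def)
      have "x - y = \<Phi> (n - m) (k - l)" using \<Phi>add[of n k "- 1" m l] xy by simp
      then show "x - y \<in> M" using \<Phi>I[OF int_vec_diff[OF xy(2,5)] Ints_diff[OF xy(3,6)]] by simp
    qed
    have Msep: "p = 0" if p: "p \<in> M" "norm p \<le> c" for p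
    proof -
      obtain n k where nk: "p = \<Phi> n k" "int_vec n" "k \<in> \<int>" using p by (auto simp: M_def)
      have f: "norm (n /\<^sub>R t) \<le> c" using norm_fst_le_norm[of p] p(2) nk(1) by (simp add: \<Phi>_def)
      have "\<bar>n $ i\<bar> \<le> real \<tau>" for i
      proof -
        have "\<bar>n $ i\<bar> \<le> norm n" by (rule component_le_norm_cart)
        also have "norm n = t * norm (n /\<^sub>R t)" using t by simp
        also have "\<dots> \<le> t * 1" using f c t by (intro mult_left_mono) auto
        finally show ?thesis by (simp add: t_def)
      qed
      moreover have s: "\<bar>D * (n \<bullet> \<alpha> + k)\<bar> \<le> c" using norm_snd_le_norm[of p] p(2) nk(1) by (simp add: \<Phi>_def)
      then have "\<bar>n \<bullet> \<alpha> + k\<bar> \<le> c / D" using D by (simp add: abs_mult le_divide_eq mult.commute)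
      ultimately have "n = 0" using sep nk(2,3) unfolding separated_def D_def t_def by (metis not_less)
      moreover have "k = 0"
      proof (rule ccontr)
        assume "k \<noteq> 0"
        then have "1 \<le> \<bar>k\<bar>" using nk(3) by (rule Ints_nonzero_abs_ge1[rotated])
        then have "1 \<le> D * \<bar>k\<bar>" using D mult_mono[of 1 D 1 "\<bar>k\<bar>"] by simp
        then show False using s \<open>n = 0\<close> c(2) D by (simp add: abs_mult)
      qed
      ultimately show ?thesis by (simp add: nk(1) \<Phi>_def zero_prod_def)
    qed
    have Mcov: "\<exists>q\<in>M. norm (q - p) \<le> K" for p
    proof -
      obtain n0 where n0: "int_vec n0" "norm (n0 - t *\<^sub>R fst p) \<le> real ?d" by (rule int_vec_near)
      obtain n' k where n': "int_vec n'" "k \<in> \<int>" "\<forall>i. \<bar>n' $ i\<bar> \<le> real (2 * J) * real \<tau>"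
        "\<bar>n' \<bullet> \<alpha> + k - (snd p / D - n0 \<bullet> \<alpha>)\<bar> \<le> real (2 * J) * (c / real \<tau> ^ ?d)"
        using separated_imp_dense[OF sep c(1) \<tau> J, of "snd p / D - n0 \<bullet> \<alpha>"] by blast
      have n'n: "norm n' \<le> real ?d * (real (2 * J) * t)"
        unfolding t_def by (rule norm_le_card_components) (use n'(3) in auto)
      define q where "q = \<Phi> (n0 + n') k"
      have "norm (fst (q - p)) \<le> real ?d + real ?d * real (2 * J)"
      proof -
        have "fst (q - p) = ((n0 - t *\<^sub>R fst p) + n') /\<^sub>R t" using t by (simp add: q_def \<Phi>_def algebra_simps)
        then have "norm (fst (q - p)) = norm ((n0 - t *\<^sub>R fst p) + n') / t"
          using t by (simp add: divide_inverse mult.commute)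
        also have "\<dots> \<le> (real ?d + real ?d * (real (2 * J) * t)) / t"
          using norm_triangle_ineq[of "n0 - t *\<^sub>R fst p" n'] n0(2) n'n t by (intro divide_right_mono) auto
        also have "\<dots> \<le> real ?d + real ?d * real (2 * J)"
        proof -
          have "real ?d / t \<le> real ?d" using t by (simp add: divide_le_eq mult_le_cancel_left1)
          then show ?thesis using t by (simp add: add_divide_distrib)
        qed
        finally show ?thesis .
      qed
      moreover have "\<bar>snd (q - p)\<bar> \<le> real (2 * J)"
      proof -
        have "snd (q - p) = D * (n' \<bullet> \<alpha> + k - (snd p / D - n0 \<bullet> \<alpha>))"
          using D by (simp add: q_def \<Phi>_def inner_add_left right_diff_distrib distrib_left)
        then have "\<bar>snd (q - p)\<bar> = D * \<bar>n' \<bullet> \<alpha> + k - (snd p / D - n0 \<bullet> \<alpha>)\<bar>" using D by (simp add: abs_mult)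
        also have "\<dots> \<le> D * (real (2 * J) * (c / D))"
          using n'(4) D unfolding D_def t_def by (intro mult_left_mono) auto
        also have "\<dots> = real (2 * J) * c" using D by simp
        also have "\<dots> \<le> real (2 * J) * 1" using c by (intro mult_left_mono) auto
        finally show ?thesis by simp
      qed
      ultimately have "norm (q - p) \<le> K" using norm_le_fst_snd[of "q - p"] by (simp add: K_def)
      then show ?thesis using \<Phi>I[OF int_vec_add[OF n0(1) n'(1)] n'(2)] unfolding q_def by blast
    qed
    obtain \<phi> where \<phi>: "norm \<phi> \<le> C" "\<And>\<psi>. \<psi> \<in> ball \<phi> \<kappa> \<Longrightarrow> lattice_rows M e \<epsilon> \<delta> \<Delta> s \<psi>"
      using pert[OF Msub Msep Mcov] by blast
    have tD0: "0 < t * D" using t D by simp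
    have "norm (\<phi> /\<^sub>R (t * D)) = norm \<phi> / (t * D)"
      using t D by (simp add: abs_mult divide_inverse mult.commute)
    then have "norm ((\<alpha> + \<phi> /\<^sub>R (t * D)) - \<alpha>) \<le> C / (t * D)"
      using divide_right_mono[OF \<phi>(1), of "t * D"] tD0 by simp
    moreover have "row_structured e \<epsilon> \<delta> \<Delta> (s * t) \<alpha>'" if \<alpha>': "\<alpha>' \<in> ball (\<alpha> + \<phi> /\<^sub>R (t * D)) (\<kappa> / (t * D))" for \<alpha>'
    proof -
      \<comment> \<open>Replacing \<alpha> by \<alpha>' shears the rescaled lattice by this vector;
        the factor combines both rescalings.\<close>
      define \<psi> where "\<psi> = (t * D) *\<^sub>R (\<alpha>' - \<alpha>)"
      have "\<phi> - \<psi> = (t * D) *\<^sub>R ((\<alpha> + \<phi> /\<^sub>R (t * D)) - \<alpha>')"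
        using t D by (simp add: \<psi>_def algebra_simps)
      then have "norm (\<phi> - \<psi>) = (t * D) * norm ((\<alpha> + \<phi> /\<^sub>R (t * D)) - \<alpha>')" using tD0 by simp
      also have "\<dots> < (t * D) * (\<kappa> / (t * D))"
        using \<alpha>' tD0 by (intro mult_strict_left_mono) (auto simp: dist_norm)
      also have "\<dots> = \<kappa>" using t D by simp
      finally have "lattice_rows M e \<epsilon> \<delta> \<Delta> s \<psi>" by (intro \<phi>(2)) (simp add: dist_norm)
      then obtain pv pb Y w where rw: "pv \<in> M" "pb \<in> M" "0 < w" "w \<le> \<epsilon> * s"
         "norm (fst pv + w *\<^sub>R e) \<le> \<delta> * w" "norm (fst pb) \<le> 3 * w" "0 < snd pv + \<psi> \<bullet> fst pv"
        and rows: "\<forall>p\<in>M. norm (fst p) \<le> \<Delta> * s \<and> 0 < snd p + \<psi> \<bullet> fst p \<and> snd p + \<psi> \<bullet> fst p < Y \<longrightarrow>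
            (\<exists>l::int. p = of_int l *\<^sub>R pv) \<or> (\<exists>l::int. p = pb + of_int l *\<^sub>R pv)"
        and brow: "\<forall>l::int. norm (fst (pb + of_int l *\<^sub>R pv)) \<le> \<Delta> * s \<longrightarrow>
            0 < snd (pb + of_int l *\<^sub>R pv) + \<psi> \<bullet> fst (pb + of_int l *\<^sub>R pv) \<and>
            snd (pb + of_int l *\<^sub>R pv) + \<psi> \<bullet> fst (pb + of_int l *\<^sub>R pv) < Y"
        unfolding lattice_rows_def by blast
      obtain v kv where v: "pv = \<Phi> v kv" "int_vec v" "kv \<in> \<int>" using rw(1) by (auto simp: M_def)
      obtain b kb where b: "pb = \<Phi> b kb" "int_vec b" "kb \<in> \<int>" using rw(2) by (auto simp: M_def)
      have val: "snd (\<Phi> n k) + \<psi> \<bullet> fst (\<Phi> n k) = D * (n \<bullet> \<alpha>' + k)" for n k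
      proof -
        have "\<psi> \<bullet> (n /\<^sub>R t) = D * ((\<alpha>' - \<alpha>) \<bullet> n)" using t by (simp add: \<psi>_def)
        then show ?thesis by (simp add: \<Phi>_def inner_diff_left inner_commute algebra_simps)
      qed
      have nf: "norm (fst (\<Phi> n k)) \<le> \<Delta> * s \<longleftrightarrow> norm n \<le> \<Delta> * (s * t)" for n k
        using t by (simp add: \<Phi>_def field_simps)
      have vp: "0 < D * x \<longleftrightarrow> 0 < x" "D * x < Y \<longleftrightarrow> x < Y / D" for x
        using D by (simp_all add: zero_less_mult_iff less_divide_eq mult.commute)
      show ?thesis unfolding row_structured_def
      proof (rule exI[of _ v], rule exI[of _ kv], rule exI[of _ b], rule exI[of _ kb], rule exI[of _ "Y / D"],
          rule exI[of _ "w * t"], intro conjI)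
        show "int_vec v" "kv \<in> \<int>" "int_vec b" "kb \<in> \<int>" by fact+
        show "0 < w * t" using rw(3) t by simp
        show "w * t \<le> \<epsilon> * (s * t)" using rw(4) t mult_right_mono[of w "\<epsilon> * s" t] by simp
        have "v + (w * t) *\<^sub>R e = t *\<^sub>R (fst pv + w *\<^sub>R e)" using t by (simp add: v(1) \<Phi>_def algebra_simps)
        then show "norm (v + (w * t) *\<^sub>R e) \<le> \<delta> * (w * t)"
          using mult_left_mono[OF rw(5), of t] t by (simp add: mult.commute mult.left_commute)
        have "b = t *\<^sub>R fst pb" using t by (simp add: b(1) \<Phi>_def)
        then show "norm b \<le> 3 * (w * t)"
          using mult_left_mono[OF rw(6), of t] t by (simp add: mult.commute mult.left_commute)
        show "0 < v \<bullet> \<alpha>' + kv" using rw(7) unfolding v(1) val vp .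
        show "\<forall>n k. int_vec n \<and> k \<in> \<int> \<and> norm n \<le> \<Delta> * (s * t) \<and> 0 < n \<bullet> \<alpha>' + k \<and> n \<bullet> \<alpha>' + k < Y / D \<longrightarrow>
          (\<exists>l::int. n = of_int l *\<^sub>R v \<and> k = of_int l * kv) \<or>
          (\<exists>l::int. n = b + of_int l *\<^sub>R v \<and> k = kb + of_int l * kv)"
        proof (intro allI impI)
          fix n k
          assume a: "int_vec n \<and> k \<in> \<int> \<and> norm n \<le> \<Delta> * (s * t) \<and> 0 < n \<bullet> \<alpha>' + k \<and> n \<bullet> \<alpha>' + k < Y / D"
          have "(\<exists>l::int. \<Phi> n k = of_int l *\<^sub>R pv) \<or> (\<exists>l::int. \<Phi> n k = pb + of_int l *\<^sub>R pv)"
            using rows[rule_format, OF \<Phi>I[of n k]] a unfolding nf val vp by blast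
          then show "(\<exists>l::int. n = of_int l *\<^sub>R v \<and> k = of_int l * kv) \<or>
            (\<exists>l::int. n = b + of_int l *\<^sub>R v \<and> k = kb + of_int l * kv)"
            unfolding v(1) b(1) \<Phi>add unfolding \<Phi>scale by (meson \<Phi>inj)
        qed
        show "\<forall>l::int. norm (b + of_int l *\<^sub>R v) \<le> \<Delta> * (s * t) \<longrightarrow>
          0 < (b + of_int l *\<^sub>R v) \<bullet> \<alpha>' + (kb + of_int l * kv) \<and>
          (b + of_int l *\<^sub>R v) \<bullet> \<alpha>' + (kb + of_int l * kv) < Y / D"
          using brow unfolding v(1) b(1) \<Phi>add val nf vp .
      qed
    qed
    ultimately show ?thesis unfolding t_def[symmetric] tD by blast
  qed
  then show thesis using that sC by blast
qed

text \<open>Holes at a separated scale \<tau> have size and distance of the same order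
  \<tau>^-(d+1), so their ratio is fixed. Arbitrarily large separated scales give arbitrarily small
  holes and at the same time push the structured scale \<open>s * \<tau>\<close> beyond
  \<open>T0\<close>.\<close>

lemma negligible_not_row_structured:
  fixes e :: "real ^ 'n"
  assumes card: "CARD('n) \<ge> 2" and e: "norm e = 1" and pos: "0 < \<epsilon>" "0 < \<delta>" "\<delta> \<le> 1 / 4" "0 < \<Delta>"
    and c: "0 < c" "c < 1"
  shows "negligible {\<alpha>. (\<forall>\<tau>0. \<exists>\<tau>\<ge>\<tau>0. separated \<alpha> \<tau> c) \<and> (\<forall>T\<ge>T0. \<not> row_structured e \<epsilon> \<delta> \<Delta> T \<alpha>)}"
    (is "negligible ?A")
proof -
  obtain s C \<kappa> where sC: "0 < s" "0 < C" "0 < \<kappa>" and hole: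
    "\<And>\<alpha> \<tau>. separated \<alpha> \<tau> c \<Longrightarrow> 0 < \<tau> \<Longrightarrow>
       \<exists>\<beta>. norm (\<beta> - \<alpha>) \<le> C / real \<tau> ^ (CARD('n) + 1) \<and>
         (\<forall>\<alpha>'\<in>ball \<beta> (\<kappa> / real \<tau> ^ (CARD('n) + 1)). row_structured e \<epsilon> \<delta> \<Delta> (s * real \<tau>) \<alpha>')"
    using structured_hole[OF card e pos c] by metis
  define good where "good = {\<alpha>. \<exists>T\<ge>T0. row_structured e \<epsilon> \<delta> \<Delta> T \<alpha>}"
  \<comment> \<open>Taking the interior gives closedness without any study of \<open>good\<close>,
    and loses nothing, as the holes are open balls of good points.\<close>
  define F where "F = - interior good"
  show ?thesis
  proof (rule negligible_porous)
    show "closed F" by (simp add: F_def closed_def)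
    show "?A \<subseteq> F"
    proof
      fix x assume "x \<in> ?A"
      then have "x \<notin> good" by (auto simp: good_def)
      then show "x \<in> F" using interior_subset by (auto simp: F_def)
    qed
    \<comment> \<open>The hole has radius \<kappa>/Q in a ball of radius (C + \<kappa>)/Q; the
      factor 2 leaves room for a closed ball inside the open hole.\<close>
    show "0 < \<kappa> / (2 * (C + \<kappa>))" using sC by simp
    fix a r assume a: "a \<in> ?A" and r: "0 < (r :: real)"
    obtain m1 :: nat where m1: "T0 / s \<le> real m1" using real_arch_simple by blast
    obtain m2 :: nat where m2: "(C + \<kappa>) / r < real m2" using reals_Archimedean2 by blast
    obtain \<tau> where \<tau>: "\<tau> \<ge> max 1 (max m1 m2)" "separated a \<tau> c" using a by blast
    define Q where "Q = real \<tau> ^ (CARD('n) + 1)"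
    have "real \<tau> ^ 1 \<le> Q" unfolding Q_def using \<tau>(1) by (intro power_increasing) auto
    then have Q: "real \<tau> \<le> Q" "0 < Q" using \<tau>(1) by auto
    obtain \<beta> where \<beta>: "norm (\<beta> - a) \<le> C / Q" "\<forall>\<alpha>'\<in>ball \<beta> (\<kappa> / Q). row_structured e \<epsilon> \<delta> \<Delta> (s * real \<tau>) \<alpha>'"
      using hole[OF \<tau>(2)] \<tau>(1) unfolding Q_def by auto
    define S where "S = (C + \<kappa>) / Q"
    have S: "0 < S" using sC Q by (simp add: S_def)
    have "S < r"
    proof -
      have "(C + \<kappa>) / r < Q" using m2 \<tau>(1) Q by linarith
      then show ?thesis using r Q by (simp add: S_def field_simps)
    qed
    have "\<kappa> / (2 * X) * (X / Q) = \<kappa> / Q / 2" if "X \<noteq> 0" for X using that by simp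
    from this[of "C + \<kappa>"] have kS: "\<kappa> / (2 * (C + \<kappa>)) * S = \<kappa> / Q / 2"
      unfolding S_def using sC by linarith
    have "T0 \<le> s * real \<tau>"
    proof -
      have "T0 / s \<le> real \<tau>" using m1 \<tau>(1) by linarith
      then show ?thesis using sC by (simp add: divide_le_eq mult.commute)
    qed
    then have "ball \<beta> (\<kappa> / Q) \<subseteq> good" using \<beta>(2) by (auto simp: good_def)
    then have ball: "ball \<beta> (\<kappa> / Q) \<subseteq> interior good" by (intro interior_maximal) auto
    have "cball \<beta> (\<kappa> / Q / 2) \<subseteq> cball a S - F"
    proof
      fix x assume x: "x \<in> cball \<beta> (\<kappa> / Q / 2)"
      have k: "0 < \<kappa> / Q" using sC Q by simp
      then have "x \<in> ball \<beta> (\<kappa> / Q)" using x by auto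
      then have "x \<notin> F" using ball by (auto simp: F_def)
      moreover have "dist a x \<le> dist a \<beta> + dist \<beta> x" by (rule dist_triangle)
      then have "dist a x \<le> S" using x k \<beta>(1) by (simp add: S_def add_divide_distrib dist_norm norm_minus_commute)
      ultimately show "x \<in> cball a S - F" by simp
    qed
    then show "\<exists>s b. 0 < s \<and> s < r \<and> cball b (\<kappa> / (2 * (C + \<kappa>)) * s) \<subseteq> cball a s - F"
      using S \<open>S < r\<close> kS by (intro exI[of _ S] exI[of _ \<beta>]) simp
  qed
qed

section \<open>Assembly of the set of full measure\<close>

lemma negligible_countable_UN:
  assumes "countable X" "\<And>x. x \<in> X \<Longrightarrow> negligible (f x)"
  shows "negligible (\<Union>x\<in>X. f x)"
  using assms by (intro negligible_countable_Union) auto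

text \<open>Only an eventual ratio below 2 matters: the first member that reaches \<open>T\<close>
  has a predecessor below \<open>T\<close> and so cannot exceed \<open>2 * T\<close>.\<close>

lemma subexponential_hits:
  assumes "subexponential R"
  shows "\<exists>T1. \<forall>T\<ge>T1. \<exists>i\<ge>N. T \<le> R i \<and> R i \<le> 2 * T"
proof -
  have R: "0 < R 0" "strict_mono R" "filterlim R at_top sequentially" "(\<lambda>i. R (Suc i) / R i) \<longlonglongrightarrow> 1"
    using assms by (auto simp: subexponential_def)
  have Rpos: "0 < R i" for i using R(1) strict_mono_less_eq[OF R(2), of 0 i] by simp
  have "eventually (\<lambda>i. R (Suc i) / R i < 2) sequentially"
    by (rule order_tendstoD(2)[OF R(4)]) simp
  then obtain m where m: "\<And>i. m \<le> i \<Longrightarrow> R (Suc i) / R i < 2" by (auto simp: eventually_sequentially)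
  define k where "k = max m N"
  have "\<exists>i\<ge>N. T \<le> R i \<and> R i \<le> 2 * T" if T: "R k + 1 \<le> T" for T
  proof -
    have "\<exists>i. T \<le> R i" using R(3) by (auto simp: filterlim_at_top eventually_sequentially)
    then have le: "T \<le> R (LEAST i. T \<le> R i)" by (rule LeastI_ex)
    define i where "i = (LEAST i. T \<le> R i)"
    have "k < i"
    proof (rule ccontr)
      assume "\<not> k < i"
      then have "R i \<le> R k" using R(2) by (simp add: strict_mono_less_eq)
      then show False using le T by (simp add: i_def)
    qed
    then obtain i' where i': "i = Suc i'" "k \<le> i'" by (cases i) auto
    have "R i' < T" using not_less_Least[of i' "\<lambda>i. T \<le> R i"] i' by (simp add: i_def)
    moreover have "R i < 2 * R i'" using m[of i'] i' Rpos[of i'] by (simp add: k_def divide_less_eq)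
    ultimately have "R i \<le> 2 * T" by linarith
    then show ?thesis using le \<open>k < i\<close> by (intro exI[of _ i]) (auto simp: i_def k_def)
  qed
  then show ?thesis by blast
qed

theorem theorem1p1:
  assumes "CARD('n) \<ge> 2"
  shows "\<exists>P :: (real ^ 'n) set. - P \<in> null_sets lebesgue \<and>
    (\<forall>D \<alpha> R. bounded D \<and> convex D \<and> interior D \<noteq> {} \<and> \<alpha> \<in> P \<and> subexponential R \<longrightarrow>
       (SUP i. ereal (real (num_gaps \<alpha> (scale_set (R i) D)))) = \<infinity> \<and>
       liminf (\<lambda>i. ereal (real (num_gaps \<alpha> (scale_set (R i) D)))) < \<infinity>)"
proof -
  obtain E :: "(real ^ 'n) set" where E: "countable E" "E \<subseteq> sphere 0 1" "sphere 0 1 \<subseteq> closure E"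
    by (rule separable)
  define c where "c i = 1 / (real i + 2)" for i
  have c: "0 < c i" "c i < 1" for i by (auto simp: c_def)
  have clim: "c \<longlonglongrightarrow> 0" unfolding c_def by real_asymp
  \<comment> \<open>The offset 4 respects the bound 1/4 on the angular tolerance.\<close>
  define \<eta> where "\<eta> j = 1 / (real j + 4)" for j
  have \<eta>: "0 < \<eta> j" "\<eta> j \<le> 1 / 4" for j by (auto simp: \<eta>_def divide_simps)
  define nonsing where "nonsing i = {\<alpha> :: real ^ 'n. \<forall>\<tau>0. \<exists>\<tau>\<ge>\<tau>0. separated \<alpha> \<tau> (c i)}" for i
  define rec where "rec e j T = {\<alpha> :: real ^ 'n. \<exists>T'\<ge>T. row_structured e (\<eta> j) (\<eta> j) (1 / \<eta> j) T' \<alpha>}" for e j T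
  \<comment> \<open>One constant \<open>c i\<close> with infinitely many separated scales serves the
    lower limit. For the supremum every direction, every accuracy and arbitrarily large structured
    scales are demanded.\<close>
  define P where "P = (\<Union>i. nonsing i) \<inter> (\<Inter>e\<in>E. \<Inter>j. \<Inter>m::nat. rec e j (real m))"
  have "negligible (- P)"
  proof -
    \<comment> \<open>Recurrence is only known for points with separated scales; hence its failure
      is split over the constants \<open>c i\<close>.\<close>
    have "- P \<subseteq> - (\<Union>i. nonsing i) \<union> (\<Union>e\<in>E. \<Union>j. \<Union>m::nat. \<Union>i. nonsing i - rec e j (real m))"
      by (auto simp: P_def)
    moreover have "negligible (- (\<Union>i. nonsing i))"
    proof -
      have "- (\<Union>i. nonsing i) = {\<alpha>. \<forall>i. \<exists>\<tau>0. \<forall>\<tau>\<ge>\<tau>0. \<not> separated \<alpha> \<tau> (c i)}"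
        by (simp add: nonsing_def set_eq_iff)
      then show ?thesis using negligible_eventually_not_separated[OF c(1) clim] by simp
    qed
    moreover have "negligible (\<Union>e\<in>E. \<Union>j. \<Union>m::nat. \<Union>i. nonsing i - rec e j (real m))"
    proof -
      have "negligible (nonsing i - rec e j (real m))" if "e \<in> E" for i e j and m :: nat
      proof -
        have "norm e = 1" using that E(2) by auto
        then have "negligible {\<alpha>. (\<forall>\<tau>0. \<exists>\<tau>\<ge>\<tau>0. separated \<alpha> \<tau> (c i)) \<and>
            (\<forall>T\<ge>real m. \<not> row_structured e (\<eta> j) (\<eta> j) (1 / \<eta> j) T \<alpha>)}"
          using \<eta>[of j] by (intro negligible_not_row_structured assms c) auto
        moreover have "nonsing i - rec e j (real m) = {\<alpha>. (\<forall>\<tau>0. \<exists>\<tau>\<ge>\<tau>0. separated \<alpha> \<tau> (c i)) \<and>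
            (\<forall>T\<ge>real m. \<not> row_structured e (\<eta> j) (\<eta> j) (1 / \<eta> j) T \<alpha>)}"
          by (auto simp: nonsing_def rec_def)
        ultimately show ?thesis by simp
      qed
      then show ?thesis
        by (intro negligible_countable_UN E(1) countableI_type)
    qed
    ultimately show ?thesis by (meson negligible_Un negligible_subset)
  qed
  then have "- P \<in> null_sets lebesgue" by (simp add: negligible_iff_null_sets)
  moreover have "(SUP i. ereal (real (num_gaps \<alpha> (scale_set (R i) D)))) = \<infinity> \<and>
       liminf (\<lambda>i. ereal (real (num_gaps \<alpha> (scale_set (R i) D)))) < \<infinity>"
    if D: "bounded D" "convex D" "interior D \<noteq> {}" and \<alpha>: "\<alpha> \<in> P" and R: "subexponential R" for D \<alpha> R
  proof
    show "(SUP i. ereal (real (num_gaps \<alpha> (scale_set (R i) D)))) = \<infinity>"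
    proof (rule SUP_PInfty)
      fix N :: nat
      obtain e0 \<eta>0 T0 where e0: "norm e0 = 1" "0 < \<eta>0" and many:
        "\<And>\<alpha> T R. row_structured e0 \<eta>0 \<eta>0 (1 / \<eta>0) T \<alpha> \<Longrightarrow> T0 \<le> T \<Longrightarrow> T \<le> R \<Longrightarrow> R \<le> 2 * T \<Longrightarrow>
           N \<le> num_gaps \<alpha> (scale_set R D)"
        using many_gaps[OF assms D, of N] by blast
      have "e0 \<in> closure E" using E(3) e0(1) by auto
      then obtain e where e: "e \<in> E" "dist e e0 < \<eta>0 / 2"
        using closure_approachable[of e0 E] half_gt_zero[OF e0(2)] by blast
      obtain j :: nat where j: "2 / \<eta>0 < real j" using reals_Archimedean2 by blast
      have \<eta>j: "\<eta> j \<le> \<eta>0 / 2" "1 / \<eta>0 \<le> 1 / \<eta> j"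
      proof -
        have "2 < \<eta>0 * real j" using j e0(2) by (simp add: divide_less_eq mult.commute)
        then show "\<eta> j \<le> \<eta>0 / 2" using e0(2) by (simp add: \<eta>_def divide_le_eq le_divide_eq algebra_simps)
        then show "1 / \<eta>0 \<le> 1 / \<eta> j" using e0(2) \<eta>(1)[of j] by (intro divide_left_mono) auto
      qed
      obtain T1 where T1: "\<And>T. T1 \<le> T \<Longrightarrow> \<exists>i\<ge>0. T \<le> R i \<and> R i \<le> 2 * T"
        using subexponential_hits[OF R, of 0] by blast
      obtain m :: nat where m: "max 0 (max T0 T1) \<le> real m" using real_arch_simple by blast
      have "\<alpha> \<in> rec e j (real m)" using \<alpha> e(1) by (auto simp: P_def)
      then obtain T where T: "real m \<le> T" "row_structured e (\<eta> j) (\<eta> j) (1 / \<eta> j) T \<alpha>" by (auto simp: rec_def)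
      \<comment> \<open>Half of the tolerance pays for replacing the direction \<open>e0\<close> by
        \<open>e\<close>, the other half covers \<open>\<eta> j\<close>.\<close>
      have "row_structured e0 \<eta>0 \<eta>0 (1 / \<eta>0) T \<alpha>"
        by (rule row_structured_mono[OF T(2), of \<eta>0 "\<eta>0 / 2" "1 / \<eta>0" e0 \<eta>0])
          (use \<eta>j e(2) e0(2) T(1) m in \<open>auto simp: dist_norm\<close>)
      moreover obtain i where "T \<le> R i" "R i \<le> 2 * T" using T1[of T] T(1) m by auto
      ultimately have "N \<le> num_gaps \<alpha> (scale_set (R i) D)" using many T(1) m by auto
      then show "\<exists>i\<in>UNIV. ereal (real N) \<le> ereal (real (num_gaps \<alpha> (scale_set (R i) D)))" by auto
    qed
    obtain i where i: "\<alpha> \<in> nonsing i" using \<alpha> by (auto simp: P_def)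
    obtain \<mu> B where \<mu>: "0 < \<mu>" and few:
      "\<And>\<alpha> \<tau> R. separated \<alpha> \<tau> (c i) \<Longrightarrow> 0 < \<tau> \<Longrightarrow> \<mu> * real \<tau> \<le> R \<Longrightarrow> R \<le> 2 * \<mu> * real \<tau> \<Longrightarrow>
         num_gaps \<alpha> (scale_set R D) \<le> B"
      using num_gaps_bounded[OF D(1,3) c] by metis
    have often: "\<exists>k\<ge>N. num_gaps \<alpha> (scale_set (R k) D) \<le> B" for N
    proof -
      obtain T1 where T1: "\<And>T. T1 \<le> T \<Longrightarrow> \<exists>i\<ge>N. T \<le> R i \<and> R i \<le> 2 * T"
        using subexponential_hits[OF R, of N] by blast
      obtain m :: nat where m: "T1 / \<mu> \<le> real m" using real_arch_simple by blast
      obtain \<tau> where \<tau>: "max 1 m \<le> \<tau>" "separated \<alpha> \<tau> (c i)" using i unfolding nonsing_def by blast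
      have "T1 / \<mu> \<le> real \<tau>" using m \<tau>(1) by linarith
      then have "T1 \<le> \<mu> * real \<tau>" using \<mu> by (simp add: divide_le_eq mult.commute)
      then obtain k where "N \<le> k" "\<mu> * real \<tau> \<le> R k" "R k \<le> 2 * (\<mu> * real \<tau>)" using T1 by blast
      then show ?thesis using few[OF \<tau>(2)] \<tau>(1) by (intro exI[of _ k]) auto
    qed
    have "liminf (\<lambda>i. ereal (real (num_gaps \<alpha> (scale_set (R i) D)))) \<le> ereal (real B)"
    proof (rule ccontr)
      assume "\<not> ?thesis"
      then have "ereal (real B) < liminf (\<lambda>i. ereal (real (num_gaps \<alpha> (scale_set (R i) D))))" by simp
      from less_LiminfD[OF this] obtain N where
        "\<And>k. N \<le> k \<Longrightarrow> B < num_gaps \<alpha> (scale_set (R k) D)" by (auto simp: eventually_sequentially)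
      then show False using often[of N] by (meson not_less)
    qed
    then show "liminf (\<lambda>i. ereal (real (num_gaps \<alpha> (scale_set (R i) D)))) < \<infinity>"
      using less_PInf_Ex_of_nat by (metis ereal_infty_less(1) ereal_less_eq(1) not_le PInfty_neq_ereal(1))
  qed
  ultimately show ?thesis by blast
qed

end
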